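(* Let $\lambda_0\in\mathbb R$, $s_0\in(0,1]$, and assume $\dim\ker(N_{s_0}-s_0^2\lambda_0)=n$ with basis $\{\mathbf u_{s_0}^{(1)},\dots,\mathbf u_{s_0}^{(n)}\}$. Then there exists an $n\times n$ matrix $M(\lambda,s)$, defined for $(\lambda,s)\in\mathbb R^2$ near $(\lambda_0,s_0)$, such that $s^2\lambda\in\operatorname{Spec}(N_s)$ if and only if $\det M(\lambda,s)=0$. This matrix satisfies $M(\lambda_0,s_0)=0$ and $$\frac{\partial M_{ij}}{\partial\lambda}(\lambda_0,s_0)=-s_0^2\big\langle\mathbf u_{s_0}^{(i)},S\mathbf u_{s_0}^{(j)}\big\rangle,\qquad \frac{\partial M_{ij}}{\partial s}(\lambda_0,s_0)=\big\langle(\partial_sB_{s_0}-2s_0\lambda_0)\mathbf u_{s_0}^{(i)},S\mathbf u_{s_0}^{(j)}\big\rangle .$$ Moreover, if $\langle\mathbf u_{s_0}^{(i)},S\mathbf u_{s_0}^{(j)}\rangle=0$ for all $i,j=1,\dots,n$, then $$\frac{\partial^2M_{ij}}{\partial\lambda^2}(\lambda_0,s_0)=-2s_0^4\big\langle\mathbf v_{s_0}^{(i)},S\mathbf u_{s_0}^{(j)}\big\rangle,$$ where $\mathbf v_{s_0}^{(i)}\in\operatorname{dom}(N_{s_0})$ solves $(N_{s_0}-s_0^2\lambda_0)\mathbf v_{s_0}^{(i)}=\mathbf u_{s_0}^{(i)}$.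
   Context: $\ell>0$ and $g,h$ are real-valued $C^2$ functions on $[0,\ell]$. Put $L_+^s=-\partial_{xx}-s^2g(sx)$, $L_-^s=-\partial_{xx}-s^2h(sx)$ and $N_s=\begin{pmatrix}0&-L_-^s\\L_+^s&0\end{pmatrix}$, an unbounded operator in $L^2(0,\ell)^2$ with domain $\operatorname{dom}(N_s)=(H^2(0,\ell)\cap H^1_0(0,\ell))^2$. Thus $N_s=\begin{pmatrix}0&\partial_{xx}\\-\partial_{xx}&0\end{pmatrix}+B_s(x)$ with $B_s(x)=s^2B(sx)$, $B(x)=\begin{pmatrix}0&h(x)\\-g(x)&0\end{pmatrix}$, and $\partial_sB_s=2sB(sx)+s^2xB'(sx)$. $S=\begin{pmatrix}0&1\\1&0\end{pmatrix}$, $\langle\cdot,\cdot\rangle$ is the $L^2$ inner product, and basis functions are real-valued. Under the orthogonality condition the equation for $\mathbf v_{s_0}^{(i)}$ is solvable, and the stated expressions do not depend on the choice of solution. When values $s>1$ occur (for $s_0=1$), $g,h$ are taken to be defined and $C^2$ on $[0,\ell']$ for some $\ell'>\ell$. *)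

theory Defs
  imports "HOL-Analysis.Analysis" "Jordan_Normal_Form.Determinant"
begin

text \<open>
  Elements of the Lebesgue and Sobolev spaces on the interval from 0 to \<open>l\<close> are represented by
  functions on the whole real line. Only their values inside the interval matter, and equality of
  elements is equality almost everywhere there.
\<close>

abbreviation lebI :: "real \<Rightarrow> real measure"
  where "lebI l \<equiv> lebesgue_on {0<..<l}"

definition L2 :: "real \<Rightarrow> (real \<Rightarrow> complex) set"
  where "L2 l = {f \<in> borel_measurable (lebI l). integrable (lebI l) (\<lambda>x. (norm (f x))\<^sup>2)}"

definition ip :: "real \<Rightarrow> (real \<Rightarrow> complex) \<Rightarrow> (real \<Rightarrow> complex) \<Rightarrow> complex"
  where "ip l f w = (LINT x|lebI l. f x * cnj (w x))"

definition nrm :: "real \<Rightarrow> (real \<Rightarrow> complex) \<Rightarrow> real"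
  where "nrm l f = sqrt (LINT x|lebI l. (norm (f x))\<^sup>2)"

text \<open>
  Sobolev spaces are defined as in Brezis, \<^emph>\<open>Functional Analysis, Sobolev Spaces and Partial
  Differential Equations\<close>, Chapter 8: weak derivatives are tested against compactly supported
  \<open>C\<^sup>1\<close> functions, and \<open>H10\<close> is the closure of these functions in \<open>H1\<close>.
\<close>

definition C1c :: "real \<Rightarrow> (real \<Rightarrow> complex) set"
  where "C1c l = {\<phi>. \<phi> C1_differentiable_on UNIV \<and>
                     (\<exists>K. compact K \<and> K \<subseteq> {0<..<l} \<and> (\<forall>x. x \<notin> K \<longrightarrow> \<phi> x = 0))}"

definition weak_deriv :: "real \<Rightarrow> (real \<Rightarrow> complex) \<Rightarrow> (real \<Rightarrow> complex) \<Rightarrow> bool"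
  where "weak_deriv l f f' \<longleftrightarrow>
    (\<forall>\<phi>\<in>C1c l. (LINT x|lebI l. f x * vector_derivative \<phi> (at x)) = - (LINT x|lebI l. f' x * \<phi> x))"

definition H1 :: "real \<Rightarrow> (real \<Rightarrow> complex) set"
  where "H1 l = {f \<in> L2 l. \<exists>f'\<in>L2 l. weak_deriv l f f'}"

text \<open>The chosen weak derivative; for \<open>f \<in> H1 l\<close> it is unique up to null sets.\<close>

definition wderiv :: "real \<Rightarrow> (real \<Rightarrow> complex) \<Rightarrow> (real \<Rightarrow> complex)"
  where "wderiv l f = (SOME f'. f' \<in> L2 l \<and> weak_deriv l f f')"

definition H2 :: "real \<Rightarrow> (real \<Rightarrow> complex) set"
  where "H2 l = {f \<in> H1 l. wderiv l f \<in> H1 l}"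

definition H10 :: "real \<Rightarrow> (real \<Rightarrow> complex) set"
  where "H10 l = {f \<in> H1 l. \<exists>\<phi>. (\<forall>k::nat. \<phi> k \<in> C1c l) \<and>
     (\<lambda>k. nrm l (\<lambda>x. f x - \<phi> k x)) \<longlonglongrightarrow> 0 \<and>
     (\<lambda>k. nrm l (\<lambda>x. wderiv l f x - vector_derivative (\<phi> k) (at x))) \<longlonglongrightarrow> 0}"

text \<open>Elements of the product of two function spaces, i.e. two-component vector functions.\<close>

type_synonym vfun = "(real \<Rightarrow> complex) \<times> (real \<Rightarrow> complex)"

definition aeq :: "real \<Rightarrow> vfun \<Rightarrow> vfun \<Rightarrow> bool"
  where "aeq l u w \<longleftrightarrow> (AE x in lebI l. fst u x = fst w x \<and> snd u x = snd w x)"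

definition real_valued :: "real \<Rightarrow> vfun \<Rightarrow> bool"
  where "real_valued l u \<longleftrightarrow> (AE x in lebI l. fst u x \<in> \<real> \<and> snd u x \<in> \<real>)"

definition ip2 :: "real \<Rightarrow> vfun \<Rightarrow> vfun \<Rightarrow> complex"
  where "ip2 l u w = ip l (fst u) (fst w) + ip l (snd u) (snd w)"

definition nrm2 :: "real \<Rightarrow> vfun \<Rightarrow> real"
  where "nrm2 l u = sqrt ((nrm l (fst u))\<^sup>2 + (nrm l (snd u))\<^sup>2)"

definition lin_comb :: "nat \<Rightarrow> (nat \<Rightarrow> complex) \<Rightarrow> (nat \<Rightarrow> vfun) \<Rightarrow> vfun"
  where "lin_comb n c u = (\<lambda>x. \<Sum>k<n. c k * fst (u k) x, \<lambda>x. \<Sum>k<n. c k * snd (u k) x)"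

definition Smat :: "vfun \<Rightarrow> vfun"
  where "Smat u = (snd u, fst u)"

text \<open>The operator \<open>T - \<mu>\<close>.\<close>

definition shift :: "(vfun \<Rightarrow> vfun) \<Rightarrow> complex \<Rightarrow> vfun \<Rightarrow> vfun"
  where "shift T \<mu> u = (\<lambda>x. fst (T u) x - \<mu> * fst u x, \<lambda>x. snd (T u) x - \<mu> * snd u x)"

text \<open>
  Spectrum of an unbounded operator \<open>T\<close> with domain \<open>D\<close> in the product of two copies of \<open>L2 l\<close>:
  the complement of the set of \<open>\<mu>\<close> for which \<open>T - \<mu>\<close> is a bijection from \<open>D\<close> onto the whole
  space with bounded inverse.
\<close>

definition resolvent_set :: "real \<Rightarrow> vfun set \<Rightarrow> (vfun \<Rightarrow> vfun) \<Rightarrow> complex set"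
  where "resolvent_set l D T = {\<mu>.
     (\<forall>w\<in>L2 l \<times> L2 l. \<exists>u\<in>D. aeq l (shift T \<mu> u) w) \<and>
     (\<forall>u\<in>D. \<forall>v\<in>D. aeq l (shift T \<mu> u) (shift T \<mu> v) \<longrightarrow> aeq l u v) \<and>
     (\<exists>C. \<forall>u\<in>D. nrm2 l u \<le> C * nrm2 l (shift T \<mu> u))}"

definition Spec :: "real \<Rightarrow> vfun set \<Rightarrow> (vfun \<Rightarrow> vfun) \<Rightarrow> complex set"
  where "Spec l D T = - resolvent_set l D T"

definition kernel :: "real \<Rightarrow> vfun set \<Rightarrow> (vfun \<Rightarrow> vfun) \<Rightarrow> vfun set"
  where "kernel l D T = {u \<in> D. aeq l (T u) (\<lambda>x. 0, \<lambda>x. 0)}"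

text \<open>
  The functions \<open>u 0, \<dots>, u (n - 1)\<close> form a basis of the space \<open>V\<close> modulo almost everywhere
  equality; in particular this space has dimension \<open>n\<close>.
\<close>

definition is_basis :: "real \<Rightarrow> vfun set \<Rightarrow> nat \<Rightarrow> (nat \<Rightarrow> vfun) \<Rightarrow> bool"
  where "is_basis l V n u \<longleftrightarrow>
     (\<forall>i<n. u i \<in> V) \<and>
     (\<forall>c. aeq l (lin_comb n c u) (\<lambda>x. 0, \<lambda>x. 0) \<longrightarrow> (\<forall>i<n. c i = 0)) \<and>
     (\<forall>w\<in>V. \<exists>c. aeq l w (lin_comb n c u))"

text \<open>\<open>C\<^sup>2\<close> functions on a closed interval, with one-sided derivatives at the end points.\<close>

definition C2_on :: "real \<Rightarrow> real \<Rightarrow> (real \<Rightarrow> real) \<Rightarrow> bool"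
  where "C2_on a b f \<longleftrightarrow> (\<exists>f' f''.
     (\<forall>x\<in>{a..b}. (f has_real_derivative f' x) (at x within {a..b})) \<and>
     (\<forall>x\<in>{a..b}. (f' has_real_derivative f'' x) (at x within {a..b})) \<and>
     continuous_on {a..b} f'')"

text \<open>The operator \<open>f \<mapsto> - f'' - s\<^sup>2 q(s x) f\<close>; it is \<open>L\<^sub>+\<close> for \<open>q = g\<close> and \<open>L\<^sub>-\<close> for \<open>q = h\<close>.\<close>

definition Lop :: "real \<Rightarrow> (real \<Rightarrow> real) \<Rightarrow> real \<Rightarrow> (real \<Rightarrow> complex) \<Rightarrow> (real \<Rightarrow> complex)"
  where "Lop l q s f = (\<lambda>x. - wderiv l (wderiv l f) x - of_real (s\<^sup>2 * q (s * x)) * f x)"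

definition domN :: "real \<Rightarrow> vfun set"
  where "domN l = (H2 l \<inter> H10 l) \<times> (H2 l \<inter> H10 l)"

definition Nop :: "real \<Rightarrow> (real \<Rightarrow> real) \<Rightarrow> (real \<Rightarrow> real) \<Rightarrow> real \<Rightarrow> vfun \<Rightarrow> vfun"
  where "Nop l g h s u = (\<lambda>x. - Lop l h s (snd u) x, Lop l g s (fst u))"

text \<open>
  \<open>\<partial>\<^sub>s B\<^sub>s = 2 s B(s x) + s\<^sup>2 x B'(s x)\<close> acting on \<open>u\<close>, where \<open>B\<close> has the off-diagonal
  entries \<open>h\<close> (upper right) and \<open>- g\<close> (lower left) and zero diagonal.
\<close>

definition dsB :: "(real \<Rightarrow> real) \<Rightarrow> (real \<Rightarrow> real) \<Rightarrow> real \<Rightarrow> vfun \<Rightarrow> vfun"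
  where "dsB g h s u =
    (\<lambda>x. of_real (2 * s * h (s * x) + s\<^sup>2 * x * deriv h (s * x)) * snd u x,
     \<lambda>x. - of_real (2 * s * g (s * x) + s\<^sup>2 * x * deriv g (s * x)) * fst u x)"

end

theory Submission
  imports Defs
begin

text \<open>
  The proof is a Lyapunov-Schmidt reduction carried out on an interval instead of a function space.
  Written in second derivatives, \<open>(N\<^sub>s - s\<^sup>2 t) u = w\<close> is a linear system \<open>u'' = A u + f\<close> for a pair of
  functions with \<open>u(0) = u(l) = 0\<close>, where \<open>A\<close> is a real, continuous coefficient that depends on \<open>(t, s)\<close>.
  Elements of the domain are exactly the double integrals of square integrable functions with
  vanishing value at \<open>l\<close> (\<open>H2_H10_representation\<close>, \<open>H2_H10I\<close>), so everything can be said about continuous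
  solutions of Volterra equations. The value at \<open>l\<close> of a solution is an affine function of its initial
  slope in a space of finite dimension; hence injectivity implies solvability with a bound
  (\<open>bsol_well_posed\<close>), and \<open>s\<^sup>2 t\<close> is in the spectrum if and only if the homogeneous problem has a
  nontrivial real solution (\<open>Spec_iff_bsol\<close>).

  Let \<open>y\<^sub>i\<close> be the real basis of the kernel at \<open>(\<lambda>\<^sub>0, s\<^sub>0)\<close> and \<open>a\<^sub>i\<close> the initial slopes. The Green identity
  (\<open>Green_identity\<close>), in which the swap \<open>S\<close> turns the operator into its adjoint, says that a solution \<open>w\<close>
  with source \<open>f\<close> and \<open>w(0) = 0\<close> satisfies \<open>\<beta>\<^sub>j \<bullet> w(l) = \<integral> f\<^sub>2 y\<^sub>j\<^sub>2 - f\<^sub>1 y\<^sub>j\<^sub>1\<close>, where \<open>\<beta>\<^sub>j\<close> is the derivative of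
  \<open>y\<^sub>j\<close> at \<open>l\<close> up to a sign. The kernel is removed by bordering: the condition \<open>u(l) = 0\<close> is replaced by
  \<open>u(l) + Z u'(0) = \<zeta>\<close> with a linear map \<open>Z\<close> that sends \<open>a\<^sub>i\<close> to \<open>\<beta>\<^sub>i\<close> and has range in the span of the
  \<open>\<beta>\<^sub>i\<close>. This problem is uniquely solvable at \<open>(\<lambda>\<^sub>0, s\<^sub>0)\<close> (\<open>border_exists\<close>) and, with uniform bounds, nearby
  (\<open>bsol_stable\<close>). Its solutions \<open>\<Phi>\<^sub>i(t, s)\<close> of the homogeneous equation with \<open>\<zeta> = \<beta>\<^sub>i\<close> continue the \<open>y\<^sub>i\<close>, and
  \<open>M\<^sub>i\<^sub>j = - \<beta>\<^sub>j \<bullet> \<Phi>\<^sub>i(l)\<close>. A combination of the \<open>\<Phi>\<^sub>i\<close> has its value at \<open>l\<close> in the span of the \<open>\<beta>\<^sub>j\<close>, so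
  this value vanishes if and only if \<open>M\<close> annihilates the coefficients; conversely every solution of the
  Dirichlet problem is such a combination (\<open>singular_iff\<close>).

  For the derivatives, \<open>\<Phi>\<^sub>i(t, s)\<close> is viewed as a solution at \<open>(\<lambda>\<^sub>0, s\<^sub>0)\<close> whose source is the change of the
  coefficient. The Green identity gives \<open>M\<^sub>i\<^sub>j = \<langle>(change of N\<^sub>s - s\<^sup>2 t) \<Phi>\<^sub>i, S y\<^sub>j\<rangle>\<close> (\<open>M_formula\<close>). The change is of
  first order, so the first derivatives only need that \<open>\<Phi>\<^sub>i\<close> is Lipschitz. For \<open>s = s\<^sub>0\<close> it is
  \<open>- (t - \<lambda>\<^sub>0) s\<^sub>0\<^sup>2\<close>, hence the second derivative is \<open>- 2 s\<^sub>0\<^sup>2 \<langle>\<partial>\<^sub>t \<Phi>\<^sub>i, S y\<^sub>j\<rangle>\<close>; under the orthogonality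
  condition \<open>\<partial>\<^sub>t \<Phi>\<^sub>i\<close> satisfies the boundary condition at \<open>l\<close> and equals \<open>s\<^sub>0\<^sup>2 v\<^sub>i\<close> up to the kernel
  (\<open>\<Psi>_boundary\<close>), to which the pairing is blind.
\<close>

section \<open>Volterra equations with double integrals\<close>

text \<open>A function with \<open>U(0) = 0\<close> and \<open>U'(0) = a\<close> is \<open>x \<mapsto> x *\<^sub>R a + dint U'' x\<close>. Working with this
  integrated form avoids second derivatives altogether: the same formula describes classical solutions
  and, when the integrand is only square integrable, elements of the operator domain.\<close>

definition dint :: "(real \<Rightarrow> 'b::euclidean_space) \<Rightarrow> real \<Rightarrow> 'b"
  where "dint f x = integral {0..x} (\<lambda>t. integral {0..t} f)"

lemma continuous_on_indefinite_integral:
  fixes f :: "real \<Rightarrow> 'b::euclidean_space"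
  assumes "f integrable_on {0..l}" "x \<le> l"
  shows "continuous_on {0..x} (\<lambda>t. integral {0..t} f)"
  using assms(2) by (intro continuous_on_subset[OF indefinite_integral_continuous_1[OF assms(1)]]) auto

lemma integrable_indefinite_integral:
  fixes f :: "real \<Rightarrow> 'b::euclidean_space"
  assumes "f integrable_on {0..l}" "x \<le> l"
  shows "(\<lambda>t. integral {0..t} f) integrable_on {0..x}"
  using continuous_on_indefinite_integral[OF assms] by (rule integrable_continuous_interval)

lemma integrable_initial:
  fixes f :: "real \<Rightarrow> 'b::euclidean_space"
  assumes "f integrable_on {0..l}" "x \<le> l"
  shows "f integrable_on {0..x}"
  using assms by (auto intro: integrable_on_subinterval)

lemma continuous_on_dint:
  assumes "f integrable_on {0..l}"
  shows "continuous_on {0..l} (dint f)"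
  unfolding dint_def using assms
  by (intro indefinite_integral_continuous_1 integrable_indefinite_integral[OF _ order_refl])

lemma dint_cong:
  assumes "\<And>r. r \<in> {0..x} \<Longrightarrow> f r = g r"
  shows "dint f x = dint g x"
  unfolding dint_def using assms by (intro integral_cong) auto

lemma dint_add:
  assumes "f integrable_on {0..l}" "g integrable_on {0..l}" "x \<in> {0..l}"
  shows "dint (\<lambda>r. f r + g r) x = dint f x + dint g x"
proof -
  have "dint (\<lambda>r. f r + g r) x = integral {0..x} (\<lambda>t. integral {0..t} f + integral {0..t} g)"
    unfolding dint_def using assms
    by (intro integral_cong integral_add integrable_initial[OF assms(1)] integrable_initial[OF assms(2)]) auto
  also have "\<dots> = dint f x + dint g x"
    unfolding dint_def using assms
    by (intro integral_add integrable_indefinite_integral[OF assms(1)] integrable_indefinite_integral[OF assms(2)]) auto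
  finally show ?thesis .
qed

lemma dint_bounded_linear:
  assumes "bounded_linear T" "f integrable_on {0..l}" "x \<in> {0..l}"
  shows "dint (\<lambda>r. T (f r)) x = T (dint f x)"
proof -
  have "dint (\<lambda>r. T (f r)) x = integral {0..x} (\<lambda>t. T (integral {0..t} f))"
    unfolding dint_def using assms
    by (intro integral_cong integral_linear[unfolded comp_def] integrable_initial[OF assms(2)]) auto
  also have "\<dots> = T (dint f x)"
    unfolding dint_def
    using integral_linear[OF integrable_indefinite_integral[OF assms(2), of x] assms(1)] assms(3)
    by (simp add: comp_def)
  finally show ?thesis .
qed

lemma dint_zero [simp]: "dint (\<lambda>r. 0) x = 0"
  by (simp add: dint_def)

text \<open>The weight is what makes the double integral a contraction, whatever the length of the
  interval.\<close>

lemma norm_dint_le_exp: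
  assumes f: "f integrable_on {0..x}" and x: "0 \<le> x" and \<gamma>: "0 < \<gamma>" and m: "0 \<le> m"
    and le: "\<And>r. r \<in> {0..x} \<Longrightarrow> norm (f r) \<le> m * exp (\<gamma> * r)"
  shows "norm (dint f x) \<le> m / \<gamma>\<^sup>2 * exp (\<gamma> * x)"
proof -
  have I: "((\<lambda>r. c * exp (\<gamma> * r)) has_integral (c / \<gamma> * exp (\<gamma> * t) - c / \<gamma> * exp (\<gamma> * 0))) {0..t}"
    if "0 \<le> t" for t c
    using \<gamma> by (intro fundamental_theorem_of_calculus that)
      (auto intro!: derivative_eq_intros simp flip: has_real_derivative_iff_has_vector_derivative)
  have 1: "norm (integral {0..t} f) \<le> m / \<gamma> * exp (\<gamma> * t)" if t: "t \<in> {0..x}" for t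
  proof -
    have "norm (integral {0..t} f) \<le> integral {0..t} (\<lambda>r. m * exp (\<gamma> * r))"
      using t le I[of t m] by (intro integral_norm_bound_integral integrable_initial[OF f]) auto
    also have "\<dots> = m / \<gamma> * exp (\<gamma> * t) - m / \<gamma>"
      using integral_unique[OF I[of t m]] t by simp
    also have "\<dots> \<le> m / \<gamma> * exp (\<gamma> * t)" using m \<gamma> by simp
    finally show ?thesis .
  qed
  have "norm (dint f x) \<le> integral {0..x} (\<lambda>r. m / \<gamma> * exp (\<gamma> * r))"
    unfolding dint_def using 1 I[of x "m / \<gamma>"] x
    by (intro integral_norm_bound_integral integrable_indefinite_integral[OF f]) auto
  also have "\<dots> = m / \<gamma> / \<gamma> * exp (\<gamma> * x) - m / \<gamma> / \<gamma>"
    using integral_unique[OF I[of x "m / \<gamma>"]] x by simp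
  also have "\<dots> \<le> m / \<gamma>\<^sup>2 * exp (\<gamma> * x)" using m \<gamma> by (simp add: power2_eq_square)
  finally show ?thesis .
qed

lemma norm_dint_le:
  assumes f: "f integrable_on {0..l}" and m: "0 \<le> m" and x: "x \<in> {0..l}"
    and le: "\<And>t. t \<in> {0..l} \<Longrightarrow> norm (integral {0..t} f) \<le> m"
  shows "norm (dint f x) \<le> m * l"
proof -
  have "norm (dint f x) \<le> integral {0..x} (\<lambda>t. m)"
    unfolding dint_def using x le
    by (intro integral_norm_bound_integral integrable_indefinite_integral[OF f]) auto
  also have "\<dots> = m * x" using x by simp
  also have "\<dots> \<le> m * l" using m x by (simp add: mult_left_mono)
  finally show ?thesis .
qed

lemma norm_dint_le_sup:
  assumes f: "f integrable_on {0..l}" and m: "0 \<le> m" and x: "x \<in> {0..l}"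
    and le: "\<And>t. t \<in> {0..l} \<Longrightarrow> norm (f t) \<le> m"
  shows "norm (dint f x) \<le> m * l\<^sup>2"
proof -
  have "norm (integral {0..t} f) \<le> m * l" if t: "t \<in> {0..l}" for t
  proof -
    have "norm (integral {0..t} f) \<le> integral {0..t} (\<lambda>t. m)"
      using t le by (intro integral_norm_bound_integral integrable_initial[OF f]) auto
    also have "\<dots> = m * t" using t by simp
    also have "\<dots> \<le> m * l" using m t by (simp add: mult_left_mono)
    finally show ?thesis .
  qed
  then have "norm (dint f x) \<le> (m * l) * l"
    using x m by (intro norm_dint_le[OF f]) auto
  then show ?thesis by (simp add: power2_eq_square)
qed

text \<open>The equation \<open>U'' = A U\<close> in integrated form; \<open>P\<close> carries the initial slope and the
  inhomogeneity.\<close>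

definition sol :: "real \<Rightarrow> (real \<Rightarrow> 'b \<Rightarrow> 'b) \<Rightarrow> (real \<Rightarrow> 'b) \<Rightarrow> (real \<Rightarrow> 'b::euclidean_space) \<Rightarrow> bool"
  where "sol l A P U \<longleftrightarrow> continuous_on {0..l} U \<and>
    (\<forall>x\<in>{0..l}. U x = P x + dint (\<lambda>r. A r (U r)) x)"

locale volterra =
  fixes A :: "real \<Rightarrow> 'b::euclidean_space \<Rightarrow> 'b" and l C :: real
  assumes l_pos: "0 < l" and C_nonneg: "0 \<le> C"
    and lin: "x \<in> {0..l} \<Longrightarrow> linear (A x)"
    and bnd: "x \<in> {0..l} \<Longrightarrow> norm (A x u) \<le> C * norm u"
    and cont: "continuous_on {0..l} U \<Longrightarrow> continuous_on {0..l} (\<lambda>x. A x (U x))"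
begin

lemma integrable_A: "continuous_on {0..l} U \<Longrightarrow> (\<lambda>x. A x (U x)) integrable_on {0..l}"
  by (intro integrable_continuous_interval cont)

lemma sol_add:
  assumes "sol l A P U" "sol l A Q V"
  shows "sol l A (\<lambda>x. P x + Q x) (\<lambda>x. U x + V x)"
  unfolding sol_def
proof safe
  show "continuous_on {0..l} (\<lambda>x. U x + V x)"
    using assms by (auto simp: sol_def intro: continuous_on_add)
  fix x assume x: "x \<in> {0..l}"
  have "dint (\<lambda>r. A r (U r + V r)) x = dint (\<lambda>r. A r (U r) + A r (V r)) x"
    using x by (intro dint_cong linear_add lin) auto
  also have "\<dots> = dint (\<lambda>r. A r (U r)) x + dint (\<lambda>r. A r (V r)) x"
    using assms x by (intro dint_add[of _ l] integrable_A) (auto simp: sol_def)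
  finally show "U x + V x = P x + Q x + dint (\<lambda>r. A r (U r + V r)) x"
    using assms x by (simp add: sol_def)
qed

lemma sol_scale:
  assumes "sol l A P U"
  shows "sol l A (\<lambda>x. c *\<^sub>R P x) (\<lambda>x. c *\<^sub>R U x)"
  unfolding sol_def
proof safe
  show "continuous_on {0..l} (\<lambda>x. c *\<^sub>R U x)"
    using assms by (auto simp: sol_def intro: continuous_intros)
  fix x assume x: "x \<in> {0..l}"
  have "dint (\<lambda>r. A r (c *\<^sub>R U r)) x = dint (\<lambda>r. c *\<^sub>R A r (U r)) x"
    using x by (intro dint_cong linear_scale lin) auto
  also have "\<dots> = c *\<^sub>R dint (\<lambda>r. A r (U r)) x"
    using assms x by (intro dint_bounded_linear[of _ _ l] integrable_A bounded_linear_scaleR_right)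
      (auto simp: sol_def)
  finally show "c *\<^sub>R U x = c *\<^sub>R P x + dint (\<lambda>r. A r (c *\<^sub>R U r)) x"
    using assms x by (simp add: sol_def scaleR_right_distrib)
qed

text \<open>The bound for solutions comes out of the weight \<open>exp (- (1 + 2 * C) * x)\<close>, for which the double
  integral at most halves the norm.\<close>

definition K0 :: real where "K0 = 2 * exp ((1 + 2 * C) * l)"

lemma K0_pos: "0 < K0" by (simp add: K0_def)

lemma half: "C / (1 + 2 * C)\<^sup>2 \<le> 1 / 2"
proof -
  have "2 * C \<le> (1 + 2 * C)\<^sup>2"
    using C_nonneg by (simp add: power2_eq_square algebra_simps)
  then show ?thesis using C_nonneg by (simp add: divide_simps)
qed

text \<open>At a maximum of the weighted norm the integral term is at most half of that maximum, so the
  other half is controlled by \<open>P\<close>. This covers uniqueness as well as a bound.\<close>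

lemma sol_bound:
  assumes s: "sol l A P U" and P: "\<And>x. x \<in> {0..l} \<Longrightarrow> norm (P x) \<le> \<kappa>" and x: "x \<in> {0..l}"
  shows "norm (U x) \<le> K0 * \<kappa>"
proof -
  define \<gamma> where "\<gamma> = 1 + 2 * C"
  have \<gamma>: "0 < \<gamma>" using C_nonneg by (simp add: \<gamma>_def)
  have U: "continuous_on {0..l} U" using s by (simp add: sol_def)
  define w where "w = (\<lambda>x. exp (- \<gamma> * x) * norm (U x))"
  have "continuous_on {0..l} w" unfolding w_def by (intro continuous_intros U)
  moreover have "{0..l} \<noteq> {}" using l_pos by auto
  ultimately obtain z where z: "z \<in> {0..l}" and max: "\<And>y. y \<in> {0..l} \<Longrightarrow> w y \<le> w z"
    using continuous_attains_sup[of "{0..l}" w] by auto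
  define m where "m = w z"
  have m0: "0 \<le> m" by (simp add: m_def w_def)
  have Um: "norm (U y) \<le> m * exp (\<gamma> * y)" if "y \<in> {0..l}" for y
  proof -
    have "exp (- \<gamma> * y) * norm (U y) \<le> m" using max[OF that] by (simp add: w_def m_def)
    then show ?thesis by (simp add: exp_minus field_simps)
  qed
  have "norm (dint (\<lambda>r. A r (U r)) z) \<le> (C * m) / \<gamma>\<^sup>2 * exp (\<gamma> * z)"
  proof (rule norm_dint_le_exp)
    show "(\<lambda>r. A r (U r)) integrable_on {0..z}"
      using z by (intro integrable_initial[OF integrable_A[OF U]]) auto
    show "norm (A r (U r)) \<le> C * m * exp (\<gamma> * r)" if "r \<in> {0..z}" for r
    proof -
      have "norm (A r (U r)) \<le> C * norm (U r)" using bnd that z by auto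
      also have "\<dots> \<le> C * (m * exp (\<gamma> * r))"
        using Um[of r] that z C_nonneg by (intro mult_left_mono) auto
      finally show ?thesis by (simp add: mult.assoc)
    qed
  qed (use z \<gamma> m0 C_nonneg in auto)
  then have "norm (U z) \<le> \<kappa> + C * m / \<gamma>\<^sup>2 * exp (\<gamma> * z)"
    using s z P[OF z] norm_triangle_ineq[of "P z" "dint (\<lambda>r. A r (U r)) z"] unfolding sol_def by auto
  moreover have "norm (U z) = m * exp (\<gamma> * z)"
    by (simp add: m_def w_def exp_minus field_simps)
  moreover have "C * m / \<gamma>\<^sup>2 * exp (\<gamma> * z) \<le> 1/2 * m * exp (\<gamma> * z)"
    using mult_right_mono[OF half m0] by (intro mult_right_mono) (auto simp: \<gamma>_def)
  ultimately have "m / 2 * exp (\<gamma> * z) \<le> \<kappa>" by linarith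
  moreover have "m / 2 * 1 \<le> m / 2 * exp (\<gamma> * z)"
    using m0 \<gamma> z by (intro mult_left_mono) auto
  ultimately have "m \<le> 2 * \<kappa>" by linarith
  then have "norm (U x) \<le> 2 * \<kappa> * exp (\<gamma> * x)"
    using Um[OF x] by (meson mult_right_mono exp_ge_zero order_trans)
  also have "\<dots> \<le> 2 * \<kappa> * exp (\<gamma> * l)"
    using x \<gamma> m0 \<open>m \<le> 2 * \<kappa>\<close> by (intro mult_left_mono) (auto simp: mult_left_mono)
  finally show ?thesis by (simp add: K0_def \<gamma>_def mult_ac)
qed

text \<open>The weighted unknown \<open>exp (- \<gamma> * x) *\<^sub>R U x\<close> is the fixed point of a contraction. It lives on all
  bounded continuous functions on the line, extended from the interval by clamping.\<close>

lemma sol_exists: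
  assumes P: "continuous_on {0..l} P"
  obtains U where "sol l A P U"
proof -
  define \<gamma> where "\<gamma> = 1 + 2 * C"
  have \<gamma>: "0 < \<gamma>" using C_nonneg by (simp add: \<gamma>_def)
  define F where "F v = (\<lambda>x. exp (- \<gamma> * x) *\<^sub>R (P x + dint (\<lambda>r. A r (exp (\<gamma> * r) *\<^sub>R v r)) x))"
    for v :: "real \<Rightarrow> 'b"
  have int: "(\<lambda>r. A r (exp (\<gamma> * r) *\<^sub>R apply_bcontfun v r)) integrable_on {0..l}"
    for v :: "real \<Rightarrow>\<^sub>C 'b"
    by (intro integrable_A continuous_intros) auto
  have Fc: "continuous_on {0..l} (F (apply_bcontfun v))" for v :: "real \<Rightarrow>\<^sub>C 'b"
    unfolding F_def by (intro continuous_intros P continuous_on_dint int)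
  have "\<exists>T :: real \<Rightarrow>\<^sub>C 'b. \<forall>x. apply_bcontfun T x = F (apply_bcontfun v) (clamp 0 l x)" for v
    using continuous_on_cbox_bcontfunE[of 0 l "F (apply_bcontfun v)"] Fc[of v]
    by (metis box_real(2))
  then obtain T :: "(real \<Rightarrow>\<^sub>C 'b) \<Rightarrow> (real \<Rightarrow>\<^sub>C 'b)"
    where T: "\<And>v x. apply_bcontfun (T v) x = F (apply_bcontfun v) (clamp 0 l x)" by metis
  have "dist (T v) (T w) \<le> 1/2 * dist v w" for v w
  proof (rule dist_bound)
    fix x
    define y where "y = clamp 0 l x"
    have y: "y \<in> {0..l}" unfolding y_def using l_pos clamp_in_interval[of 0 l x] by auto
    let ?d = "\<lambda>r. exp (\<gamma> * r) *\<^sub>R (apply_bcontfun v r - apply_bcontfun w r)"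
    have d: "dint (\<lambda>r. A r (exp (\<gamma> * r) *\<^sub>R apply_bcontfun v r)) y
        - dint (\<lambda>r. A r (exp (\<gamma> * r) *\<^sub>R apply_bcontfun w r)) y = dint (\<lambda>r. A r (?d r)) y"
    proof -
      have "dint (\<lambda>r. A r (exp (\<gamma> * r) *\<^sub>R apply_bcontfun v r)) y
        = dint (\<lambda>r. A r (?d r) + A r (exp (\<gamma> * r) *\<^sub>R apply_bcontfun w r)) y"
      proof (intro dint_cong)
        fix r assume "r \<in> {0..y}"
        then have "linear (A r)" using y lin by auto
        from linear_add[OF this, symmetric]
        show "A r (exp (\<gamma> * r) *\<^sub>R apply_bcontfun v r) = A r (?d r) + A r (exp (\<gamma> * r) *\<^sub>R apply_bcontfun w r)"
          by (simp add: algebra_simps)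
      qed
      also have "\<dots> = dint (\<lambda>r. A r (?d r)) y + dint (\<lambda>r. A r (exp (\<gamma> * r) *\<^sub>R apply_bcontfun w r)) y"
        using y by (intro dint_add[of _ l] integrable_A int continuous_intros) auto
      finally show ?thesis by simp
    qed
    have "norm (dint (\<lambda>r. A r (?d r)) y) \<le> C * dist v w / \<gamma>\<^sup>2 * exp (\<gamma> * y)"
    proof (rule norm_dint_le_exp)
      show "(\<lambda>r. A r (?d r)) integrable_on {0..y}"
        using y by (rule_tac integrable_initial[of _ l]) (auto intro!: integrable_A continuous_intros)
      fix r assume r: "r \<in> {0..y}"
      have "norm (A r (?d r)) \<le> C * (exp (\<gamma> * r) * norm (apply_bcontfun v r - apply_bcontfun w r))"
        using bnd[of r "?d r"] r y by auto
      also have "\<dots> \<le> C * (exp (\<gamma> * r) * dist v w)"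
        using C_nonneg dist_bounded[of v r w] by (intro mult_left_mono) (auto simp: dist_norm)
      finally show "norm (A r (?d r)) \<le> C * dist v w * exp (\<gamma> * r)" by (simp add: mult_ac)
    qed (use y \<gamma> C_nonneg in auto)
    then have "exp (- \<gamma> * y) * norm (dint (\<lambda>r. A r (?d r)) y)
        \<le> exp (- \<gamma> * y) * (C * dist v w / \<gamma>\<^sup>2 * exp (\<gamma> * y))"
      by (intro mult_left_mono) auto
    also have "\<dots> = C / \<gamma>\<^sup>2 * dist v w" by (simp add: exp_minus)
    also have "\<dots> \<le> 1 / 2 * dist v w"
      using half by (intro mult_right_mono) (auto simp: \<gamma>_def)
    finally show "dist (apply_bcontfun (T v) x) (apply_bcontfun (T w) x) \<le> 1/2 * dist v w"
      using d by (simp add: T y_def[symmetric] F_def dist_norm flip: scaleR_diff_right)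
  qed
  then obtain v where v: "T v = v" using banach_fix_type[of "1/2" T] by auto
  have "sol l A P (\<lambda>x. exp (\<gamma> * x) *\<^sub>R apply_bcontfun v x)"
    unfolding sol_def
  proof safe
    show "continuous_on {0..l} (\<lambda>x. exp (\<gamma> * x) *\<^sub>R apply_bcontfun v x)"
      by (intro continuous_intros) auto
    fix x assume x: "x \<in> {0..l}"
    have "apply_bcontfun v x = F (apply_bcontfun v) x"
      using T[of v x] x by (simp add: v)
    then have "exp (\<gamma> * x) *\<^sub>R apply_bcontfun v x = exp (\<gamma> * x) *\<^sub>R F (apply_bcontfun v) x" by simp
    then show "exp (\<gamma> * x) *\<^sub>R apply_bcontfun v x = P x + dint (\<lambda>r. A r (exp (\<gamma> * r) *\<^sub>R apply_bcontfun v r)) x"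
      by (simp add: F_def exp_minus)
  qed
  then show ?thesis using that by blast
qed

end

section \<open>Square integrable functions on an interval\<close>

lemma lebI_sets [simp]: "{0<..<l::real} \<in> sets lebesgue" by simp

lemma finite_measure_lebI: "finite_measure (lebI l)"
  by (rule finite_measure_lebesgue_on) simp

lemma measurable_lebI:
  "continuous_on {0..l} f \<Longrightarrow> f \<in> borel_measurable (lebI l)" for f :: "real \<Rightarrow> 'b::euclidean_space"
  by (rule continuous_imp_measurable_on_sets_lebesgue) (auto elim: continuous_on_subset)

lemma integrable_lebI_bounded:
  fixes f :: "real \<Rightarrow> 'b::euclidean_space"
  assumes "f \<in> borel_measurable (lebI l)" "\<And>x. x \<in> {0<..<l} \<Longrightarrow> norm (f x) \<le> B"
  shows "integrable (lebI l) f"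
  using assms by (intro finite_measure.integrable_const_bound[OF finite_measure_lebI, of _ B])
    (auto intro!: AE_I2)

lemma integrable_lebI:
  fixes f :: "real \<Rightarrow> 'b::euclidean_space"
  assumes "continuous_on {0..l} f"
  shows "integrable (lebI l) f"
proof -
  have "bounded (f ` {0..l})" using assms by (intro compact_imp_bounded compact_continuous_image) auto
  then obtain B where "\<And>x. x \<in> {0..l} \<Longrightarrow> norm (f x) \<le> B" unfolding bounded_iff by (metis imageI)
  then show ?thesis using assms by (intro integrable_lebI_bounded[of _ _ B] measurable_lebI) auto
qed

lemma L2_integrable: "f \<in> L2 l \<Longrightarrow> integrable (lebI l) f"
proof -
  assume f: "f \<in> L2 l"
  interpret finite_measure "lebI l" by (rule finite_measure_lebI)
  have i: "integrable (lebI l) (\<lambda>x. 1 + (norm (f x))\<^sup>2)"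
    using f unfolding L2_def by (intro Bochner_Integration.integrable_add integrable_const) auto
  have "norm (f x) \<le> norm (1 + (norm (f x))\<^sup>2)" for x
  proof -
    have "2 * norm (f x) \<le> 1 + (norm (f x))\<^sup>2"
      using zero_le_power2[of "norm (f x) - 1"] by (simp add: power2_eq_square algebra_simps)
    then have "norm (f x) \<le> 1 + (norm (f x))\<^sup>2" using norm_ge_zero[of "f x"] by linarith
    then show ?thesis by simp
  qed
  then show ?thesis using f
    by (intro Bochner_Integration.integrable_bound[OF i]) (auto simp: L2_def)
qed

lemma L2_add:
  assumes "f \<in> L2 l" "g \<in> L2 l"
  shows "(\<lambda>x. f x + g x) \<in> L2 l"
proof -
  have [measurable]: "f \<in> borel_measurable (lebI l)" "g \<in> borel_measurable (lebI l)"
    using assms by (auto simp: L2_def)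
  have i: "integrable (lebI l) (\<lambda>x. 2 * (norm (f x))\<^sup>2 + 2 * (norm (g x))\<^sup>2)"
    using assms by (auto simp: L2_def)
  have "norm ((norm (f x + g x))\<^sup>2) \<le> norm (2 * (norm (f x))\<^sup>2 + 2 * (norm (g x))\<^sup>2)" for x
  proof -
    have "(norm (f x + g x))\<^sup>2 \<le> (norm (f x) + norm (g x))\<^sup>2"
      by (intro power_mono norm_triangle_ineq) auto
    also have "\<dots> \<le> 2 * (norm (f x))\<^sup>2 + 2 * (norm (g x))\<^sup>2"
      using zero_le_power2[of "norm (f x) - norm (g x)"] by (simp add: power2_eq_square algebra_simps)
    finally show ?thesis by simp
  qed
  then have "integrable (lebI l) (\<lambda>x. (norm (f x + g x))\<^sup>2)"
    by (intro Bochner_Integration.integrable_bound[OF i]) auto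
  then show ?thesis by (simp add: L2_def)
qed

lemma L2_mult:
  assumes f: "f \<in> L2 l" and q: "continuous_on {0..l} q"
  shows "(\<lambda>x. q x * f x) \<in> L2 l"
proof -
  have [measurable]: "f \<in> borel_measurable (lebI l)" "q \<in> borel_measurable (lebI l)"
    using f measurable_lebI[OF q] by (auto simp: L2_def)
  have "bounded (q ` {0..l})" using q by (intro compact_imp_bounded compact_continuous_image) auto
  then obtain B where B: "\<And>x. x \<in> {0..l} \<Longrightarrow> norm (q x) \<le> B" unfolding bounded_iff by (metis imageI)
  have i: "integrable (lebI l) (\<lambda>x. B\<^sup>2 * (norm (f x))\<^sup>2)" using f by (auto simp: L2_def)
  have "norm ((norm (q x * f x))\<^sup>2) \<le> norm (B\<^sup>2 * (norm (f x))\<^sup>2)" if "x \<in> {0<..<l}" for x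
    using power_mono[OF B[of x], of 2] that by (simp add: norm_mult power_mult_distrib mult_right_mono)
  then have "integrable (lebI l) (\<lambda>x. (norm (q x * f x))\<^sup>2)"
    by (intro Bochner_Integration.integrable_bound[OF i]) (auto intro!: AE_I2)
  then show ?thesis by (simp add: L2_def)
qed

lemma L2_diff: "f \<in> L2 l \<Longrightarrow> g \<in> L2 l \<Longrightarrow> (\<lambda>x. f x - g x) \<in> L2 l"
  using L2_add[OF _ L2_mult[of g l "\<lambda>x. -1"], of f] by simp

lemma L2_continuous:
  assumes "continuous_on {0..l} f"
  shows "f \<in> L2 l"
  unfolding L2_def using assms by (auto intro!: measurable_lebI integrable_lebI continuous_intros)

text \<open>The Cauchy-Schwarz inequality, from \<open>\<bar>f\<bar> \<le> (e + \<bar>f\<bar>\<^sup>2 / e) / 2\<close> with the best constant \<open>e\<close>.\<close>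

lemma L1_le_nrm:
  assumes l: "0 < l" and f: "f \<in> L2 l"
  shows "(LINT x|lebI l. norm (f x)) \<le> sqrt l * nrm l f"
proof -
  interpret finite_measure "lebI l" by (rule finite_measure_lebI)
  define Q where "Q = (LINT x|lebI l. (norm (f x))\<^sup>2)"
  have Q0: "0 \<le> Q" by (simp add: Q_def)
  have le: "(LINT x|lebI l. norm (f x)) \<le> (e * l + Q / e) / 2" if e: "0 < e" for e
  proof -
    have "(LINT x|lebI l. norm (f x)) \<le> (LINT x|lebI l. (e + (norm (f x))\<^sup>2 / e) / 2)"
    proof (intro integral_mono)
      fix x
      have "0 \<le> (norm (f x) - e)\<^sup>2 / e" using e by simp
      then show "norm (f x) \<le> (e + (norm (f x))\<^sup>2 / e) / 2"
        using e by (simp add: power2_eq_square field_simps)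
    qed (use f L2_integrable[OF f] in \<open>auto simp: L2_def\<close>)
    also have "\<dots> = ((LINT x|lebI l. e) + (LINT x|lebI l. (norm (f x))\<^sup>2 / e)) / 2"
      using f by (simp add: L2_def)
    also have "\<dots> = (e * l + Q / e) / 2"
      using l by (simp add: Q_def measure_restrict_space)
    finally show ?thesis .
  qed
  show ?thesis
  proof (cases "Q = 0")
    case True
    have "(LINT x|lebI l. norm (f x)) \<le> 0"
    proof (rule field_le_epsilon)
      fix e :: real assume "0 < e"
      then show "(LINT x|lebI l. norm (f x)) \<le> 0 + e"
        using le[of "2 * e / l"] True l by simp
    qed
    then show ?thesis using True by (simp add: nrm_def Q_def)
  next
    case False
    then have Q: "0 < Q" using Q0 by simp
    \<comment> \<open>The value of \<open>e\<close> at which the two terms of the bound agree.\<close>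
    define e where "e = sqrt Q / sqrt l"
    have e: "0 < e" using Q l by (simp add: e_def)
    have "e * l = sqrt l * sqrt Q" "Q / e = sqrt l * sqrt Q"
      using l Q by (simp_all add: e_def field_simps)
    then show ?thesis using le[OF e] by (simp add: nrm_def Q_def)
  qed
qed

lemma integral_lebI:
  fixes f :: "real \<Rightarrow> 'b::euclidean_space"
  assumes "integrable (lebI l) f"
  shows "(LINT x|lebI l. f x) = integral {0..l} f" "f integrable_on {0..l}"
  using lebesgue_integral_eq_integral[OF assms] integrable_on_lebesgue_on[OF assms]
  by (simp_all add: integral_open_interval_real integrable_on_open_interval_real)

lemma AE_lebI_negligible:
  assumes "AE x in lebI l. P x"
  obtains N where "negligible N" "\<And>x. x \<in> {0..l} \<Longrightarrow> x \<notin> N \<Longrightarrow> P x"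
proof -
  have "AE x in lebesgue. x \<in> {0<..<l} \<longrightarrow> P x"
    using assms by (simp add: AE_restrict_space_iff)
  then obtain N where N: "N \<in> null_sets lebesgue" "{x \<in> space lebesgue. \<not> (x \<in> {0<..<l} \<longrightarrow> P x)} \<subseteq> N"
    by (rule AE_E3) auto
  then have "negligible (N \<union> {0, l})" by (simp add: negligible_iff_null_sets[symmetric])
  moreover have "P x" if "x \<in> {0..l}" "x \<notin> N \<union> {0, l}" for x
  proof -
    have "0 < x" "x < l" "x \<notin> N" using that by auto
    then show ?thesis using N(2) by auto
  qed
  ultimately show ?thesis using that by blast
qed

lemma integral_cong_lebI:
  fixes f :: "real \<Rightarrow> 'b::euclidean_space"
  assumes "AE x in lebI l. f x = g x" "x \<le> l"
  shows "integral {0..x} f = integral {0..x} g"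
proof -
  obtain N where N: "negligible N" "\<And>x. x \<in> {0..l} \<Longrightarrow> x \<notin> N \<Longrightarrow> f x = g x"
    using AE_lebI_negligible[OF assms(1)] by blast
  then show ?thesis using assms(2) by (intro integral_spike[OF N(1)]) auto
qed

lemma dint_cong_lebI:
  assumes "AE x in lebI l. f x = g x" "x \<le> l"
  shows "dint f x = dint g x"
  unfolding dint_def using assms by (intro integral_cong integral_cong_lebI) auto

text \<open>Elements of the function spaces are only determined almost everywhere; this is what makes their
  continuous representatives unique, also at the end points.\<close>

lemma continuous_AE_eq:
  fixes f g :: "real \<Rightarrow> 'b::euclidean_space"
  assumes "AE x in lebI l. f x = g x" "continuous_on {0..l} f" "continuous_on {0..l} g" "0 < l" "x \<in> {0..l}"
  shows "f x = g x"
proof -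
  obtain N where N: "negligible N" "\<And>x. x \<in> {0..l} \<Longrightarrow> x \<notin> N \<Longrightarrow> f x = g x"
    using AE_lebI_negligible[OF assms(1)] by blast
  have "((\<lambda>x. norm (f x - g x)) has_integral 0) (cbox 0 l)"
    using N by (intro has_integral_spike_finite_eq[THEN iffD1, OF _ _ has_integral_0, of "{}"]
        has_integral_spike[OF N(1) _ has_integral_0]) auto
  then have "norm (f x - g x) = 0"
    using assms by (intro has_integral_0_cbox_imp_0[of 0 l]) (auto intro!: continuous_intros)
  then show ?thesis by simp
qed

section \<open>Weak derivatives and test functions\<close>

text \<open>Continuous functions with compact support in the interval. They are the derivatives of test
  functions as soon as their mean vanishes.\<close>

definition Cc :: "real \<Rightarrow> (real \<Rightarrow> complex) set"
  where "Cc l = {\<psi>. continuous_on UNIV \<psi> \<and> (\<exists>a b. 0 < a \<and> a \<le> b \<and> b < l \<and> (\<forall>x. x \<notin> {a..b} \<longrightarrow> \<psi> x = 0))}"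

text \<open>Trapezoids that increase to the indicator function of the interval.\<close>

definition cutoff :: "real \<Rightarrow> nat \<Rightarrow> real \<Rightarrow> complex"
  where "cutoff l k x = of_real (min 1 (max 0 (real k * min x (l - x) - 1)))"

lemma norm_cutoff: "norm (cutoff l k x) \<le> 1"
  unfolding cutoff_def norm_of_real by simp

lemma cutoff_tendsto:
  assumes "x \<in> {0<..<l}"
  shows "(\<lambda>k. cutoff l k x) \<longlonglongrightarrow> 1"
proof (rule tendsto_eventually)
  define d where "d = min x (l - x)"
  have d: "0 < d" using assms by (simp add: d_def)
  obtain k0 where k0: "2 / d < real k0" using reals_Archimedean2 by blast
  show "\<forall>\<^sub>F k in sequentially. cutoff l k x = 1"
  proof (rule eventually_sequentiallyI[of k0])
    fix k assume "k0 \<le> k"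
    then have "2 / d < real k" using k0 by linarith
    then have "2 \<le> real k * d" using d by (simp add: field_simps)
    then show "cutoff l k x = 1" by (simp add: cutoff_def flip: d_def)
  qed
qed

lemma cutoff_mult_Cc:
  assumes f: "continuous_on UNIV f" and l: "0 < l"
  shows "(\<lambda>x. cutoff l k x * f x) \<in> Cc l"
proof -
  define d where "d = min (1 / (real k + 1)) (l / 2)"
  have d: "0 < d" "d \<le> l - d" "l - d < l" using l by (auto simp: d_def)
  have "cutoff l k x = 0" if "x \<notin> {d..l - d}" for x
  proof -
    have m: "min x (l - x) < d" using that by auto
    have "real k * min x (l - x) \<le> 1"
    proof (cases "min x (l - x) \<le> 0")
      case True
      then show ?thesis using mult_nonneg_nonpos[of "real k" "min x (l - x)"] by linarith
    next
      case False
      have "real k * min x (l - x) \<le> (real k + 1) * (1 / (real k + 1))"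
        using m False by (intro mult_mono) (auto simp: d_def)
      then show ?thesis by simp
    qed
    then show ?thesis by (simp add: cutoff_def)
  qed
  moreover have "continuous_on UNIV (\<lambda>x. cutoff l k x * f x)"
    unfolding cutoff_def by (intro continuous_intros f)
  ultimately show ?thesis using d unfolding Cc_def by (intro CollectI conjI exI[of _ d] exI[of _ "l - d"]) auto
qed

lemma Cc_lin: 
  assumes "f \<in> Cc l" "g \<in> Cc l" shows "(\<lambda>x. f x - c * g x) \<in> Cc l"
proof -
  obtain a b where 1: "0 < a" "a \<le> b" "b < l" "\<And>x. x \<notin> {a..b} \<Longrightarrow> f x = 0" using assms(1) unfolding Cc_def by blast
  obtain a' b' where 2: "0 < a'" "a' \<le> b'" "b' < l" "\<And>x. x \<notin> {a'..b'} \<Longrightarrow> g x = 0" using assms(2) unfolding Cc_def by blast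
  have "f x - c * g x = 0" if "x \<notin> {min a a'..max b b'}" for x
  proof -
    have "x \<notin> {a..b}" "x \<notin> {a'..b'}" using that by auto
    then show ?thesis using 1(4) 2(4) by simp
  qed
  moreover have "continuous_on UNIV (\<lambda>x. f x - c * g x)"
    using assms by (auto simp: Cc_def intro!: continuous_intros)
  ultimately show ?thesis using 1 2 unfolding Cc_def
    by (intro CollectI conjI exI[of _ "min a a'"] exI[of _ "max b b'"]) auto
qed

lemma Cc_integrable_mult:
  fixes \<psi> :: "real \<Rightarrow> complex"
  assumes h: "integrable (lebI l) h" and \<psi>: "continuous_on UNIV \<psi>"
  shows "integrable (lebI l) (\<lambda>x. h x * \<psi> x)"
proof -
  have m: "\<psi> \<in> borel_measurable (lebI l)"
    using \<psi> by (intro measurable_lebI) (auto elim: continuous_on_subset)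
  have "continuous_on {0..l} \<psi>" using \<psi> by (auto elim: continuous_on_subset)
  then have "bounded (\<psi> ` {0..l})" by (intro compact_imp_bounded compact_continuous_image) auto
  then obtain B where B: "\<And>x. x \<in> {0..l} \<Longrightarrow> norm (\<psi> x) \<le> B" unfolding bounded_iff by (metis imageI)
  have "norm (h x * \<psi> x) \<le> norm (B * norm (h x))" if "x \<in> {0<..<l}" for x
  proof -
    have "norm (h x * \<psi> x) \<le> norm (h x) * B" using that by (auto simp: norm_mult intro!: mult_left_mono B)
    also have "\<dots> \<le> norm (B * norm (h x))" by (simp add: mult.commute)
    finally show ?thesis .
  qed
  then show ?thesis using h m
    by (intro Bochner_Integration.integrable_bound[OF _ _ AE_I2, of _ "\<lambda>x. B * norm (h x)"
          "\<lambda>x. h x * \<psi> x"] integrable_mult_right integrable_norm borel_measurable_times) auto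
qed

text \<open>The measurable sign of \<open>h\<close> is an almost everywhere limit of continuous functions, so
  testing against these recovers the integral of the modulus of \<open>h\<close>.\<close>

lemma fundamental_lemma_Cc:
  assumes h: "integrable (lebI l) h" and l: "0 < l"
    and 0: "\<And>\<psi>. \<psi> \<in> Cc l \<Longrightarrow> (LINT x|lebI l. h x * \<psi> x) = 0"
  shows "AE x in lebI l. h x = 0"
proof -
  define k where "k x = cnj (sgn (h x))" for x
  have [measurable]: "h \<in> borel_measurable (lebI l)" using h by auto
  have "(\<lambda>x. sgn (h x)) \<in> borel_measurable (lebI l)"
    unfolding sgn_div_norm by measurable
  moreover have "cnj \<in> borel_measurable borel"
    by (intro borel_measurable_continuous_onI continuous_intros)
  ultimately have "k \<in> borel_measurable (lebI l)"
    unfolding k_def[abs_def] by (rule measurable_compose)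
  then have "k measurable_on {0<..<l}" by (simp add: measurable_on_iff_borel_measurable)
  then obtain N g where N: "negligible N" and gc: "\<And>n. continuous_on UNIV (g n)"
    and g: "\<And>x. x \<notin> N \<Longrightarrow> (\<lambda>n. g n x) \<longlonglongrightarrow> (if x \<in> {0<..<l} then k x else 0)"
    unfolding measurable_on_def by metis
  define r where "r z = z / of_real (max 1 (norm z))" for z :: complex
  have rc: "continuous_on UNIV r" unfolding r_def by (intro continuous_intros) auto
  have r1: "norm (r z) \<le> 1" for z by (simp add: r_def norm_divide)
  have rk: "r (k x) = k x" for x by (simp add: r_def k_def norm_sgn)
  define \<psi> where "\<psi> n x = cutoff l n x * r (g n x)" for n x
  have rg: "continuous_on UNIV (\<lambda>x. r (g n x))" for n
    using continuous_on_compose[OF gc[of n], of r] continuous_on_subset[OF rc] by (simp add: comp_def)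
  have \<psi>: "\<psi> n \<in> Cc l" for n
    unfolding \<psi>_def[abs_def] by (intro cutoff_mult_Cc rg l)
  then have \<psi>c: "continuous_on UNIV (\<psi> n)" for n by (simp add: Cc_def)
  have \<psi>1: "norm (\<psi> n x) \<le> 1" for n x
    using mult_mono[OF norm_cutoff[of l n x] r1[of "g n x"]] by (simp add: \<psi>_def norm_mult)
  have lim: "(\<lambda>n. h x * \<psi> n x) \<longlonglongrightarrow> complex_of_real (norm (h x))" if "x \<in> {0<..<l}" "x \<notin> N" for x
  proof -
    have "(\<lambda>n. g n x) \<longlonglongrightarrow> k x" using g[OF that(2)] that(1) by simp
    then have "(\<lambda>n. r (g n x)) \<longlonglongrightarrow> r (k x)"
      using rc by (intro isCont_tendsto_compose[of _ r]) (auto simp: continuous_on_eq_continuous_at)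
    then have "(\<lambda>n. h x * \<psi> n x) \<longlonglongrightarrow> h x * (1 * k x)"
      unfolding \<psi>_def rk by (intro tendsto_mult tendsto_const cutoff_tendsto that)
    moreover have "h x * (1 * k x) = of_real (norm (h x))"
    proof (cases "h x = 0")
      case False
      have "h x * (1 * k x) = (h x * cnj (h x)) / of_real (norm (h x))"
        by (simp add: k_def sgn_div_norm scaleR_conv_of_real divide_inverse)
      also have "\<dots> = of_real ((norm (h x))\<^sup>2) / of_real (norm (h x))"
        by (simp only: complex_norm_square)
      also have "\<dots> = of_real (norm (h x))" using False by (simp add: power2_eq_square)
      finally show ?thesis .
    qed simp
    ultimately show ?thesis by simp
  qed
  have "(\<lambda>n. LINT x|lebI l. h x * \<psi> n x) \<longlonglongrightarrow> (LINT x|lebI l. complex_of_real (norm (h x)))"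
  proof (rule integral_dominated_convergence[where w = "\<lambda>x. norm (h x)"])
    have "N \<in> null_sets lebesgue" using N by (simp add: negligible_iff_null_sets)
    then have "AE x in lebesgue. x \<notin> N" by (rule AE_not_in)
    then show "AE x in lebI l. (\<lambda>n. h x * \<psi> n x) \<longlonglongrightarrow> complex_of_real (norm (h x))"
      using lim by (auto simp: AE_restrict_space_iff elim!: eventually_mono)
    show "AE x in lebI l. norm (h x * \<psi> n x) \<le> norm (h x)" for n
      using mult_left_le[OF \<psi>1 norm_ge_zero] by (intro AE_I2) (simp add: norm_mult)
    show "(\<lambda>x. h x * \<psi> n x) \<in> borel_measurable (lebI l)" for n
      using Cc_integrable_mult[OF h \<psi>c[of n]] by auto
  qed (use h in auto)
  then have "(LINT x|lebI l. complex_of_real (norm (h x))) = 0"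
    using 0[OF \<psi>] by (simp add: LIMSEQ_const_iff)
  then have "(LINT x|lebI l. norm (h x)) = 0" by simp
  then have "AE x in lebI l. norm (h x) = 0"
    using h by (subst (asm) integral_nonneg_eq_0_iff_AE) auto
  then show ?thesis by simp
qed

text \<open>For \<open>\<psi> \<in> Cc l\<close> this is a primitive on the whole line: left of the support the interval of
  integration contributes nothing, whether it is empty or not.\<close>

definition primitive :: "(real \<Rightarrow> complex) \<Rightarrow> real \<Rightarrow> complex"
  where "primitive \<psi> x = integral {0..x} \<psi>"

lemma primitive_Cc:
  assumes \<psi>: "\<psi> \<in> Cc l"
  shows "(primitive \<psi> has_vector_derivative \<psi> x) (at x)"
proof -
  obtain a b where ab: "0 < a" "\<And>x. x \<notin> {a..b} \<Longrightarrow> \<psi> x = 0" using \<psi> unfolding Cc_def by blast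
  have c: "continuous_on UNIV \<psi>" using \<psi> by (simp add: Cc_def)
  show ?thesis
  proof (cases "x < a")
    case True
    have z: "primitive \<psi> y = 0" if "y < a" for y
      unfolding primitive_def using integral_cong[of "{0..y}" \<psi> "\<lambda>_. 0"] ab that by auto
    have "\<psi> x = 0" using ab True by auto
    then show ?thesis
      using has_vector_derivative_transform_within_open[of "\<lambda>x. 0" 0 x "{..<a}" "primitive \<psi>"] True z by auto
  next
    case False
    then have "(primitive \<psi> has_vector_derivative \<psi> x) (at x within {0..x+1})"
      unfolding primitive_def[abs_def] using ab
      by (intro integral_has_vector_derivative) (auto intro: continuous_on_subset[OF c])
    then have "(primitive \<psi> has_vector_derivative \<psi> x) (at x within {0<..<x+1})"
      by (rule has_vector_derivative_within_subset) auto
    then show ?thesis using False ab by (subst (asm) has_vector_derivative_within_open) auto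
  qed
qed

lemma Cc_integral:
  assumes "\<psi> \<in> Cc l" "x \<le> y"
  shows "(\<psi> has_integral primitive \<psi> y - primitive \<psi> x) {x..y}"
  using assms by (intro fundamental_theorem_of_calculus)
    (auto intro: has_vector_derivative_at_within primitive_Cc)

lemma Cc_bounded:
  assumes "\<psi> \<in> Cc l"
  obtains B where "0 \<le> B" "\<And>x. norm (\<psi> x) \<le> B"
proof -
  obtain a b where ab: "\<And>x. x \<notin> {a..b} \<Longrightarrow> \<psi> x = 0" using assms unfolding Cc_def by blast
  have "continuous_on {a..b} \<psi>" using assms by (auto simp: Cc_def elim: continuous_on_subset)
  then have "bounded (\<psi> ` {a..b})" by (intro compact_imp_bounded compact_continuous_image) auto
  then obtain B where B: "\<And>x. x \<in> {a..b} \<Longrightarrow> norm (\<psi> x) \<le> B" unfolding bounded_iff by (metis imageI)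
  have "norm (\<psi> x) \<le> max 0 B" for x using B[of x] ab[of x] by (cases "x \<in> {a..b}") auto
  then show ?thesis using that[of "max 0 B"] by simp
qed

lemma primitive_outside:
  assumes \<psi>: "\<psi> \<in> Cc l" and zero: "\<And>x. x \<notin> {a..b} \<Longrightarrow> \<psi> x = 0" and ab: "0 < a" "b < l"
  shows "x < a \<Longrightarrow> primitive \<psi> x = 0" "b < x \<Longrightarrow> primitive \<psi> x = primitive \<psi> l"
proof -
  assume "x < a"
  then have "integral {0..x} \<psi> = integral {0..x} (\<lambda>_. 0)" by (intro integral_cong zero) auto
  then show "primitive \<psi> x = 0" by (simp add: primitive_def)
next
  have *: "primitive \<psi> z = primitive \<psi> y" if "b < y" "y \<le> z" for y z
  proof -
    have "integral {y..z} \<psi> = integral {y..z} (\<lambda>_. 0)" using that by (intro integral_cong zero) auto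
    then show ?thesis using integral_unique[OF Cc_integral[OF \<psi> that(2)]] by simp
  qed
  assume "b < x"
  then show "primitive \<psi> x = primitive \<psi> l" using *[of x l] *[of l x] ab by (cases "x \<le> l") auto
qed

lemma C1cI:
  assumes "\<And>x. (\<phi> has_vector_derivative D x) (at x)" "continuous_on UNIV D"
    "0 < a" "b < l" "\<And>x. x \<notin> {a..b} \<Longrightarrow> \<phi> x = 0"
  shows "\<phi> \<in> C1c l"
  using assms unfolding C1c_def C1_differentiable_on_def
  by (intro CollectI conjI exI[of _ D] exI[of _ "{a..b}"]) auto

lemma primitive_C1c:
  assumes \<psi>: "\<psi> \<in> Cc l" and 0: "primitive \<psi> l = 0"
  shows "primitive \<psi> \<in> C1c l" "vector_derivative (primitive \<psi>) (at x) = \<psi> x"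
proof -
  obtain a b where ab: "0 < a" "a \<le> b" "b < l" "\<And>x. x \<notin> {a..b} \<Longrightarrow> \<psi> x = 0"
    using \<psi> unfolding Cc_def by blast
  have "primitive \<psi> x = 0" if "x \<notin> {a..b}" for x
  proof (cases "x < a")
    case True then show ?thesis using primitive_outside(1)[OF \<psi> ab(4,1,3)] by simp
  next
    case False then show ?thesis using primitive_outside(2)[OF \<psi> ab(4,1,3), of x] that 0 by auto
  qed
  then show "primitive \<psi> \<in> C1c l"
    using ab primitive_Cc[OF \<psi>] \<psi> by (intro C1cI[of _ \<psi> a b]) (auto simp: Cc_def)
  show "vector_derivative (primitive \<psi>) (at x) = \<psi> x"
    using primitive_Cc[OF \<psi>] by (rule vector_derivative_at)
qed

text \<open>Difference quotients of the primitive are continuously differentiable approximations of a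
  continuous function, with supports that stay inside the interval.\<close>

lemma fundamental_lemma:
  assumes h: "integrable (lebI l) h" and l: "0 < l"
    and 0: "\<And>\<phi>. \<phi> \<in> C1c l \<Longrightarrow> (LINT x|lebI l. h x * \<phi> x) = 0"
  shows "AE x in lebI l. h x = 0"
proof (rule fundamental_lemma_Cc[OF h l])
  fix \<psi> assume \<psi>: "\<psi> \<in> Cc l"
  obtain a b where ab: "0 < a" "a \<le> b" "b < l" "\<And>x. x \<notin> {a..b} \<Longrightarrow> \<psi> x = 0"
    using \<psi> unfolding Cc_def by blast
  obtain B where B: "0 \<le> B" "\<And>x. norm (\<psi> x) \<le> B" using Cc_bounded[OF \<psi>] by blast
  \<comment> \<open>Steps of at most \<open>a / 2\<close> move the left end of the support to \<open>a / 2 > 0\<close> at worst.\<close>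
  define e where "e n = a / 2 * inverse (real (Suc n))" for n
  have e: "0 < e n" "e n \<le> a / 2" for n
  proof -
    have "inverse (real (Suc n)) \<le> 1" "0 < inverse (real (Suc n))"
      by (simp_all add: inverse_le_1_iff)
    then show "0 < e n" "e n \<le> a / 2"
      using ab(1) mult_left_mono[of "inverse (real (Suc n))" 1 "a / 2"] unfolding e_def by auto
  qed
  define \<phi> where "\<phi> n x = (1 / e n) *\<^sub>R (primitive \<psi> (x + e n) - primitive \<psi> x)" for n x
  have c: "continuous_on UNIV \<psi>" using \<psi> by (simp add: Cc_def)
  have \<phi>: "\<phi> n \<in> C1c l" for n
  proof (rule C1cI)
    fix x
    have "((\<lambda>x. x + e n) has_real_derivative 1) (at x)" by (auto intro!: derivative_eq_intros)
    then have "((\<lambda>x. x + e n) has_vector_derivative 1) (at x)"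
      by (simp add: has_real_derivative_iff_has_vector_derivative)
    then have "((\<lambda>x. primitive \<psi> (x + e n)) has_vector_derivative \<psi> (x + e n)) (at x)"
      using vector_diff_chain_at[of "\<lambda>x. x + e n" 1 x "primitive \<psi>" "\<psi> (x + e n)"] primitive_Cc[OF \<psi>, of "x + e n"]
      by (simp add: comp_def)
    then show "(\<phi> n has_vector_derivative (1 / e n) *\<^sub>R (\<psi> (x + e n) - \<psi> x)) (at x)"
      unfolding \<phi>_def[abs_def] using primitive_Cc[OF \<psi>, of x]
      by (auto intro!: derivative_eq_intros)
    show "continuous_on UNIV (\<lambda>x. (1 / e n) *\<^sub>R (\<psi> (x + e n) - \<psi> x))"
      by (intro continuous_intros continuous_on_compose2[OF c]) auto
    show "0 < a / 2" "b < l" using ab by auto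
    fix x assume x: "x \<notin> {a / 2..b}"
    have "primitive \<psi> (x + e n) = primitive \<psi> x"
    proof (cases "x < a / 2")
      case True
      then have "x + e n < a" "x < a" using e[of n] ab(1) by auto
      then show ?thesis using primitive_outside(1)[OF \<psi> ab(4,1,3)] by simp
    next
      case False
      then have "b < x + e n" "b < x" using e[of n] x by auto
      then show ?thesis using primitive_outside(2)[OF \<psi> ab(4,1,3)] by simp
    qed
    then show "\<phi> n x = 0" by (simp add: \<phi>_def)
  qed
  have \<phi>B: "norm (\<phi> n x) \<le> B" for n x
  proof -
    have "norm (primitive \<psi> (x + e n) - primitive \<psi> x) \<le> B * measure lborel {x..x + e n}"
      using has_integral_bound_real[OF B(1) finite.emptyI Cc_integral[OF \<psi>, of x "x + e n"]] B(2) e[of n] by auto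
    then have "norm (primitive \<psi> (x + e n) - primitive \<psi> x) \<le> B * e n" using e(1)[of n] by simp
    then show ?thesis using e(1)[of n] unfolding \<phi>_def norm_scaleR by (simp add: field_simps)
  qed
  have lim: "(\<lambda>n. \<phi> n x) \<longlonglongrightarrow> \<psi> x" for x
  proof -
    have "e \<longlonglongrightarrow> 0"
      unfolding e_def[abs_def] by (rule tendsto_mult_right_zero[OF LIMSEQ_inverse_real_of_nat])
    then have ea: "filterlim e (at 0) sequentially"
      using e(1) by (intro filterlim_atI) (auto simp: less_le)
    have "(\<lambda>h. norm (primitive \<psi> (x + h) - primitive \<psi> x - h *\<^sub>R \<psi> x) / norm h) \<midarrow>0\<rightarrow> 0"
      using primitive_Cc[OF \<psi>, of x] by (simp add: has_vector_derivative_def has_derivative_at)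
    from filterlim_compose[OF this ea]
    have "(\<lambda>n. norm (primitive \<psi> (x + e n) - primitive \<psi> x - e n *\<^sub>R \<psi> x) / norm (e n)) \<longlonglongrightarrow> 0" .
    moreover have "norm (primitive \<psi> (x + e n) - primitive \<psi> x - e n *\<^sub>R \<psi> x) / norm (e n) = norm (\<phi> n x - \<psi> x)" for n
    proof -
      have "primitive \<psi> (x + e n) - primitive \<psi> x - e n *\<^sub>R \<psi> x = e n *\<^sub>R (\<phi> n x - \<psi> x)"
        using e(1)[of n] by (simp add: \<phi>_def scaleR_diff_right)
      then show ?thesis using e(1)[of n] by simp
    qed
    ultimately show ?thesis by (simp add: tendsto_norm_zero_iff LIM_zero_iff)
  qed
  have "(\<lambda>n. LINT x|lebI l. h x * \<phi> n x) \<longlonglongrightarrow> (LINT x|lebI l. h x * \<psi> x)"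
  proof (rule integral_dominated_convergence[where w = "\<lambda>x. B * norm (h x)"])
    show "AE x in lebI l. (\<lambda>n. h x * \<phi> n x) \<longlonglongrightarrow> h x * \<psi> x"
      by (intro AE_I2 tendsto_mult tendsto_const lim)
    show "AE x in lebI l. norm (h x * \<phi> n x) \<le> B * norm (h x)" for n
      using mult_right_mono[OF \<phi>B norm_ge_zero] by (intro AE_I2) (simp add: norm_mult mult.commute)
    have "continuous_on UNIV (\<phi> n)" for n
      using \<phi>[of n] unfolding C1c_def by (auto intro: C1_differentiable_imp_continuous_on)
    then show "(\<lambda>x. h x * \<phi> n x) \<in> borel_measurable (lebI l)" for n
      using Cc_integrable_mult[OF h] by auto
    show "(\<lambda>x. h x * \<psi> x) \<in> borel_measurable (lebI l)"
      using Cc_integrable_mult[OF h c] by auto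
  qed (use h in auto)
  then show "(LINT x|lebI l. h x * \<psi> x) = 0"
    using 0[OF \<phi>] by (simp add: LIMSEQ_const_iff)
qed

lemma cutoff_integral_nonzero:
  assumes l: "0 < l"
  obtains k where "(LINT x|lebI l. cutoff l k x) \<noteq> 0"
proof -
  have "cutoff l k \<in> Cc l" for k using cutoff_mult_Cc[of "\<lambda>x. 1" l k] l by simp
  then have c: "continuous_on UNIV (cutoff l k)" for k by (simp add: Cc_def)
  have "(\<lambda>k. LINT x|lebI l. cutoff l k x) \<longlonglongrightarrow> (LINT x|lebI l. 1)"
  proof (rule integral_dominated_convergence[where w = "\<lambda>x. 1"])
    show "integrable (lebI l) (\<lambda>x. 1::real)" by (intro integrable_lebI continuous_intros)
    show "AE x in lebI l. (\<lambda>k. cutoff l k x) \<longlonglongrightarrow> 1"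
      by (intro AE_I2 cutoff_tendsto) auto
    show "cutoff l k \<in> borel_measurable (lebI l)" for k
      using c[of k] by (intro measurable_lebI) (auto elim: continuous_on_subset)
  qed (auto simp: norm_cutoff)
  moreover have "(LINT x|lebI l. 1::complex) = of_real l"
    using l by (simp add: measure_restrict_space scaleR_conv_of_real)
  moreover have "of_real l \<noteq> (0::complex)" using l by simp
  ultimately have "\<forall>\<^sub>F k in sequentially. (LINT x|lebI l. cutoff l k x) \<noteq> 0"
    by (metis tendsto_imp_eventually_ne)
  then show ?thesis using that by (auto simp: eventually_sequentially)
qed

lemma primitive_eq_lebI: "continuous_on UNIV \<psi> \<Longrightarrow> primitive \<psi> l = (LINT x|lebI l. \<psi> x)"
  unfolding primitive_def by (intro integral_lebI(1)[symmetric] integrable_lebI) (auto elim: continuous_on_subset)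

text \<open>Subtracting a multiple of a fixed cutoff turns any continuous function with compact support into
  the derivative of a test function; the constant is the price of this correction.\<close>

lemma du_Bois_Reymond:
  assumes g: "integrable (lebI l) g" and l: "0 < l"
    and 0: "\<And>\<phi>. \<phi> \<in> C1c l \<Longrightarrow> (LINT x|lebI l. g x * vector_derivative \<phi> (at x)) = 0"
  obtains c where "AE x in lebI l. g x = c"
proof -
  obtain k where k: "(LINT x|lebI l. cutoff l k x) \<noteq> 0" using cutoff_integral_nonzero[OF l] .
  define m where "m = (LINT x|lebI l. cutoff l k x)"
  have m: "m \<noteq> 0" using k by (simp add: m_def)
  have cut: "cutoff l k \<in> Cc l" using cutoff_mult_Cc[of "\<lambda>x. 1" l k] l by simp
  then have cc: "continuous_on UNIV (cutoff l k)" by (simp add: Cc_def)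
  define c where "c = (LINT x|lebI l. g x * cutoff l k x) / m"
  have "AE x in lebI l. g x - c = 0"
  proof (rule fundamental_lemma_Cc[OF _ l])
    show "integrable (lebI l) (\<lambda>x. g x - c)"
      by (intro Bochner_Integration.integrable_diff g integrable_lebI continuous_intros)
    fix \<psi> assume \<psi>: "\<psi> \<in> Cc l"
    then have \<psi>c: "continuous_on UNIV \<psi>" by (simp add: Cc_def)
    define J where "J = (LINT x|lebI l. \<psi> x)"
    have i: "integrable (lebI l) (\<lambda>x. \<psi> x)" "integrable (lebI l) (cutoff l k)"
      using \<psi>c cc by (auto intro!: integrable_lebI elim: continuous_on_subset)
    define \<theta> where "\<theta> x = \<psi> x - J / m * cutoff l k x" for x
    have \<theta>: "\<theta> \<in> Cc l" unfolding \<theta>_def[abs_def] by (rule Cc_lin[OF \<psi> cut])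
    have "primitive \<theta> l = (LINT x|lebI l. \<theta> x)" using \<theta> by (intro primitive_eq_lebI) (simp add: Cc_def)
    also have "\<dots> = J - J / m * m" using i by (simp add: \<theta>_def J_def m_def)
    finally have "primitive \<theta> l = 0" using m by simp
    from 0[OF primitive_C1c(1)[OF \<theta> this]] primitive_C1c(2)[OF \<theta> this]
    have "(LINT x|lebI l. g x * \<theta> x) = 0" by simp
    moreover have "(LINT x|lebI l. g x * \<theta> x) = (LINT x|lebI l. g x * \<psi> x - J / m * (g x * cutoff l k x))"
      by (intro Bochner_Integration.integral_cong) (auto simp: \<theta>_def algebra_simps)
    moreover have "\<dots> = (LINT x|lebI l. g x * \<psi> x) - J * c"
      using Cc_integrable_mult[OF g \<psi>c] Cc_integrable_mult[OF g cc] by (simp add: c_def)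
    moreover have "(LINT x|lebI l. (g x - c) * \<psi> x) = (LINT x|lebI l. g x * \<psi> x - c * \<psi> x)"
      by (simp add: algebra_simps)
    moreover have "\<dots> = (LINT x|lebI l. g x * \<psi> x) - c * J"
      using Cc_integrable_mult[OF g \<psi>c] i by (simp add: J_def)
    ultimately show "(LINT x|lebI l. (g x - c) * \<psi> x) = 0" by (simp add: mult.commute)
  qed
  then show ?thesis by (intro that[of c]) simp
qed

lemma C1c_D:
  assumes "\<phi> \<in> C1c l"
  shows "(\<phi> has_vector_derivative vector_derivative \<phi> (at x)) (at x)"
    "continuous_on UNIV (\<lambda>x. vector_derivative \<phi> (at x))" "continuous_on UNIV \<phi>"
    "\<phi> 0 = 0" "\<phi> l = 0"
proof -
  have C1: "\<phi> C1_differentiable_on UNIV" and K: "\<exists>K. compact K \<and> K \<subseteq> {0<..<l} \<and> (\<forall>x. x \<notin> K \<longrightarrow> \<phi> x = 0)"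
    using assms by (auto simp: C1c_def)
  obtain D where D: "\<And>x. (\<phi> has_vector_derivative D x) (at x)" "continuous_on UNIV D"
    using C1 unfolding C1_differentiable_on_def by auto
  have "vector_derivative \<phi> (at x) = D x" for x using D(1) by (rule vector_derivative_at)
  then show "(\<phi> has_vector_derivative vector_derivative \<phi> (at x)) (at x)"
    "continuous_on UNIV (\<lambda>x. vector_derivative \<phi> (at x))" using D by auto
  show "continuous_on UNIV \<phi>" using C1 by (rule C1_differentiable_imp_continuous_on)
  show "\<phi> 0 = 0" "\<phi> l = 0" using K by fastforce+
qed

lemma C1c_integral:
  assumes "\<phi> \<in> C1c l" "x \<le> y"
  shows "((\<lambda>x. vector_derivative \<phi> (at x)) has_integral \<phi> y - \<phi> x) {x..y}"
  using assms by (intro fundamental_theorem_of_calculus)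
    (auto intro: has_vector_derivative_at_within C1c_D)

text \<open>Integration by parts for an integrand that is merely integrable: both sides are the integral of
  \<open>f t * \<phi>' x\<close> over the triangle \<open>t \<le> x\<close>, taken in the two orders.\<close>

lemma weak_deriv_indefinite_integral:
  assumes f: "integrable (lebI l) f" and l: "0 < l"
  shows "weak_deriv l (\<lambda>x. integral {0..x} f) f"
  unfolding weak_deriv_def
proof
  fix \<phi> assume \<phi>: "\<phi> \<in> C1c l"
  define D where "D x = vector_derivative \<phi> (at x)" for x
  have D: "continuous_on UNIV D" using C1c_D[OF \<phi>] by (simp add: D_def[abs_def])
  interpret M: finite_measure "lebI l" by (rule finite_measure_lebI)
  interpret P: pair_sigma_finite "lebI l" "lebI l" ..
  have [measurable]: "(\<lambda>x. x) \<in> borel_measurable (lebI l)" by (intro measurable_lebI continuous_intros)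
  have [measurable]: "f \<in> borel_measurable (lebI l)" using f by auto
  have [measurable]: "D \<in> borel_measurable (lebI l)"
    using D by (intro measurable_lebI) (auto elim: continuous_on_subset)
  define H where "H x t = (if t \<le> x then f t * D x else 0)" for x t
  have fst': "(\<lambda>p. fst p) \<in> borel_measurable (lebI l \<Otimes>\<^sub>M lebI l)"
    and snd': "(\<lambda>p. snd p) \<in> borel_measurable (lebI l \<Otimes>\<^sub>M lebI l)"
    using measurable_compose[OF measurable_fst, of "\<lambda>x. x" "lebI l" borel "lebI l"]
      measurable_compose[OF measurable_snd, of "\<lambda>x. x" "lebI l" borel "lebI l"] by auto
  have [measurable]: "Measurable.pred (lebI l \<Otimes>\<^sub>M lebI l) (\<lambda>p. snd p \<le> fst p)"
    using fst' snd' by measurable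
  have Hm[measurable]: "case_prod H \<in> borel_measurable (lebI l \<Otimes>\<^sub>M lebI l)"
    unfolding H_def case_prod_beta by measurable
  have "continuous_on {0..l} D" using D by (auto elim: continuous_on_subset)
  then have "bounded (D ` {0..l})" by (intro compact_imp_bounded compact_continuous_image) auto
  then obtain B where B: "\<And>x. x \<in> {0..l} \<Longrightarrow> norm (D x) \<le> B" unfolding bounded_iff by (metis imageI)
  have HB: "norm (H x t) \<le> B * norm (f t)" if "x \<in> {0<..<l}" for x t
  proof -
    have "norm (D x) \<le> B" "0 \<le> B" using B[of x] that order_trans[OF norm_ge_zero B[of x]] by auto
    then show ?thesis by (auto simp: H_def norm_mult mult.commute intro!: mult_right_mono)
  qed
  have Hi: "integrable (lebI l) (H x)" if "x \<in> {0<..<l}" for x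
  proof (rule Bochner_Integration.integrable_bound)
    show "integrable (lebI l) (\<lambda>t. B * norm (f t))" using f by simp
    show "H x \<in> borel_measurable (lebI l)" unfolding H_def by measurable
    show "AE t in lebI l. norm (H x t) \<le> norm (B * norm (f t))"
      using order_trans[OF HB[OF that] abs_ge_self] by simp
  qed
  have "integrable (lebI l \<Otimes>\<^sub>M lebI l) (case_prod H)"
  proof (rule P.Fubini_integrable[OF Hm])
    show "AE x in lebI l. integrable (lebI l) (\<lambda>y. case_prod H (x, y))"
      using Hi by (intro AE_I2) auto
    show "integrable (lebI l) (\<lambda>x. LINT y|lebI l. norm (case_prod H (x, y)))"
    proof (rule integrable_lebI_bounded)
      show "(\<lambda>x. LINT y|lebI l. norm (case_prod H (x, y))) \<in> borel_measurable (lebI l)"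
        by (intro M.borel_measurable_lebesgue_integral) simp
      fix x assume x: "x \<in> {0<..<l}"
      have "(LINT y|lebI l. norm (H x y)) \<le> (LINT y|lebI l. B * norm (f y))"
        using Hi[OF x] f HB[OF x] by (intro integral_mono) auto
      then show "norm (LINT y|lebI l. norm (case_prod H (x, y))) \<le> (LINT y|lebI l. B * norm (f y))"
        by simp
    qed
  qed
  from P.Fubini_integral[OF this]
  have F: "(LINT t|lebI l. LINT x|lebI l. H x t) = (LINT x|lebI l. LINT t|lebI l. H x t)" .
  have 1: "(LINT t|lebI l. H x t) = integral {0..x} f * D x" if x: "x \<in> {0<..<l}" for x
  proof -
    have "(LINT t|lebI l. H x t) = integral {0..l} (H x)" by (rule integral_lebI(1)[OF Hi[OF x]])
    also have "\<dots> = integral {0..l} (\<lambda>t. if t \<in> {..x} then f t * D x else 0)"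
      by (intro integral_cong) (auto simp: H_def)
    also have "\<dots> = integral ({..x} \<inter> {0..l}) (\<lambda>t. f t * D x)" by (rule Henstock_Kurzweil_Integration.integral_restrict_Int)
    also have "{..x} \<inter> {0..l} = {0..x}" using x by auto
    finally show ?thesis by simp
  qed
  have 2: "(LINT x|lebI l. H x t) = - (f t * \<phi> t)" if t: "t \<in> {0<..<l}" for t
  proof -
    have Ht: "integrable (lebI l) (\<lambda>x. H x t)"
    proof (rule integrable_lebI_bounded)
      show "(\<lambda>x. H x t) \<in> borel_measurable (lebI l)" unfolding H_def by measurable
      show "\<And>x. x \<in> {0<..<l} \<Longrightarrow> norm (H x t) \<le> B * norm (f t)" by (rule HB)
    qed
    have "(LINT x|lebI l. H x t) = integral {0..l} (\<lambda>x. H x t)" by (rule integral_lebI(1)[OF Ht])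
    also have "\<dots> = integral {0..l} (\<lambda>x. if x \<in> {t..} then f t * D x else 0)"
      by (intro integral_cong) (auto simp: H_def)
    also have "\<dots> = integral ({t..} \<inter> {0..l}) (\<lambda>x. f t * D x)" by (rule Henstock_Kurzweil_Integration.integral_restrict_Int)
    also have "{t..} \<inter> {0..l} = {t..l}" using t by auto
    also have "integral {t..l} (\<lambda>x. f t * D x) = f t * (\<phi> l - \<phi> t)"
      using integral_unique[OF C1c_integral[OF \<phi>, of t l]] t by (simp add: D_def)
    finally show ?thesis using C1c_D(5)[OF \<phi>] by simp
  qed
  have "(LINT x|lebI l. integral {0..x} f * D x) = (LINT x|lebI l. LINT t|lebI l. H x t)"
    by (intro Bochner_Integration.integral_cong) (auto simp: 1)
  also have "\<dots> = (LINT t|lebI l. - (f t * \<phi> t))"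
    unfolding F[symmetric] by (intro Bochner_Integration.integral_cong) (auto simp: 2)
  finally show "(LINT x|lebI l. integral {0..x} f * vector_derivative \<phi> (at x)) = - (LINT x|lebI l. f x * \<phi> x)"
    by (simp add: D_def)
qed

section \<open>The operator domain as a space of double integrals\<close>

lemma wderiv_H1:
  assumes "f \<in> H1 l"
  shows "wderiv l f \<in> L2 l" "weak_deriv l f (wderiv l f)"
proof -
  have "\<exists>f'. f' \<in> L2 l \<and> weak_deriv l f f'" using assms by (auto simp: H1_def)
  from someI_ex[OF this] show "wderiv l f \<in> L2 l" "weak_deriv l f (wderiv l f)"
    by (simp_all add: wderiv_def)
qed

lemma weak_deriv_unique:
  assumes "w \<in> L2 l" "w' \<in> L2 l" "weak_deriv l f w" "weak_deriv l f w'" "0 < l"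
  shows "AE x in lebI l. w x = w' x"
proof -
  have "AE x in lebI l. w x - w' x = 0"
  proof (rule fundamental_lemma)
    show "integrable (lebI l) (\<lambda>x. w x - w' x)"
      using assms L2_integrable by (intro Bochner_Integration.integrable_diff) auto
    fix \<phi> assume \<phi>: "\<phi> \<in> C1c l"
    have "(LINT x|lebI l. (w x - w' x) * \<phi> x) = (LINT x|lebI l. w x * \<phi> x) - (LINT x|lebI l. w' x * \<phi> x)"
      using assms C1c_D(3)[OF \<phi>] unfolding left_diff_distrib
      by (intro Bochner_Integration.integral_diff Cc_integrable_mult L2_integrable) auto
    also have "\<dots> = 0"
      using assms(3,4) \<phi> unfolding weak_deriv_def by (metis cancel_comm_monoid_add_class.diff_cancel minus_equation_iff)
    finally show "(LINT x|lebI l. (w x - w' x) * \<phi> x) = 0" .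
  qed (use assms in auto)
  then show ?thesis by simp
qed

lemma wderiv_eq:
  assumes "f \<in> L2 l" "w \<in> L2 l" "weak_deriv l f w" "0 < l"
  shows "f \<in> H1 l" "AE x in lebI l. wderiv l f x = w x"
proof -
  show H: "f \<in> H1 l" using assms by (auto simp: H1_def)
  show "AE x in lebI l. wderiv l f x = w x"
    using weak_deriv_unique[OF _ assms(2) _ assms(3,4)] wderiv_H1[OF H] by blast
qed

lemma weak_deriv_cong_AE:
  assumes "AE x in lebI l. f x = g x" "f \<in> L2 l" "g \<in> L2 l" "weak_deriv l g w"
  shows "weak_deriv l f w"
  unfolding weak_deriv_def
proof
  fix \<phi> assume \<phi>: "\<phi> \<in> C1c l"
  have "(LINT x|lebI l. f x * vector_derivative \<phi> (at x)) = (LINT x|lebI l. g x * vector_derivative \<phi> (at x))"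
    using assms(1) Cc_integrable_mult[OF L2_integrable[OF assms(2)] C1c_D(2)[OF \<phi>]]
      Cc_integrable_mult[OF L2_integrable[OF assms(3)] C1c_D(2)[OF \<phi>]]
    by (intro integral_cong_AE) (auto elim: eventually_mono)
  then show "(LINT x|lebI l. f x * vector_derivative \<phi> (at x)) = - (LINT x|lebI l. w x * \<phi> x)"
    using assms(4) \<phi> by (simp add: weak_deriv_def)
qed

lemma weak_deriv_add_const:
  assumes f: "f \<in> L2 l" and l: "0 < l" and w: "weak_deriv l f w"
  shows "weak_deriv l (\<lambda>x. a + f x) w"
  unfolding weak_deriv_def
proof
  fix \<phi> assume \<phi>: "\<phi> \<in> C1c l"
  let ?D = "\<lambda>x. vector_derivative \<phi> (at x)"
  have D: "integrable (lebI l) ?D"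
    using C1c_D(2)[OF \<phi>] by (intro integrable_lebI) (auto elim: continuous_on_subset)
  have "(LINT x|lebI l. ?D x) = 0"
    using integral_lebI(1)[OF D] integral_unique[OF C1c_integral[OF \<phi>, of 0 l]] C1c_D[OF \<phi>] l by simp
  then have "(LINT x|lebI l. (a + f x) * ?D x) = (LINT x|lebI l. f x * ?D x)"
    using D Cc_integrable_mult[OF L2_integrable[OF f] C1c_D(2)[OF \<phi>]] by (simp add: distrib_right)
  then show "(LINT x|lebI l. (a + f x) * ?D x) = - (LINT x|lebI l. w x * \<phi> x)"
    using w \<phi> by (simp add: weak_deriv_def)
qed

lemma weak_deriv_diff:
  assumes "f \<in> L2 l" "g \<in> L2 l" "weak_deriv l f w" "weak_deriv l g w" "0 < l"
  obtains c where "AE x in lebI l. f x = c + g x"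
proof -
  obtain c where "AE x in lebI l. f x - g x = c"
  proof (rule du_Bois_Reymond)
    show "integrable (lebI l) (\<lambda>x. f x - g x)"
      using assms L2_integrable by (intro Bochner_Integration.integrable_diff) auto
    fix \<phi> assume \<phi>: "\<phi> \<in> C1c l"
    have "(LINT x|lebI l. (f x - g x) * vector_derivative \<phi> (at x))
      = (LINT x|lebI l. f x * vector_derivative \<phi> (at x)) - (LINT x|lebI l. g x * vector_derivative \<phi> (at x))"
      using assms C1c_D(2)[OF \<phi>] unfolding left_diff_distrib
      by (intro Bochner_Integration.integral_diff Cc_integrable_mult L2_integrable) auto
    then show "(LINT x|lebI l. (f x - g x) * vector_derivative \<phi> (at x)) = 0"
      using assms(3,4) \<phi> by (simp add: weak_deriv_def)
  qed (use assms in auto)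
  then show ?thesis by (intro that[of c]) (auto elim!: eventually_mono simp: algebra_simps)
qed

lemma norm_integral_le_L1:
  fixes f :: "real \<Rightarrow> 'b::euclidean_space"
  assumes f: "integrable (lebI l) f" and x: "x \<in> {0..l}"
  shows "norm (integral {0..x} f) \<le> (LINT x|lebI l. norm (f x))"
proof -
  have i: "f integrable_on {0..x}" "(\<lambda>x. norm (f x)) integrable_on {0..l}"
    using integral_lebI(2)[OF f] integral_lebI(2)[OF integrable_norm[OF f]] x
    by (auto intro: integrable_initial)
  have "norm (integral {0..x} f) \<le> integral {0..x} (\<lambda>x. norm (f x))"
    using x by (intro integral_norm_bound_integral i integrable_initial[OF i(2)]) auto
  also have "\<dots> \<le> integral {0..l} (\<lambda>x. norm (f x))"
    using x i by (intro integral_subset_le integrable_initial[OF i(2)]) auto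
  also have "\<dots> = (LINT x|lebI l. norm (f x))" using integral_lebI(1)[OF integrable_norm[OF f]] by simp
  finally show ?thesis .
qed

lemma indefinite_integral_L2:
  assumes "f \<in> L2 l"
  shows "(\<lambda>x. integral {0..x} f) \<in> L2 l" "continuous_on {0..l} (\<lambda>x. integral {0..x} f)"
proof -
  show c: "continuous_on {0..l} (\<lambda>x. integral {0..x} f)"
    using integral_lebI(2)[OF L2_integrable[OF assms]] by (rule indefinite_integral_continuous_1)
  then show "(\<lambda>x. integral {0..x} f) \<in> L2 l" by (rule L2_continuous)
qed

lemma integral_const_add:
  fixes f :: "real \<Rightarrow> complex"
  assumes "f integrable_on {0..l}" "x \<in> {0..l}"
  shows "integral {0..x} (\<lambda>t. a + integral {0..t} f) = x *\<^sub>R a + dint f x"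
proof -
  have "integral {0..x} (\<lambda>t. a + integral {0..t} f)
      = integral {0..x} (\<lambda>t. a) + integral {0..x} (\<lambda>t. integral {0..t} f)"
    using assms by (intro integral_add integrable_indefinite_integral[OF assms(1)]) auto
  then show ?thesis using assms(2) by (simp add: dint_def)
qed

text \<open>An element of \<open>H10\<close> is the integral of its weak derivative, because its approximants are
  the integrals of theirs; the same limit at \<open>l\<close> is the boundary condition.\<close>

lemma H10_integral:
  assumes f: "f \<in> H10 l" and l: "0 < l"
  shows "AE x in lebI l. f x = integral {0..x} (wderiv l f)" "integral {0..l} (wderiv l f) = 0"
proof -
  define w where "w = wderiv l f"
  have fH: "f \<in> H1 l" using f by (simp add: H10_def)
  have fL: "f \<in> L2 l" using fH by (simp add: H1_def)
  have w: "w \<in> L2 l" using wderiv_H1[OF fH] by (simp add: w_def)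
  obtain \<phi> where \<phi>: "\<And>k. \<phi> k \<in> C1c l" and l1: "(\<lambda>k. nrm l (\<lambda>x. f x - \<phi> k x)) \<longlonglongrightarrow> 0"
    and l2: "(\<lambda>k. nrm l (\<lambda>x. w x - vector_derivative (\<phi> k) (at x))) \<longlonglongrightarrow> 0"
    using f unfolding H10_def w_def by blast
  define D where "D k x = vector_derivative (\<phi> k) (at x)" for k x
  have cI: "continuous_on {0..l} (D k)" "continuous_on {0..l} (\<phi> k)" for k
    using C1c_D(2,3)[OF \<phi>[of k]] by (auto simp: D_def[abs_def] elim: continuous_on_subset)
  have DL: "D k \<in> L2 l" and \<phi>L: "\<phi> k \<in> L2 l" for k using cI by (auto intro: L2_continuous)
  define G where "G x = integral {0..x} w" for x
  have G: "G \<in> L2 l" using indefinite_integral_L2(1)[OF w] by (simp add: G_def[abs_def])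
  have wi: "w integrable_on {0..l}" using integral_lebI(2)[OF L2_integrable[OF w]] .
  define \<epsilon> where "\<epsilon> k = sqrt l * nrm l (\<lambda>x. w x - D k x)" for k
  have \<epsilon>: "\<epsilon> \<longlonglongrightarrow> 0" unfolding \<epsilon>_def[abs_def] using tendsto_mult_right_zero[OF l2] by (simp add: D_def)
  have diff: "norm (G x - \<phi> k x) \<le> \<epsilon> k" if x: "x \<in> {0..l}" for x k
  proof -
    have "integral {0..x} (D k) = \<phi> k x"
      using integral_unique[OF C1c_integral[OF \<phi>[of k], of 0 x]] x C1c_D(4)[OF \<phi>[of k]] by (simp add: D_def[abs_def])
    then have "G x - \<phi> k x = integral {0..x} (\<lambda>x. w x - D k x)"
      using x cI(1)[of k] unfolding G_def
      by (subst integral_diff) (auto intro!: integrable_initial[OF wi]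
          integrable_initial[OF integrable_continuous_interval[OF cI(1)[of k]]])
    also have "norm \<dots> \<le> (LINT x|lebI l. norm (w x - D k x))"
      using x by (intro norm_integral_le_L1 L2_integrable L2_diff w DL)
    also have "\<dots> \<le> \<epsilon> k" unfolding \<epsilon>_def by (intro L1_le_nrm l L2_diff w DL)
    finally show ?thesis .
  qed
  have "norm (G l) \<le> \<epsilon> k" for k using diff[of l k] l C1c_D(5)[OF \<phi>[of k]] by simp
  then have "norm (G l) \<le> 0" using \<epsilon> by (intro LIMSEQ_le_const[OF \<epsilon>]) auto
  then show "integral {0..l} (wderiv l f) = 0" by (simp add: G_def w_def)
  have fG: "integrable (lebI l) (\<lambda>x. f x - G x)" by (intro L2_integrable L2_diff fL G)
  have "(LINT x|lebI l. norm (f x - G x)) \<le> sqrt l * nrm l (\<lambda>x. f x - \<phi> k x) + \<epsilon> k * l" for k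
  proof -
    have i: "integrable (lebI l) (\<lambda>x. norm (f x - \<phi> k x))"
      by (intro integrable_norm L2_integrable L2_diff fL \<phi>L)
    have ic: "integrable (lebI l) (\<lambda>x. \<epsilon> k)" by (intro integrable_lebI continuous_intros)
    have "(LINT x|lebI l. norm (f x - G x)) \<le> (LINT x|lebI l. norm (f x - \<phi> k x) + \<epsilon> k)"
    proof (rule integral_mono[OF integrable_norm[OF fG] Bochner_Integration.integrable_add[OF i ic]])
      fix x assume "x \<in> space (lebI l)"
      then have "norm (G x - \<phi> k x) \<le> \<epsilon> k" by (intro diff) auto
      then show "norm (f x - G x) \<le> norm (f x - \<phi> k x) + \<epsilon> k"
        using norm_triangle_ineq4[of "f x - \<phi> k x" "G x - \<phi> k x"] by simp
    qed
    also have "\<dots> = (LINT x|lebI l. norm (f x - \<phi> k x)) + \<epsilon> k * l"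
      using i ic l by (simp add: measure_restrict_space)
    also have "\<dots> \<le> sqrt l * nrm l (\<lambda>x. f x - \<phi> k x) + \<epsilon> k * l"
      using L1_le_nrm[OF l L2_diff[OF fL \<phi>L]] by simp
    finally show ?thesis .
  qed
  moreover have "(\<lambda>k. sqrt l * nrm l (\<lambda>x. f x - \<phi> k x) + \<epsilon> k * l) \<longlonglongrightarrow> sqrt l * 0 + 0 * l"
    by (intro tendsto_intros l1 \<epsilon>)
  ultimately have "(LINT x|lebI l. norm (f x - G x)) \<le> 0"
    by (intro LIMSEQ_le_const[of _ 0]) auto
  then have "(LINT x|lebI l. norm (f x - G x)) = 0"
    using Bochner_Integration.integral_nonneg[of "lebI l" "\<lambda>x. norm (f x - G x)"] by (intro antisym) auto
  then have "AE x in lebI l. norm (f x - G x) = 0"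
    using fG by (subst (asm) integral_nonneg_eq_0_iff_AE) auto
  then show "AE x in lebI l. f x = integral {0..x} (wderiv l f)" by (simp add: G_def w_def)
qed

text \<open>The operator domain consists of double integrals: one integration comes from the weak
  derivative of \<open>wderiv l f\<close>, the other one and the boundary condition from \<open>H10_integral\<close>.\<close>

lemma H2_H10_representation:
  assumes f: "f \<in> H2 l \<inter> H10 l" and l: "0 < l"
  defines "\<phi> \<equiv> wderiv l (wderiv l f)"
  obtains a where "\<phi> \<in> L2 l" "AE x in lebI l. f x = x *\<^sub>R a + dint \<phi> x" "l *\<^sub>R a + dint \<phi> l = 0"
proof -
  define w where "w = wderiv l f"
  have H: "f \<in> H1 l" "w \<in> H1 l" using f by (auto simp: H2_def w_def)
  have w: "w \<in> L2 l" and \<phi>: "\<phi> \<in> L2 l" "weak_deriv l w \<phi>"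
    using wderiv_H1[OF H(1)] wderiv_H1[OF H(2)] by (auto simp: w_def \<phi>_def)
  note i = L2_integrable[OF \<phi>(1)]
  obtain a where a: "AE x in lebI l. w x = a + integral {0..x} \<phi>"
    using weak_deriv_diff[OF w indefinite_integral_L2(1)[OF \<phi>(1)] \<phi>(2)
        weak_deriv_indefinite_integral[OF i l] l] .
  have "integral {0..x} w = x *\<^sub>R a + dint \<phi> x" if "x \<in> {0..l}" for x
    using integral_cong_lebI[OF a, of x] integral_const_add[OF integral_lebI(2)[OF i] that] that by simp
  moreover have "AE x in lebI l. f x = integral {0..x} w" "integral {0..l} w = 0"
    using H10_integral[of f l] f l by (auto simp: w_def)
  ultimately have "AE x in lebI l. f x = x *\<^sub>R a + dint \<phi> x" "l *\<^sub>R a + dint \<phi> l = 0"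
    using l by (auto simp: AE_restrict_space_iff elim!: eventually_mono)
  with \<phi> show ?thesis by (intro that)
qed

lemma nrm_le:
  assumes l: "0 < l" and B: "0 \<le> B" and f: "f \<in> L2 l" and le: "AE x in lebI l. norm (f x) \<le> B"
  shows "nrm l f \<le> B * sqrt l"
proof -
  have "(LINT x|lebI l. (norm (f x))\<^sup>2) \<le> (LINT x|lebI l. B\<^sup>2)"
    using f le by (intro integral_mono_AE)
      (auto simp: L2_def intro!: integrable_lebI continuous_intros elim!: eventually_mono intro: power_mono)
  also have "\<dots> = B\<^sup>2 * l" using l by (simp add: measure_restrict_space)
  finally have "nrm l f \<le> sqrt (B\<^sup>2 * l)" unfolding nrm_def by (rule real_sqrt_le_mono)
  then show ?thesis using B by (simp add: real_sqrt_mult)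
qed

text \<open>Test functions that approximate \<open>f\<close> in \<open>H1\<close> are primitives of cut off versions of \<open>V\<close>. Their mean
  is corrected by a fixed cutoff; the correction tends to zero because \<open>V\<close> itself has mean zero.\<close>

lemma H10I:
  assumes V: "continuous_on {0..l} V" and l: "0 < l"
    and f: "\<And>x. x \<in> {0..l} \<Longrightarrow> f x = integral {0..x} V" "f l = 0"
    and fH: "f \<in> H1 l" and wV: "AE x in lebI l. wderiv l f x = V x"
  shows "f \<in> H10 l"
proof -
  obtain k0 where k0: "(LINT x|lebI l. cutoff l k0 x) \<noteq> 0" using cutoff_integral_nonzero[OF l] .
  define m where "m = (LINT x|lebI l. cutoff l k0 x)"
  have cutCc: "cutoff l k \<in> Cc l" for k using cutoff_mult_Cc[of "\<lambda>x. 1" l k] l by simp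
  define W where "W x = V (clamp 0 l x)" for x
  have W: "continuous_on UNIV W" unfolding W_def[abs_def]
    using V l by (intro continuous_on_compose2[OF V] clamp_continuous_on) (auto simp: clamp_def)
  have WV: "W x = V x" if "x \<in> {0..l}" for x using that by (simp add: W_def)
  have Vi: "integrable (lebI l) V" using V by (rule integrable_lebI)
  define J where "J k = (LINT x|lebI l. cutoff l k x * W x)" for k
  define \<theta> where "\<theta> k x = cutoff l k x * W x - J k / m * cutoff l k0 x" for k x
  have \<theta>: "\<theta> k \<in> Cc l" for k
    unfolding \<theta>_def[abs_def] by (intro Cc_lin cutoff_mult_Cc W l cutCc)
  then have \<theta>c: "continuous_on UNIV (\<theta> k)" for k by (simp add: Cc_def)
  have cW: "continuous_on UNIV (\<lambda>x. cutoff l k x * W x)" "continuous_on UNIV (cutoff l k)" for k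
    using cutoff_mult_Cc[OF W l, of k] cutCc[of k] by (auto simp: Cc_def)
  have ii: "integrable (lebI l) (\<lambda>x. cutoff l k x * W x)" "integrable (lebI l) (cutoff l k)"
    "integrable (lebI l) (\<theta> k)" for k
    using cW[of k] \<theta>c[of k] by (auto intro!: integrable_lebI elim: continuous_on_subset)
  have "primitive (\<theta> k) l = 0" for k
  proof -
    have "primitive (\<theta> k) l = (LINT x|lebI l. \<theta> k x)" by (rule primitive_eq_lebI[OF \<theta>c])
    also have "\<dots> = J k - J k / m * m" using ii by (simp add: \<theta>_def J_def m_def)
    finally show ?thesis using k0 by (simp add: m_def)
  qed
  note \<phi> = primitive_C1c[OF \<theta> this]
  have "bounded (V ` {0..l})" using V by (intro compact_imp_bounded compact_continuous_image) auto
  then obtain B where B: "\<And>x. x \<in> {0..l} \<Longrightarrow> norm (V x) \<le> B" unfolding bounded_iff by (metis imageI)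
  have B0: "0 \<le> B" using order_trans[OF norm_ge_zero B[of 0]] l by auto
  have cutB: "norm (cutoff l k x * W x) \<le> B" if "x \<in> {0..l}" for k x
    using mult_mono[OF norm_cutoff[of l k x] B[OF that]] WV[OF that] by (simp add: norm_mult)
  have J0: "J \<longlonglongrightarrow> 0"
  proof -
    have "(\<lambda>k. LINT x|lebI l. cutoff l k x * W x) \<longlonglongrightarrow> (LINT x|lebI l. V x)"
    proof (rule integral_dominated_convergence[where w = "\<lambda>x. B"])
      show "AE x in lebI l. (\<lambda>k. cutoff l k x * W x) \<longlonglongrightarrow> V x"
      proof (rule AE_I2)
        fix x assume "x \<in> space (lebI l)"
        then have "x \<in> {0<..<l}" by simp
        from tendsto_mult[OF cutoff_tendsto[OF this] tendsto_const[of "W x"]] WV[of x] this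
        show "(\<lambda>k. cutoff l k x * W x) \<longlonglongrightarrow> V x" by simp
      qed
      show "AE x in lebI l. norm (cutoff l k x * W x) \<le> B" for k by (rule AE_I2) (simp add: cutB)
    qed (use ii Vi in \<open>auto intro!: integrable_lebI continuous_intros\<close>)
    also have "(LINT x|lebI l. V x) = 0" using integral_lebI(1)[OF Vi] f l by simp
    finally show ?thesis by (simp add: J_def[abs_def])
  qed
  have \<theta>V: "(\<lambda>k. \<theta> k x) \<longlonglongrightarrow> V x" if x: "x \<in> {0<..<l}" for x
  proof -
    have "(\<lambda>k. \<theta> k x) \<longlonglongrightarrow> 1 * W x - 0 / m * cutoff l k0 x"
      unfolding \<theta>_def using k0 by (intro tendsto_intros cutoff_tendsto x J0) (auto simp: m_def)
    then show ?thesis using WV x by simp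
  qed
  obtain BJ where BJ: "\<And>k. norm (J k) \<le> BJ"
    using convergent_imp_Bseq[OF convergentI[OF J0]] unfolding Bseq_def by blast
  define Q where "Q = 2 * B + BJ / norm m"
  have \<theta>Q: "norm (V x - \<theta> k x) \<le> Q" if x: "x \<in> {0<..<l}" for k x
  proof -
    have "norm (J k / m * cutoff l k0 x) \<le> BJ / norm m * 1"
      unfolding norm_mult norm_divide using BJ[of k] norm_cutoff
      by (intro mult_mono divide_right_mono) (auto intro: divide_nonneg_nonneg order_trans[OF norm_ge_zero])
    moreover have "V x - \<theta> k x = V x - cutoff l k x * W x + J k / m * cutoff l k0 x" by (simp add: \<theta>_def)
    then have "norm (V x - \<theta> k x) \<le> norm (V x - cutoff l k x * W x) + norm (J k / m * cutoff l k0 x)"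
      using norm_triangle_ineq by metis
    moreover have "norm (V x) \<le> B" "norm (cutoff l k x * W x) \<le> B" using B cutB x by auto
    ultimately show ?thesis
      using norm_triangle_ineq4[of "V x" "cutoff l k x * W x"] unfolding Q_def by linarith
  qed
  have Vth: "continuous_on {0..l} (\<lambda>x. V x - \<theta> k x)" for k
    using V \<theta>c[of k] by (intro continuous_on_diff) (auto elim: continuous_on_subset)
  have N: "(\<lambda>k. nrm l (\<lambda>x. V x - \<theta> k x)) \<longlonglongrightarrow> 0"
  proof -
    have "(\<lambda>k. LINT x|lebI l. (norm (V x - \<theta> k x))\<^sup>2) \<longlonglongrightarrow> (LINT x|lebI l. 0)"
    proof (rule integral_dominated_convergence[where w = "\<lambda>x. Q\<^sup>2"])
      show "AE x in lebI l. (\<lambda>k. (norm (V x - \<theta> k x))\<^sup>2) \<longlonglongrightarrow> 0"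
      proof (rule AE_I2)
        fix x assume "x \<in> space (lebI l)"
        then have "(\<lambda>k. \<theta> k x) \<longlonglongrightarrow> V x" by (intro \<theta>V) simp
        then have "(\<lambda>k. (norm (V x - \<theta> k x))\<^sup>2) \<longlonglongrightarrow> (norm (V x - V x))\<^sup>2" by (intro tendsto_intros)
        then show "(\<lambda>k. (norm (V x - \<theta> k x))\<^sup>2) \<longlonglongrightarrow> 0" by simp
      qed
      show "AE x in lebI l. norm ((norm (V x - \<theta> k x))\<^sup>2) \<le> Q\<^sup>2" for k
        using power_mono[OF \<theta>Q norm_ge_zero] by (intro AE_I2) simp
      show "(\<lambda>x. (norm (V x - \<theta> k x))\<^sup>2) \<in> borel_measurable (lebI l)" for k
        by (intro measurable_lebI continuous_intros Vth)
    qed (auto intro!: integrable_lebI continuous_intros)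
    then show ?thesis unfolding nrm_def using tendsto_real_sqrt by fastforce
  qed
  define \<epsilon> where "\<epsilon> k = sqrt l * nrm l (\<lambda>x. V x - \<theta> k x)" for k
  have \<epsilon>: "\<epsilon> \<longlonglongrightarrow> 0" unfolding \<epsilon>_def[abs_def] using tendsto_mult_right_zero[OF N] .
  have diff: "norm (f x - primitive (\<theta> k) x) \<le> \<epsilon> k" if x: "x \<in> {0..l}" for x k
  proof -
    have "f x - primitive (\<theta> k) x = integral {0..x} (\<lambda>x. V x - \<theta> k x)"
      unfolding f(1)[OF x] primitive_def using x
      by (intro integral_diff[symmetric] integrable_initial[OF integral_lebI(2)[OF Vi]]
          integrable_initial[OF integral_lebI(2)[OF ii(3)]]) auto
    also have "norm \<dots> \<le> (LINT x|lebI l. norm (V x - \<theta> k x))"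
      using x by (intro norm_integral_le_L1 integrable_lebI Vth)
    also have "\<dots> \<le> \<epsilon> k" unfolding \<epsilon>_def by (intro L1_le_nrm l L2_continuous Vth)
    finally show ?thesis .
  qed
  have fc: "f \<in> L2 l" using fH by (simp add: H1_def)
  have pc: "continuous_on {0..l} (primitive (\<theta> k))" for k
    by (rule continuous_on_subset[OF C1c_D(3)[OF \<phi>(1)]]) simp
  have "nrm l (\<lambda>x. f x - primitive (\<theta> k) x) \<le> \<epsilon> k * sqrt l" for k
  proof -
    have \<epsilon>0: "0 \<le> \<epsilon> k" using diff[of 0 k] l norm_ge_zero order_trans by (metis atLeastAtMost_iff less_eq_real_def)
    show ?thesis
      using diff by (intro nrm_le l \<epsilon>0 L2_diff fc L2_continuous pc AE_I2) auto
  qed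
  then have le: "\<forall>\<^sub>F k in sequentially. norm (nrm l (\<lambda>x. f x - primitive (\<theta> k) x)) \<le> \<epsilon> k * sqrt l"
    by (simp add: nrm_def)
  have "(\<lambda>k. \<epsilon> k * sqrt l) \<longlonglongrightarrow> 0" using tendsto_mult_left_zero[OF \<epsilon>] .
  from Lim_null_comparison[OF le this]
  have N1: "(\<lambda>k. nrm l (\<lambda>x. f x - primitive (\<theta> k) x)) \<longlonglongrightarrow> 0"
    .
  have "nrm l (\<lambda>x. wderiv l f x - vector_derivative (primitive (\<theta> k)) (at x)) = nrm l (\<lambda>x. V x - \<theta> k x)" for k
  proof -
    have m1: "wderiv l f \<in> borel_measurable (lebI l)" using wderiv_H1[OF fH] by (simp add: L2_def)
    have m2: "\<theta> k \<in> borel_measurable (lebI l)" using ii(3)[of k] by auto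
    have m3: "V \<in> borel_measurable (lebI l)" using Vi by auto
    show ?thesis unfolding nrm_def \<phi>(2) using wV m1 m2 m3
      by (intro arg_cong[of _ _ sqrt] integral_cong_AE) (auto elim: eventually_mono)
  qed
  then show ?thesis using fH \<phi>(1) N N1 unfolding H10_def
    by (intro CollectI conjI exI[of _ "\<lambda>k. primitive (\<theta> k)"]) auto
qed

text \<open>Converse of the representation: double integrals with the right boundary value are in the domain
  and have the expected second derivative.\<close>

lemma H2_H10I:
  assumes \<phi>: "\<phi> \<in> L2 l" and l: "0 < l"
    and f: "\<And>x. x \<in> {0..l} \<Longrightarrow> f x = x *\<^sub>R a + dint \<phi> x" "f l = 0"
  shows "f \<in> H2 l \<inter> H10 l" "AE x in lebI l. wderiv l (wderiv l f) x = \<phi> x"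
proof -
  note i = L2_integrable[OF \<phi>]
  define V where "V x = a + integral {0..x} \<phi>" for x
  have Vc: "continuous_on {0..l} V"
    unfolding V_def using indefinite_integral_L2(2)[OF \<phi>] by (intro continuous_intros)
  have VL: "V \<in> L2 l" using Vc by (rule L2_continuous)
  have fV: "f x = integral {0..x} V" if "x \<in> {0..l}" for x
    using f(1)[OF that] integral_const_add[OF integral_lebI(2)[OF i] that] by (simp add: V_def[abs_def])
  have ii: "continuous_on {0..l} (\<lambda>x. integral {0..x} V)" using indefinite_integral_L2(2)[OF VL] .
  have fL: "f \<in> L2 l"
    by (rule L2_continuous[OF continuous_on_eq[OF ii]]) (simp add: fV)
  have "weak_deriv l (\<lambda>x. integral {0..x} V) V" by (rule weak_deriv_indefinite_integral[OF L2_integrable[OF VL] l])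
  then have wf: "weak_deriv l f V"
    using fV by (intro weak_deriv_cong_AE[OF _ fL L2_continuous[OF ii]] AE_I2) auto
  note f1 = wderiv_eq[OF fL VL wf l]
  have wV: "weak_deriv l V \<phi>"
    unfolding V_def[abs_def]
    by (rule weak_deriv_add_const[OF indefinite_integral_L2(1)[OF \<phi>] l weak_deriv_indefinite_integral[OF i l]])
  have wL: "wderiv l f \<in> L2 l" using wderiv_H1[OF f1(1)] by simp
  have "weak_deriv l (wderiv l f) \<phi>" by (rule weak_deriv_cong_AE[OF f1(2) wL VL wV])
  note f2 = wderiv_eq[OF wL \<phi> this l]
  show "AE x in lebI l. wderiv l (wderiv l f) x = \<phi> x" by (rule f2(2))
  show "f \<in> H2 l \<inter> H10 l"
    using f1 f2 H10I[OF Vc l fV f(2) f1] by (simp add: H2_def)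
qed

section \<open>Boundary value problems with a border\<close>

text \<open>A boundary value problem in which the initial slope \<open>a\<close> is part of the solution and enters the
  condition at \<open>l\<close> through \<open>Z\<close>. For \<open>Z = 0\<close> and \<open>\<zeta> = 0\<close> it is the Dirichlet problem; a border \<open>Z\<close> of
  finite rank serves to remove a kernel.\<close>

definition bsol :: "real \<Rightarrow> (real \<Rightarrow> 'b \<Rightarrow> 'b) \<Rightarrow> ('b \<Rightarrow> 'b) \<Rightarrow> (real \<Rightarrow> 'b) \<Rightarrow> 'b
    \<Rightarrow> (real \<Rightarrow> 'b::euclidean_space) \<Rightarrow> 'b \<Rightarrow> bool"
  where "bsol l A Z P \<zeta> U a \<longleftrightarrow> sol l A (\<lambda>x. x *\<^sub>R a + P x) U \<and> U l + Z a = \<zeta>"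

text \<open>Solvability for all data, with one constant bounding every solution; in particular solutions
  are unique.\<close>

definition well_posed :: "real \<Rightarrow> (real \<Rightarrow> 'b \<Rightarrow> 'b) \<Rightarrow> ('b \<Rightarrow> 'b::euclidean_space) \<Rightarrow> real \<Rightarrow> bool"
  where "well_posed l A Z K \<longleftrightarrow> 0 < K \<and>
    (\<forall>P \<zeta>. continuous_on {0..l} P \<longrightarrow> (\<exists>U a. bsol l A Z P \<zeta> U a)) \<and>
    (\<forall>P \<zeta> U a \<kappa>. bsol l A Z P \<zeta> U a \<longrightarrow> continuous_on {0..l} P \<longrightarrow> (\<forall>x\<in>{0..l}. norm (P x) \<le> \<kappa>) \<longrightarrow>
      norm a \<le> K * (\<kappa> + norm \<zeta>) \<and> (\<forall>x\<in>{0..l}. norm (U x) \<le> K * (\<kappa> + norm \<zeta>)))"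

lemma well_posed_solvable:
  "well_posed l A Z K \<Longrightarrow> continuous_on {0..l} P \<Longrightarrow> \<exists>U a. bsol l A Z P \<zeta> U a"
  by (simp add: well_posed_def)

lemma well_posed_bound:
  assumes "well_posed l A Z K" "bsol l A Z P \<zeta> U a" "continuous_on {0..l} P"
    "\<And>x. x \<in> {0..l} \<Longrightarrow> norm (P x) \<le> \<kappa>"
  shows "norm a \<le> K * (\<kappa> + norm \<zeta>)" "x \<in> {0..l} \<Longrightarrow> norm (U x) \<le> K * (\<kappa> + norm \<zeta>)"
  using assms unfolding well_posed_def by blast+

lemma sol_cong:
  assumes "\<And>x. x \<in> {0..l} \<Longrightarrow> P x = Q x"
  shows "sol l A P U \<longleftrightarrow> sol l A Q U"
  using assms by (simp add: sol_def)

context volterra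
begin

lemma sol_unique:
  assumes "sol l A P U" "sol l A P V" "x \<in> {0..l}"
  shows "U x = V x"
proof -
  have "sol l A (\<lambda>x. P x + (-1) *\<^sub>R P x) (\<lambda>x. U x + (-1) *\<^sub>R V x)"
    using assms by (intro sol_add sol_scale)
  from sol_bound[OF this, of 0 x] assms(3) show ?thesis by simp
qed

lemma bsol_add:
  assumes "linear Z" "bsol l A Z P \<zeta> U a" "bsol l A Z Q \<eta> V b"
  shows "bsol l A Z (\<lambda>x. P x + Q x) (\<zeta> + \<eta>) (\<lambda>x. U x + V x) (a + b)"
  using sol_add[of "\<lambda>x. x *\<^sub>R a + P x" U "\<lambda>x. x *\<^sub>R b + Q x" V] assms
  by (auto simp: bsol_def linear_add algebra_simps)

lemma bsol_scale:
  assumes "linear Z" "bsol l A Z P \<zeta> U a"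
  shows "bsol l A Z (\<lambda>x. c *\<^sub>R P x) (c *\<^sub>R \<zeta>) (\<lambda>x. c *\<^sub>R U x) (c *\<^sub>R a)"
  using sol_scale[of "\<lambda>x. x *\<^sub>R a + P x" U c] assms
  by (auto simp: bsol_def linear_scale algebra_simps)

lemma bsol_zero: "linear Z \<Longrightarrow> bsol l A Z (\<lambda>x. 0) 0 (\<lambda>x. 0) 0"
proof -
  assume Z: "linear Z"
  have "dint (\<lambda>r. A r 0) x = dint (\<lambda>r. 0) x" if "x \<in> {0..l}" for x
    using that by (intro dint_cong) (auto simp: linear_0[OF lin])
  then show ?thesis using Z by (simp add: bsol_def sol_def linear_0)
qed

lemma bsol_sum:
  assumes "linear Z" "finite I" "\<And>i. i \<in> I \<Longrightarrow> bsol l A Z (P i) (\<zeta> i) (U i) (a i)"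
  shows "bsol l A Z (\<lambda>x. \<Sum>i\<in>I. P i x) (\<Sum>i\<in>I. \<zeta> i) (\<lambda>x. \<Sum>i\<in>I. U i x) (\<Sum>i\<in>I. a i)"
  using assms(2,3)
proof (induction rule: finite_induct)
  case empty
  then show ?case using bsol_zero[OF assms(1)] by simp
next
  case (insert i I)
  then show ?case using bsol_add[OF assms(1), of "P i" "\<zeta> i" "U i" "a i"] by simp
qed

text \<open>The two initial conditions \<open>U(0) = 0\<close> and \<open>U'(0) = a\<close> determine \<open>U\<close>, so the boundary
  condition at \<open>l\<close> is a square linear system for \<open>a\<close>; injectivity of a square system is solvability
  with a bound.\<close>

lemma bsol_well_posed:
  assumes Z: "linear Z"
    and triv: "\<forall>U a. bsol l A Z (\<lambda>x. 0) 0 U a \<longrightarrow> a = 0"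
  obtains K where "well_posed l A Z K"
proof -
  have "\<exists>U. sol l A (\<lambda>x. x *\<^sub>R a) U" for a :: 'b
    by (rule sol_exists[of "\<lambda>x. x *\<^sub>R a"]) (auto intro!: continuous_intros)
  then obtain Y where Y: "\<And>a :: 'b. sol l A (\<lambda>x. x *\<^sub>R a) (Y a)" by metis
  define F where "F a = Y a l + Z a" for a
  have lI: "l \<in> {0..l}" using l_pos by auto
  have YF: "bsol l A Z (\<lambda>x. 0) (F a) (Y a) a" for a
    using Y by (simp add: bsol_def F_def)
  have linF: "linear F"
  proof (rule linearI)
    fix a b c
    have "sol l A (\<lambda>x. x *\<^sub>R (a + b)) (\<lambda>x. Y a x + Y b x)"
      using sol_add[OF Y[of a] Y[of b]] by (simp add: scaleR_right_distrib)
    from sol_unique[OF Y this lI] show "F (a + b) = F a + F b"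
      using linear_add[OF Z] by (simp add: F_def)
    have "sol l A (\<lambda>x. x *\<^sub>R (c *\<^sub>R a)) (\<lambda>x. c *\<^sub>R Y a x)"
      using sol_scale[OF Y[of a], of c] by (simp add: mult.commute)
    from sol_unique[OF Y this lI] show "F (c *\<^sub>R a) = c *\<^sub>R F a"
      using linear_scale[OF Z] by (simp add: F_def scaleR_right_distrib)
  qed
  have "a = 0" if "F a = 0" for a using triv[rule_format, of "Y a" a] YF[of a] that by simp
  then have inj: "inj F" using linF by (simp add: linear_injective_0)
  then have surj: "surj F" using linF by (simp add: linear_injective_imp_surjective)
  obtain B where B: "0 < B" "\<And>a. B * norm a \<le> norm (F a)"
    using linear_inj_bounded_below_pos[OF linF inj] by metis
  define K1 where "K1 = (K0 + 1) / B"
  have K1: "0 < K1" using B K0_pos by (simp add: K1_def)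
  define K where "K = K1 + K0 * (l * K1 + 1)"
  have K: "0 < K" using K1 K0_pos l_pos by (simp add: K_def add_pos_pos)
  have "well_posed l A Z K" unfolding well_posed_def
  proof (intro conjI allI impI)
    show "0 < K" by (rule K)
  next
    fix P :: "real \<Rightarrow> 'b" and \<zeta> assume P: "continuous_on {0..l} P"
    obtain X where X: "sol l A P X" using sol_exists[OF P] .
    obtain a where a: "F a = \<zeta> - X l" using surj by (metis surjD)
    have "sol l A (\<lambda>x. x *\<^sub>R a + P x) (\<lambda>x. Y a x + X x)" by (rule sol_add[OF Y X])
    then have "bsol l A Z P \<zeta> (\<lambda>x. Y a x + X x) a"
      using a by (simp add: bsol_def F_def algebra_simps)
    then show "\<exists>U a. bsol l A Z P \<zeta> U a" by blast
  next
    fix P :: "real \<Rightarrow> 'b" and \<zeta> U a \<kappa>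
    assume b: "bsol l A Z P \<zeta> U a" and P: "continuous_on {0..l} P"
      and \<kappa>': "\<forall>x\<in>{0..l}. norm (P x) \<le> \<kappa>"
    have \<kappa>: "norm (P x) \<le> \<kappa>" if "x \<in> {0..l}" for x using \<kappa>' that by blast
    have \<kappa>0: "0 \<le> \<kappa>" using \<kappa>[OF lI] by (meson norm_ge_zero order_trans)
    obtain X where X: "sol l A P X" using sol_exists[OF P] .
    have XB: "norm (X x) \<le> K0 * \<kappa>" if "x \<in> {0..l}" for x using sol_bound[OF X \<kappa> that] .
    have "sol l A (\<lambda>x. x *\<^sub>R a + P x) (\<lambda>x. Y a x + X x)" by (rule sol_add[OF Y X])
    then have UX: "U x = Y a x + X x" if "x \<in> {0..l}" for x
      using sol_unique[of _ U] b that by (auto simp: bsol_def)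
    have "F a = \<zeta> - X l" using b UX[OF lI] by (simp add: bsol_def F_def algebra_simps)
    then have "B * norm a \<le> norm \<zeta> + K0 * \<kappa>"
      using B(2)[of a] XB[OF lI] norm_triangle_ineq4[of \<zeta> "X l"] by simp
    also have "\<dots> \<le> (K0 + 1) * (\<kappa> + norm \<zeta>)"
      using \<kappa>0 K0_pos by (simp add: algebra_simps)
    finally have a: "norm a \<le> K1 * (\<kappa> + norm \<zeta>)"
      using B(1) by (simp add: K1_def field_simps)
    have Ux: "norm (U x) \<le> K0 * (l * K1 + 1) * (\<kappa> + norm \<zeta>)" if x: "x \<in> {0..l}" for x
    proof -
      have "norm (y *\<^sub>R a + P y) \<le> l * norm a + \<kappa>" if "y \<in> {0..l}" for y
        using norm_triangle_ineq[of "y *\<^sub>R a" "P y"] \<kappa>[OF that] that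
          mult_right_mono[of y l "norm a"] by auto
      then have "norm (U x) \<le> K0 * (l * norm a + \<kappa>)"
        using b x sol_bound[of _ U "l * norm a + \<kappa>" x] by (auto simp: bsol_def)
      also have "\<dots> \<le> K0 * (l * (K1 * (\<kappa> + norm \<zeta>)) + (\<kappa> + norm \<zeta>))"
        using a K0_pos l_pos by (intro mult_left_mono add_mono) auto
      finally show ?thesis by (simp add: algebra_simps)
    qed
    have le: "K1 \<le> K" "K0 * (l * K1 + 1) \<le> K" using K1 K0_pos l_pos by (auto simp: K_def)
    have nn: "0 \<le> \<kappa> + norm \<zeta>" using \<kappa>0 by simp
    show "norm a \<le> K * (\<kappa> + norm \<zeta>)" by (rule order_trans[OF a mult_right_mono[OF le(1) nn]])
    show "\<forall>x\<in>{0..l}. norm (U x) \<le> K * (\<kappa> + norm \<zeta>)"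
      using order_trans[OF Ux mult_right_mono[OF le(2) nn]] by blast
  qed
  then show ?thesis by (rule that)
qed

end

section \<open>The resolvent equation in integrated form\<close>

text \<open>The coefficient of \<open>u'' = coef q r \<mu> u + f\<close>, which is \<open>(N - \<mu>) u = w\<close> solved for the second
  derivatives when \<open>q\<close>, \<open>r\<close> are the potentials of the two operators. It is real, so the same formula
  serves for real and complex functions.\<close>

definition coef :: "(real \<Rightarrow> real) \<Rightarrow> (real \<Rightarrow> real) \<Rightarrow> real \<Rightarrow> real \<Rightarrow> 'a::euclidean_space \<times> 'a \<Rightarrow> 'a \<times> 'a"
  where "coef q r \<mu> x u = (- (q x *\<^sub>R fst u) - \<mu> *\<^sub>R snd u, \<mu> *\<^sub>R fst u - r x *\<^sub>R snd u)"

lemma linear_coef: "linear (coef q r \<mu> x)"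
  by (rule linearI) (simp_all add: coef_def algebra_simps)

lemma norm_coef_le:
  assumes "\<bar>q x\<bar> \<le> Q" "\<bar>r x\<bar> \<le> Q" "\<bar>\<mu>\<bar> \<le> R"
  shows "norm (coef q r \<mu> x u) \<le> 2 * (Q + R) * norm u"
proof -
  have le: "\<bar>c\<bar> * norm v \<le> B * norm u" if "\<bar>c\<bar> \<le> B" "norm v \<le> norm u" for c B and v :: 'a
    using that by (intro mult_mono) auto
  have 1: "norm (fst u) \<le> norm u" "norm (snd u) \<le> norm u"
    using norm_fst_le[of "fst u" "snd u"] norm_snd_le[of "snd u" "fst u"] by simp_all
  have "norm (coef q r \<mu> x u) \<le> norm (- (q x *\<^sub>R fst u) - \<mu> *\<^sub>R snd u) + norm (\<mu> *\<^sub>R fst u - r x *\<^sub>R snd u)"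
    unfolding coef_def by (rule norm_Pair_le)
  also have "\<dots> \<le> (norm (q x *\<^sub>R fst u) + norm (\<mu> *\<^sub>R snd u)) + (norm (\<mu> *\<^sub>R fst u) + norm (r x *\<^sub>R snd u))"
    using norm_triangle_ineq4[of "- (q x *\<^sub>R fst u)" "\<mu> *\<^sub>R snd u"] norm_triangle_ineq4[of "\<mu> *\<^sub>R fst u" "r x *\<^sub>R snd u"]
    by simp
  also have "\<dots> \<le> (Q * norm u + R * norm u) + (R * norm u + Q * norm u)"
    using le[OF assms(1) 1(1)] le[OF assms(2) 1(2)] le[OF assms(3) 1(1)] le[OF assms(3) 1(2)] by simp
  finally show ?thesis by (simp add: algebra_simps)
qed

lemma continuous_on_coef:
  assumes "continuous_on S q" "continuous_on S r" "continuous_on S U"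
  shows "continuous_on S (\<lambda>x. coef q r \<mu> x (U x))"
  unfolding coef_def
  by (intro continuous_on_Pair continuous_on_diff continuous_on_minus continuous_on_scaleR
      continuous_on_fst continuous_on_snd continuous_on_const assms)

lemma volterra_coef:
  assumes l: "0 < l" and q: "continuous_on {0..l} q" and r: "continuous_on {0..l} r"
  obtains C where "volterra (coef q r \<mu> :: real \<Rightarrow> 'a::euclidean_space \<times> 'a \<Rightarrow> 'a \<times> 'a) l C"
proof -
  have "bounded (q ` {0..l})" "bounded (r ` {0..l})"
    using q r by (auto intro!: compact_imp_bounded compact_continuous_image)
  then obtain Q R where Q: "\<And>x. x \<in> {0..l} \<Longrightarrow> \<bar>q x\<bar> \<le> Q" and R: "\<And>x. x \<in> {0..l} \<Longrightarrow> \<bar>r x\<bar> \<le> R"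
    unfolding bounded_iff real_norm_def by (metis imageI)
  have "0 \<le> max Q R" using order_trans[OF abs_ge_zero Q[of 0]] l by auto
  moreover have "norm (coef q r \<mu> x u) \<le> 2 * (max Q R + \<bar>\<mu>\<bar>) * norm u" if "x \<in> {0..l}" for x and u :: "'a \<times> 'a"
    using Q[OF that] R[OF that] by (intro norm_coef_le) auto
  ultimately have "volterra (coef q r \<mu> :: real \<Rightarrow> 'a \<times> 'a \<Rightarrow> 'a \<times> 'a) l (2 * (max Q R + \<bar>\<mu>\<bar>))"
    using l by (intro volterra.intro linear_coef continuous_on_coef q r) auto
  then show ?thesis using that by blast
qed

lemma sol_map:
  assumes T: "bounded_linear T" and comm: "\<And>x u. x \<in> {0..l} \<Longrightarrow> T (A x u) = A' x (T u)"
    and s: "sol l A P U" and i: "(\<lambda>x. A x (U x)) integrable_on {0..l}"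
  shows "sol l A' (\<lambda>x. T (P x)) (\<lambda>x. T (U x))"
  unfolding sol_def
proof safe
  show "continuous_on {0..l} (\<lambda>x. T (U x))"
    using s by (auto simp: sol_def intro: bounded_linear.continuous_on[OF T])
  fix x assume x: "x \<in> {0..l}"
  have "dint (\<lambda>t. A' t (T (U t))) x = dint (\<lambda>t. T (A t (U t))) x"
    using x comm by (intro dint_cong) auto
  also have "\<dots> = T (dint (\<lambda>t. A t (U t)) x)" by (rule dint_bounded_linear[OF T i x])
  finally show "T (U x) = T (P x) + dint (\<lambda>t. A' t (T (U t))) x"
    using s x by (simp add: sol_def linear_add[OF bounded_linear.linear[OF T]])
qed

definition map_both :: "('a \<Rightarrow> 'b) \<Rightarrow> 'a \<times> 'a \<Rightarrow> 'b \<times> 'b"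
  where "map_both f u = (f (fst u), f (snd u))"

lemma bounded_linear_map_both:
  fixes f :: "'a::euclidean_space \<Rightarrow> 'b::euclidean_space"
  assumes "bounded_linear f"
  shows "bounded_linear (map_both f)"
proof -
  note L = bounded_linear.linear[OF assms]
  have "linear (map_both f)"
    by (intro linearI) (simp_all add: map_both_def linear_add[OF L] linear_scale[OF L])
  then show ?thesis by (rule linear_conv_bounded_linear[THEN iffD1])
qed

lemma map_both_coef:
  assumes "bounded_linear f"
  shows "map_both f (coef q r \<mu> x u) = coef q r \<mu> x (map_both f u)"
proof -
  note L = bounded_linear.linear[OF assms]
  show ?thesis by (simp add: map_both_def coef_def linear_diff[OF L] linear_scale[OF L] linear_neg[OF L])
qed

lemma bsol_map_both:
  fixes f :: "'a::euclidean_space \<Rightarrow> 'b::euclidean_space"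
  assumes f: "bounded_linear f" and q: "continuous_on {0..l} q" "continuous_on {0..l} r"
    and b: "bsol l (coef q r \<mu>) (\<lambda>_. 0) P 0 U a"
  shows "bsol l (coef q r \<mu>) (\<lambda>_. 0) (\<lambda>x. map_both f (P x)) 0 (\<lambda>x. map_both f (U x)) (map_both f a)"
proof -
  note F = bounded_linear_map_both[OF f]
  note L = bounded_linear.linear[OF F]
  have s: "sol l (coef q r \<mu>) (\<lambda>x. x *\<^sub>R a + P x) U" and Ul: "U l = 0"
    using b unfolding bsol_def by auto
  have "continuous_on {0..l} U" using s unfolding sol_def by blast
  then have i: "(\<lambda>x. coef q r \<mu> x (U x)) integrable_on {0..l}"
    by (rule integrable_continuous_interval[OF continuous_on_coef[OF q]])
  have "sol l (coef q r \<mu>) (\<lambda>x. map_both f (x *\<^sub>R a + P x)) (\<lambda>x. map_both f (U x))"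
    by (rule sol_map[OF F map_both_coef[OF f] s i])
  moreover have "map_both f (x *\<^sub>R a + P x) = x *\<^sub>R map_both f a + map_both f (P x)" for x
    by (simp only: linear_add[OF L] linear_scale[OF L])
  moreover have "map_both f (U l) = 0" unfolding Ul by (rule linear_0[OF L])
  ultimately show ?thesis unfolding bsol_def by simp
qed

lemma integrable_on_Pair:
  fixes f :: "real \<Rightarrow> 'a::euclidean_space" and g :: "real \<Rightarrow> 'b::euclidean_space"
  assumes "f integrable_on S" "g integrable_on S"
  shows "(\<lambda>x. (f x, g x)) integrable_on S"
proof -
  have "bounded_linear (\<lambda>x::'a. (x, 0::'b))" "bounded_linear (\<lambda>x::'b. (0::'a, x))"
    by (intro bounded_linear_Pair bounded_linear_ident bounded_linear_zero)+
  then have "(\<lambda>x. (f x, 0) + (0, g x)) integrable_on S"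
    using integrable_linear[OF assms(1), of "\<lambda>x. (x, 0)"] integrable_linear[OF assms(2), of "\<lambda>x. (0, x)"]
    by (intro integrable_add) (auto simp: comp_def)
  then show ?thesis by simp
qed

text \<open>\<open>(N - \<mu>) u = w\<close> is the second order system whose inhomogeneity is this rearrangement
  of \<open>w\<close>.\<close>

definition source :: "vfun \<Rightarrow> real \<Rightarrow> complex \<times> complex"
  where "source w x = (- snd w x, fst w x)"

lemma integrable_source:
  assumes "w \<in> L2 l \<times> L2 l"
  shows "source w integrable_on {0..l}"
  unfolding source_def[abs_def] using assms
  by (intro integrable_on_Pair integrable_neg integral_lebI(2) L2_integrable) auto

context
  fixes l m s :: real and g h q r :: "real \<Rightarrow> real"
  assumes l: "0 < l"
    and qr: "continuous_on {0..l} q" "continuous_on {0..l} r"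
    and q_def: "q = (\<lambda>x. s\<^sup>2 * g (s * x))" and r_def: "r = (\<lambda>x. s\<^sup>2 * h (s * x))"
begin

abbreviation (input) "N \<equiv> Nop l g h s"

lemma shift_N:
  "fst (shift N (of_real m) u) x = wderiv l (wderiv l (snd u)) x + r x *\<^sub>R snd u x - m *\<^sub>R fst u x"
  "snd (shift N (of_real m) u) x = - wderiv l (wderiv l (fst u)) x - q x *\<^sub>R fst u x - m *\<^sub>R snd u x"
  by (simp_all add: shift_def Nop_def Lop_def q_def r_def scaleR_conv_of_real)

lemma L2_scaleR: "f \<in> L2 l \<Longrightarrow> continuous_on {0..l} p \<Longrightarrow> (\<lambda>x. p x *\<^sub>R f x) \<in> L2 l"
  unfolding scaleR_conv_of_real by (intro L2_mult continuous_intros)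

lemma shift_N_L2:
  assumes "u \<in> domN l"
  shows "shift N (of_real m) u \<in> L2 l \<times> L2 l"
proof -
  have u: "fst u \<in> L2 l" "snd u \<in> L2 l" using assms by (auto simp: domN_def H2_def H1_def)
  have w: "wderiv l (wderiv l (fst u)) \<in> L2 l" "wderiv l (wderiv l (snd u)) \<in> L2 l"
    using assms by (auto simp: domN_def H2_def intro: wderiv_H1)
  have n: "(\<lambda>x. - wderiv l (wderiv l (fst u)) x) \<in> L2 l"
    using L2_mult[OF w(1), of "\<lambda>x. -1"] by (simp add: continuous_on_const)
  have "(\<lambda>x. wderiv l (wderiv l (snd u)) x + r x *\<^sub>R snd u x - m *\<^sub>R fst u x) \<in> L2 l"
    by (intro L2_diff L2_add L2_scaleR w u qr continuous_on_const)
  moreover have "(\<lambda>x. - wderiv l (wderiv l (fst u)) x - q x *\<^sub>R fst u x - m *\<^sub>R snd u x) \<in> L2 l"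
    by (intro L2_diff L2_scaleR n u qr continuous_on_const)
  moreover have "fst (shift N (of_real m) u) = (\<lambda>x. wderiv l (wderiv l (snd u)) x + r x *\<^sub>R snd u x - m *\<^sub>R fst u x)"
    "snd (shift N (of_real m) u) = (\<lambda>x. - wderiv l (wderiv l (fst u)) x - q x *\<^sub>R fst u x - m *\<^sub>R snd u x)"
    by (simp_all only: fun_eq_iff shift_N simp_thms)
  ultimately show ?thesis unfolding mem_Times_iff by metis
qed

text \<open>By the representation of the domain, \<open>(N - \<mu>) u = w\<close> is a Dirichlet problem in integrated form
  for the continuous representative of \<open>u\<close>.\<close>

lemma domN_bsol:
  assumes u: "u \<in> domN l" and w: "w \<in> L2 l \<times> L2 l" and eq: "aeq l (shift N (of_real m) u) w"
  obtains U a where "bsol l (coef q r m) (\<lambda>_. 0) (dint (source w)) 0 U a"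
    "AE x in lebI l. fst u x = fst (U x) \<and> snd u x = snd (U x)"
proof -
  define \<phi>1 where "\<phi>1 = wderiv l (wderiv l (fst u))"
  define \<phi>2 where "\<phi>2 = wderiv l (wderiv l (snd u))"
  define \<phi> where "\<phi> x = (\<phi>1 x, \<phi>2 x)" for x
  have dom: "fst u \<in> H2 l \<inter> H10 l" "snd u \<in> H2 l \<inter> H10 l" using u by (auto simp: domN_def)
  obtain a1 where 1: "\<phi>1 \<in> L2 l" "AE x in lebI l. fst u x = x *\<^sub>R a1 + dint \<phi>1 x" "l *\<^sub>R a1 + dint \<phi>1 l = 0"
    using H2_H10_representation[OF dom(1) l] unfolding \<phi>1_def by metis
  obtain a2 where 2: "\<phi>2 \<in> L2 l" "AE x in lebI l. snd u x = x *\<^sub>R a2 + dint \<phi>2 x" "l *\<^sub>R a2 + dint \<phi>2 l = 0"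
    using H2_H10_representation[OF dom(2) l] unfolding \<phi>2_def by metis
  have \<phi>i: "\<phi> integrable_on {0..l}" unfolding \<phi>_def[abs_def]
    by (intro integrable_on_Pair integral_lebI(2) L2_integrable 1 2)
  have d: "fst (dint \<phi> x) = dint \<phi>1 x" "snd (dint \<phi> x) = dint \<phi>2 x" if "x \<in> {0..l}" for x
    using dint_bounded_linear[OF bounded_linear_fst \<phi>i that]
      dint_bounded_linear[OF bounded_linear_snd \<phi>i that] by (simp_all add: \<phi>_def)
  define U where "U x = x *\<^sub>R (a1, a2) + dint \<phi> x" for x
  have Uc: "continuous_on {0..l} U" unfolding U_def
    by (intro continuous_intros continuous_on_dint \<phi>i)
  have uU: "AE x in lebI l. fst u x = fst (U x) \<and> snd u x = snd (U x)"
    using 1(2) 2(2) AE_space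
  proof eventually_elim
    case (elim x)
    then show ?case using d[of x] by (simp add: U_def)
  qed
  have ae: "AE x in lebI l. \<phi> x = source w x + coef q r m x (U x)"
    using uU eq[unfolded aeq_def]
  proof eventually_elim
    case (elim x)
    have e1: "\<phi>2 x + r x *\<^sub>R snd u x - m *\<^sub>R fst u x = fst w x"
      and e2: "- \<phi>1 x - q x *\<^sub>R fst u x - m *\<^sub>R snd u x = snd w x"
      using elim(2) unfolding shift_N \<phi>1_def \<phi>2_def by auto
    show ?case unfolding \<phi>_def source_def coef_def e1[symmetric] e2[symmetric] using elim(1) by simp
  qed
  have eqd: "dint \<phi> x = dint (\<lambda>x. source w x + coef q r m x (U x)) x" if "x \<in> {0..l}" for x
    using that by (intro dint_cong_lebI[OF ae]) simp
  have ci: "(\<lambda>x. coef q r m x (U x)) integrable_on {0..l}"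
    by (intro integrable_continuous_interval continuous_on_coef qr Uc)
  have "dint \<phi> x = dint (source w) x + dint (\<lambda>x. coef q r m x (U x)) x" if "x \<in> {0..l}" for x
    using eqd[OF that] dint_add[OF integrable_source[OF w] ci that] by simp
  then have "sol l (coef q r m) (\<lambda>x. x *\<^sub>R (a1, a2) + dint (source w) x) U"
    using Uc by (simp add: sol_def U_def add.assoc)
  moreover have "U l = 0" using 1(3) 2(3) d[of l] l by (simp add: U_def prod_eq_iff)
  ultimately show ?thesis using uU by (intro that[of U "(a1, a2)"]) (auto simp: bsol_def)
qed

lemma bsol_domN:
  assumes w: "w \<in> L2 l \<times> L2 l" and b: "bsol l (coef q r m) (\<lambda>_. 0) (dint (source w)) 0 U a"
  defines "u \<equiv> (\<lambda>x. fst (U x), \<lambda>x. snd (U x))"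
  shows "u \<in> domN l" "aeq l (shift N (of_real m) u) w"
proof -
  have Uc: "continuous_on {0..l} U" using b by (simp add: bsol_def sol_def)
  have cc: "continuous_on {0..l} (\<lambda>x. coef q r m x (U x))" by (intro continuous_on_coef qr Uc)
  define \<phi> where "\<phi> x = source w x + coef q r m x (U x)" for x
  have \<phi>i: "\<phi> integrable_on {0..l}" unfolding \<phi>_def[abs_def]
    by (intro integrable_add integrable_source[OF w] integrable_continuous_interval cc)
  have U: "U x = x *\<^sub>R a + dint \<phi> x" if "x \<in> {0..l}" for x
    using b that dint_add[OF integrable_source[OF w] integrable_continuous_interval[OF cc] that]
    by (simp add: bsol_def sol_def \<phi>_def[abs_def])
  have Ul: "U l = 0" using b by (simp add: bsol_def)
  have n: "(\<lambda>x. - snd w x) \<in> L2 l"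
    using L2_mult[of "snd w" l "\<lambda>x. -1"] w by (auto simp: continuous_on_const)
  have L: "(\<lambda>x. fst (\<phi> x)) \<in> L2 l" "(\<lambda>x. snd (\<phi> x)) \<in> L2 l"
    using L2_add[OF n L2_continuous[OF continuous_on_fst[OF cc]]]
      L2_add[of "fst w", OF _ L2_continuous[OF continuous_on_snd[OF cc]]] w
    by (auto simp: \<phi>_def source_def)
  have d: "dint (\<lambda>x. fst (\<phi> x)) x = fst (dint \<phi> x)" "dint (\<lambda>x. snd (\<phi> x)) x = snd (dint \<phi> x)" if "x \<in> {0..l}" for x
    using dint_bounded_linear[OF bounded_linear_fst \<phi>i that]
      dint_bounded_linear[OF bounded_linear_snd \<phi>i that] by simp_all
  have e1: "fst (U x) = x *\<^sub>R fst a + dint (\<lambda>x. fst (\<phi> x)) x" if "x \<in> {0..l}" for x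
    using U[OF that] d[OF that] by simp
  have e2: "snd (U x) = x *\<^sub>R snd a + dint (\<lambda>x. snd (\<phi> x)) x" if "x \<in> {0..l}" for x
    using U[OF that] d[OF that] by simp
  have r1: "(\<lambda>x. fst (U x)) \<in> H2 l \<inter> H10 l"
      "AE x in lebI l. wderiv l (wderiv l (\<lambda>x. fst (U x))) x = fst (\<phi> x)"
    using H2_H10I[OF L(1) l e1] Ul by simp_all
  have r2: "(\<lambda>x. snd (U x)) \<in> H2 l \<inter> H10 l"
      "AE x in lebI l. wderiv l (wderiv l (\<lambda>x. snd (U x))) x = snd (\<phi> x)"
    using H2_H10I[OF L(2) l e2] Ul by simp_all
  show "u \<in> domN l" using r1(1) r2(1) by (simp add: u_def domN_def)
  show "aeq l (shift N (of_real m) u) w"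
    unfolding aeq_def using r1(2) r2(2)
  proof eventually_elim
    case (elim x)
    define W1 where "W1 = wderiv l (wderiv l (\<lambda>x. fst (U x))) x"
    define W2 where "W2 = wderiv l (wderiv l (\<lambda>x. snd (U x))) x"
    have "W1 = fst (\<phi> x)" "W2 = snd (\<phi> x)" using elim by (simp_all add: W1_def W2_def)
    then show ?case unfolding shift_N u_def fst_conv snd_conv W1_def[symmetric] W2_def[symmetric]
      by (simp add: \<phi>_def source_def coef_def)
  qed
qed

end

section \<open>Spectrum and Dirichlet problem\<close>

lemma dint_source_zero: "dint (source (\<lambda>x. 0, \<lambda>x. 0)) = (\<lambda>x. 0)"
proof
  fix x
  have "source (\<lambda>x. 0, \<lambda>x. 0) = (\<lambda>x. 0)" by (simp add: source_def fun_eq_iff zero_prod_def)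
  then show "dint (source (\<lambda>x. 0, \<lambda>x. 0)) x = 0" by simp
qed

lemma zero_L2: "(\<lambda>x. 0, \<lambda>x. 0) \<in> L2 l \<times> L2 l"
  by (simp add: L2_continuous continuous_on_const)

text \<open>The coefficient is real, so real and imaginary parts of a solution are solutions.\<close>

lemma bsol_coef_trivial_complex:
  assumes qr: "continuous_on {0..l} q" "continuous_on {0..l} r"
    and triv: "\<And>U a. bsol l (coef q r m) (\<lambda>_. 0) (\<lambda>_. 0) 0 U (a :: real \<times> real) \<Longrightarrow> a = 0"
    and b: "bsol l (coef q r m) (\<lambda>_. 0) (\<lambda>_. 0) 0 U (a :: complex \<times> complex)"
  shows "a = 0"
proof -
  have "map_both Re a = 0" "map_both Im a = 0"
    using bsol_map_both[OF bounded_linear_Re qr b] bsol_map_both[OF bounded_linear_Im qr b]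
    by (auto simp: map_both_def zero_prod_def[symmetric] intro!: triv)
  then show ?thesis by (simp add: map_both_def prod_eq_iff complex_eq_iff)
qed

lemma norm_dint_source_le:
  assumes w: "w \<in> L2 l \<times> L2 l" and l: "0 < l" and x: "x \<in> {0..l}"
  shows "norm (dint (source w) x) \<le> 2 * sqrt l * l * nrm2 l w"
proof -
  have wi: "integrable (lebI l) (fst w)" "integrable (lebI l) (snd w)"
    using w by (auto intro: L2_integrable)
  have "norm (dint (source w) x) \<le> (2 * sqrt l * nrm2 l w) * l"
  proof (rule norm_dint_le[OF integrable_source[OF w] _ x])
    have n0: "0 \<le> nrm l f" for f by (simp add: nrm_def)
    show "0 \<le> 2 * sqrt l * nrm2 l w" using l by (simp add: nrm2_def)
    fix t assume t: "t \<in> {0..l}"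
    have iw: "fst w integrable_on {0..t}" "snd w integrable_on {0..t}"
      using integrable_initial[OF integral_lebI(2)[OF wi(1)]] integrable_initial[OF integral_lebI(2)[OF wi(2)]] t
      by auto
    have ir: "source w integrable_on {0..t}" using integrable_initial[OF integrable_source[OF w]] t by auto
    have "integral {0..t} (source w) = (fst (integral {0..t} (source w)), snd (integral {0..t} (source w)))" by simp
    also have "fst (integral {0..t} (source w)) = integral {0..t} (\<lambda>x. - snd w x)"
      using integral_linear[OF ir bounded_linear_fst] by (simp add: comp_def source_def)
    also have "\<dots> = - integral {0..t} (snd w)" by simp
    also have "snd (integral {0..t} (source w)) = integral {0..t} (fst w)"
      using integral_linear[OF ir bounded_linear_snd] by (simp add: comp_def source_def)
    finally have "norm (integral {0..t} (source w)) \<le> norm (integral {0..t} (snd w)) + norm (integral {0..t} (fst w))"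
      using norm_Pair_le[of "- integral {0..t} (snd w)" "integral {0..t} (fst w)"] by simp
    also have "\<dots> \<le> sqrt l * nrm l (snd w) + sqrt l * nrm l (fst w)"
      using w t norm_integral_le_L1[OF wi(1) t] norm_integral_le_L1[OF wi(2) t]
        L1_le_nrm[OF l, of "fst w"] L1_le_nrm[OF l, of "snd w"] by (auto simp: mem_Times_iff)
    also have "\<dots> \<le> sqrt l * nrm2 l w + sqrt l * nrm2 l w"
      using l n0 unfolding nrm2_def by (intro add_mono mult_left_mono real_le_rsqrt) auto
    finally show "norm (integral {0..t} (source w)) \<le> 2 * sqrt l * nrm2 l w" by simp
  qed
  then show ?thesis by (simp add: mult_ac)
qed

text \<open>A nontrivial real solution of the Dirichlet problem contradicts injectivity. If there is none,
  there is no complex one either, and well-posedness of the Dirichlet problem provides surjectivity,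
  injectivity and the bound of the inverse. Hence the spectrum consists of eigenvalues.\<close>

lemma Spec_iff_bsol:
  fixes l m s :: real and g h :: "real \<Rightarrow> real"
  defines "q \<equiv> \<lambda>x. s\<^sup>2 * g (s * x)" and "r \<equiv> \<lambda>x. s\<^sup>2 * h (s * x)"
  assumes l: "0 < l" and qr: "continuous_on {0..l} q" "continuous_on {0..l} r"
  shows "complex_of_real m \<in> Spec l (domN l) (Nop l g h s) \<longleftrightarrow>
    (\<exists>U a. bsol l (coef q r m) (\<lambda>_. 0) (\<lambda>_. 0) 0 U a \<and> a \<noteq> (0 :: real \<times> real))" (is "_ \<longleftrightarrow> ?ex")
proof -
  note qr' = qr[unfolded q_def r_def]
  note domN_bsol' = domN_bsol[OF l qr' refl refl, folded q_def r_def]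
  note bsol_domN' = bsol_domN[OF l qr' refl refl, folded q_def r_def]
  note shift_N_L2' = shift_N_L2[OF l qr' refl refl]
  obtain C where "volterra (coef q r m :: real \<Rightarrow> complex \<times> complex \<Rightarrow> _) l C" using volterra_coef[OF l qr] by blast
  then interpret vc: volterra "coef q r m :: real \<Rightarrow> complex \<times> complex \<Rightarrow> _" l C .
  let ?R = "resolvent_set l (domN l) (Nop l g h s)"
  let ?N = "shift (Nop l g h s) (complex_of_real m)"
  let ?z = "(\<lambda>x. 0, \<lambda>x. 0) :: vfun"
  have Z: "linear (\<lambda>_ :: complex \<times> complex. 0 :: complex \<times> complex)" by (rule linear_zero)
  have "complex_of_real m \<notin> ?R" if ex: ?ex
  proof
    assume res: "complex_of_real m \<in> ?R"
    obtain U a where b: "bsol l (coef q r m) (\<lambda>_. 0) (\<lambda>_. 0) 0 U (a :: real \<times> real)" and a: "a \<noteq> 0"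
      using ex by blast
    define W where "W x = map_both complex_of_real (U x)" for x
    have "bsol l (coef q r m) (\<lambda>_. 0) (\<lambda>_. 0) 0 W (map_both complex_of_real a)"
      using bsol_map_both[OF bounded_linear_of_real qr b] by (simp add: W_def[abs_def] map_both_def zero_prod_def[symmetric])
    then have bW: "bsol l (coef q r m) (\<lambda>_. 0) (dint (source ?z)) 0 W (map_both complex_of_real a)"
      by (simp add: dint_source_zero)
    have b0: "bsol l (coef q r m) (\<lambda>_. 0) (dint (source ?z)) 0 (\<lambda>x. 0) (0 :: complex \<times> complex)"
      using vc.bsol_zero[OF Z] by (simp add: dint_source_zero)
    let ?W = "(\<lambda>x. fst (W x), \<lambda>x. snd (W x))" and ?O = "(\<lambda>x. fst (0 :: complex \<times> complex), \<lambda>x. snd (0 :: complex \<times> complex))"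
    have d: "?W \<in> domN l" "?O \<in> domN l" "aeq l (?N ?W) ?z" "aeq l (?N ?O) ?z"
      using bsol_domN'[OF zero_L2 bW] bsol_domN'[OF zero_L2 b0] by auto
    have "aeq l (?N ?W) (?N ?O)"
      using d(3,4) unfolding aeq_def by eventually_elim simp
    then have "aeq l ?W ?O" using res d(1,2) unfolding resolvent_set_def by blast
    then have ae: "AE x in lebI l. W x = 0"
      unfolding aeq_def by eventually_elim (simp add: prod_eq_iff)
    have Wc: "continuous_on {0..l} W" using bW by (simp add: bsol_def sol_def)
    have W0: "W x = 0" if "x \<in> {0..l}" for x
      using continuous_AE_eq[OF ae Wc continuous_on_const l that] .
    have "dint (\<lambda>t. coef q r m t (W t)) l = dint (\<lambda>t. 0) l"
      using W0 by (intro dint_cong) (simp add: coef_def zero_prod_def)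
    moreover have "\<forall>x\<in>{0..l}. W x = (x *\<^sub>R map_both complex_of_real a + 0) + dint (\<lambda>t. coef q r m t (W t)) x"
      using bW unfolding bsol_def sol_def dint_source_zero by blast
    then have "W l = (l *\<^sub>R map_both complex_of_real a + 0) + dint (\<lambda>t. coef q r m t (W t)) l"
      by (rule bspec) (use l in simp)
    ultimately have "map_both complex_of_real a = 0" using W0[of l] l by simp
    then show False using a by (simp add: map_both_def prod_eq_iff)
  qed
  moreover have "complex_of_real m \<in> ?R" if n: "\<not> ?ex"
  proof -
    have triv: "\<forall>U (a :: complex \<times> complex). bsol l (coef q r m) (\<lambda>_. 0) (\<lambda>_. 0) 0 U a \<longrightarrow> a = 0"
      using bsol_coef_trivial_complex[OF qr] n by blast
    obtain K where wp: "well_posed l (coef q r m :: real \<Rightarrow> complex \<times> complex \<Rightarrow> _) (\<lambda>_. 0) K"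
      by (rule vc.bsol_well_posed[OF Z triv])
    then have K: "0 < K" by (simp add: well_posed_def)
    have Pc: "continuous_on {0..l} (dint (source w))" if "w \<in> L2 l \<times> L2 l" for w
      by (rule continuous_on_dint[OF integrable_source[OF that]])
    show ?thesis unfolding resolvent_set_def
    proof (intro CollectI conjI ballI impI)
      fix w :: vfun assume w: "w \<in> L2 l \<times> L2 l"
      show "\<exists>u\<in>domN l. aeq l (?N u) w" using well_posed_solvable[OF wp Pc[OF w], of 0] bsol_domN'[OF w] by blast
    next
      fix u v assume u: "u \<in> domN l" and v: "v \<in> domN l" and eq: "aeq l (?N u) (?N v)"
      note w = shift_N_L2'[OF v, of m]
      have vv: "aeq l (?N v) (?N v)" by (simp add: aeq_def)
      obtain U a where U: "bsol l (coef q r m) (\<lambda>_. 0) (dint (source (?N v))) 0 U a"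
        "AE x in lebI l. fst u x = fst (U x) \<and> snd u x = snd (U x)" by (rule domN_bsol'[OF u w eq])
      obtain V b where V: "bsol l (coef q r m) (\<lambda>_. 0) (dint (source (?N v))) 0 V b"
        "AE x in lebI l. fst v x = fst (V x) \<and> snd v x = snd (V x)" by (rule domN_bsol'[OF v w vv])
      have D: "bsol l (coef q r m) (\<lambda>_. 0) (\<lambda>x. 0) 0 (\<lambda>x. U x + (-1) *\<^sub>R V x) (a + (-1) *\<^sub>R b)"
        using vc.bsol_add[OF Z U(1) vc.bsol_scale[OF Z V(1), of "-1"]] by simp
      have UV: "U x = V x" if "x \<in> {0..l}" for x using well_posed_bound(2)[OF wp D continuous_on_const, of 0 x] that by simp
      show "aeq l u v" unfolding aeq_def using U(2) V(2) AE_space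
      proof eventually_elim
        case (elim x)
        then show ?case using UV[of x] by simp
      qed
    next
      show "\<exists>C. \<forall>u\<in>domN l. nrm2 l u \<le> C * nrm2 l (?N u)"
      proof (intro exI ballI)
        fix u assume u: "u \<in> domN l"
        note w = shift_N_L2'[OF u, of m]
        have uu: "aeq l (?N u) (?N u)" by (simp add: aeq_def)
        obtain U a where U: "bsol l (coef q r m) (\<lambda>_. 0) (dint (source (?N u))) 0 U a"
          "AE x in lebI l. fst u x = fst (U x) \<and> snd u x = snd (U x)" by (rule domN_bsol'[OF u w uu])
        define B where "B = K * (2 * sqrt l * l * nrm2 l (?N u))"
        have UB: "norm (U x) \<le> B" if "x \<in> {0..l}" for x
          using well_posed_bound(2)[OF wp U(1) Pc[OF w] norm_dint_source_le[OF w l] that] by (simp add: B_def)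
        have B0: "0 \<le> B" using K l by (simp add: B_def nrm2_def)
        have fL: "fst u \<in> L2 l" "snd u \<in> L2 l" using u by (auto simp: domN_def H2_def H1_def)
        have "AE x in lebI l. norm (fst u x) \<le> B" "AE x in lebI l. norm (snd u x) \<le> B"
        proof -
          show "AE x in lebI l. norm (fst u x) \<le> B" using U(2) AE_space
          proof eventually_elim
            case (elim x)
            then show ?case using UB[of x] norm_fst_le[of "fst (U x)" "snd (U x)"] by simp
          qed
          show "AE x in lebI l. norm (snd u x) \<le> B" using U(2) AE_space
          proof eventually_elim
            case (elim x)
            then show ?case using UB[of x] norm_snd_le[of "snd (U x)" "fst (U x)"] by simp
          qed
        qed
        then have "nrm l (fst u) \<le> B * sqrt l" "nrm l (snd u) \<le> B * sqrt l"
          using fL by (auto intro!: nrm_le l B0)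
        moreover have "nrm2 l u \<le> nrm l (fst u) + nrm l (snd u)"
          unfolding nrm2_def by (rule sqrt_sum_squares_le_sum) (simp_all add: nrm_def)
        ultimately have "nrm2 l u \<le> 2 * B * sqrt l" by simp
        then show "nrm2 l u \<le> (2 * K * (2 * sqrt l * l) * sqrt l) * nrm2 l (?N u)"
          by (simp add: B_def mult_ac)
      qed
    qed
  qed
  ultimately show ?thesis unfolding Spec_def by blast
qed

section \<open>Stability, the Green identity and dual functionals\<close>

text \<open>Moving the change of the coefficient to the right hand side shows that the bounds of the
  bordered problem survive small perturbations.\<close>

lemma (in volterra) bsol_stable:
  assumes Z: "linear Z" and triv: "\<forall>U a. bsol l A Z (\<lambda>x. 0) 0 U a \<longrightarrow> a = 0"
  obtains K \<eta> where "0 < \<eta>"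
    "\<forall>A' C'. volterra A' l C' \<longrightarrow> (\<forall>x\<in>{0..l}. \<forall>u. norm (A' x u - A x u) \<le> \<eta> * norm u) \<longrightarrow> well_posed l A' Z K"
proof -
  obtain K where wp: "well_posed l A Z K" by (rule bsol_well_posed[OF Z triv])
  then have K: "0 < K" by (simp add: well_posed_def)
  \<comment> \<open>A perturbation of this size moves at most half of the norm of \<open>U\<close> to the right hand side.\<close>
  define \<eta> where "\<eta> = 1 / (2 * K * l\<^sup>2)"
  have \<eta>: "0 < \<eta>" using K l_pos by (simp add: \<eta>_def)
  have K\<eta>: "K * (\<eta> * S * l\<^sup>2) = S / 2" for S using K l_pos by (simp add: \<eta>_def field_simps)
  have "well_posed l A' Z (2 * K)" if A': "volterra A' l C'"
      and close: "\<forall>x\<in>{0..l}. \<forall>u. norm (A' x u - A x u) \<le> \<eta> * norm u" for A' C'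
  proof -
    interpret v': volterra A' l C' by (rule A')
    have bd': "norm a \<le> 2 * K * (\<kappa> + norm \<zeta>) \<and> (\<forall>x\<in>{0..l}. norm (U x) \<le> 2 * K * (\<kappa> + norm \<zeta>))"
      if b: "bsol l A' Z P \<zeta> U a" and P: "continuous_on {0..l} P" and \<kappa>: "\<forall>x\<in>{0..l}. norm (P x) \<le> \<kappa>"
      for P \<zeta> U a \<kappa>
    proof -
      have Uc: "continuous_on {0..l} U" using b by (simp add: bsol_def sol_def)
      define D where "D x = A' x (U x) - A x (U x)" for x
      have Dc: "continuous_on {0..l} D" unfolding D_def by (intro continuous_on_diff cont v'.cont Uc)
      have Di: "D integrable_on {0..l}" using Dc by (rule integrable_continuous_interval)
      have split: "dint (\<lambda>x. A' x (U x)) x = dint D x + dint (\<lambda>x. A x (U x)) x" if "x \<in> {0..l}" for x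
        using dint_add[OF Di integrable_A[OF Uc] that] by (simp add: D_def)
      have b': "bsol l A Z (\<lambda>x. P x + dint D x) \<zeta> U a"
        using b split by (simp add: bsol_def sol_def add.assoc)
      have Pc: "continuous_on {0..l} (\<lambda>x. P x + dint D x)"
        by (intro continuous_on_add P continuous_on_dint Di)
      have "continuous_on {0..l} (\<lambda>x. norm (U x))" by (intro continuous_on_norm Uc)
      moreover have "{0..l} \<noteq> {}" using l_pos by auto
      ultimately obtain z where z: "z \<in> {0..l}" and max: "\<And>x. x \<in> {0..l} \<Longrightarrow> norm (U x) \<le> norm (U z)"
        using continuous_attains_sup[of "{0..l}" "\<lambda>x. norm (U x)"] by auto
      define S where "S = norm (U z)"
      have "norm (D x) \<le> \<eta> * S" if "x \<in> {0..l}" for x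
        unfolding D_def S_def
        using close[rule_format, OF that, of "U x"] mult_left_mono[OF max[OF that] less_imp_le[OF \<eta>]] by (rule order_trans)
      then have "norm (dint D x) \<le> \<eta> * S * l\<^sup>2" if "x \<in> {0..l}" for x
        using that \<eta> by (intro norm_dint_le_sup Di) (auto simp: S_def)
      then have "norm (P x + dint D x) \<le> \<kappa> + \<eta> * S * l\<^sup>2" if "x \<in> {0..l}" for x
        using norm_triangle_ineq[of "P x" "dint D x"] \<kappa> that by fastforce
      from well_posed_bound[OF wp b' Pc this]
      have *: "norm a \<le> K * (\<kappa> + \<eta> * S * l\<^sup>2 + norm \<zeta>)" "S \<le> K * (\<kappa> + \<eta> * S * l\<^sup>2 + norm \<zeta>)"
        using z by (auto simp: S_def)
      have e: "K * (\<kappa> + \<eta> * S * l\<^sup>2 + norm \<zeta>) = K * (\<kappa> + norm \<zeta>) + S / 2"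
        using K\<eta>[of S] by (simp add: algebra_simps)
      have S: "S \<le> 2 * (K * (\<kappa> + norm \<zeta>))" using *(2) unfolding e by simp
      then have "norm a \<le> 2 * (K * (\<kappa> + norm \<zeta>))" using *(1) unfolding e by simp
      then show ?thesis using S max by (fastforce simp: S_def mult.assoc)
    qed
    have triv': "\<forall>U a. bsol l A' Z (\<lambda>x. 0) 0 U a \<longrightarrow> a = 0"
    proof (intro allI impI)
      fix U a assume "bsol l A' Z (\<lambda>x. 0) 0 U a"
      from bd'[OF this continuous_on_const, of 0] show "a = 0" by simp
    qed
    obtain K' where "well_posed l A' Z K'" by (rule v'.bsol_well_posed[OF Z triv'])
    then show ?thesis unfolding well_posed_def[of l A' Z "2 * K"]
      using bd' K well_posed_solvable by (metis mult_pos_pos zero_less_numeral)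
  qed
  then show ?thesis using \<eta> by (intro that[of \<eta> "2 * K"]) auto
qed

lemma dint_derivatives:
  fixes \<phi> :: "real \<Rightarrow> 'b::euclidean_space"
  assumes \<phi>: "continuous_on {0..l} \<phi>" and U: "\<forall>x\<in>{0..l}. U x = x *\<^sub>R a + dint \<phi> x" and x: "x \<in> {0..l}"
  shows "(U has_vector_derivative a + integral {0..x} \<phi>) (at x within {0..l})"
    "((\<lambda>x. a + integral {0..x} \<phi>) has_vector_derivative \<phi> x) (at x within {0..l})"
proof -
  have 1: "((\<lambda>x. integral {0..x} \<phi>) has_vector_derivative \<phi> x) (at x within {0..l})"
    by (rule integral_has_vector_derivative[OF \<phi> x])
  have "continuous_on {0..l} (\<lambda>x. integral {0..x} \<phi>)"
    by (rule indefinite_integral_continuous_1[OF integrable_continuous_interval[OF \<phi>]])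
  from integral_has_vector_derivative[OF this x]
  have "(dint \<phi> has_vector_derivative integral {0..x} \<phi>) (at x within {0..l})"
    by (simp add: dint_def[abs_def])
  moreover have "((\<lambda>x. x *\<^sub>R a) has_vector_derivative a) (at x within {0..l})"
    using has_vector_derivative_scaleR[of "\<lambda>x. x" 1 x "{0..l}" "\<lambda>x. a" 0] by simp
  ultimately have 2: "((\<lambda>x. x *\<^sub>R a + dint \<phi> x) has_vector_derivative a + integral {0..x} \<phi>) (at x within {0..l})"
    by (intro has_vector_derivative_add)
  show "(U has_vector_derivative a + integral {0..x} \<phi>) (at x within {0..l})"
    using has_vector_derivative_transform[OF x _ 2, of U] U by simp
  show "((\<lambda>x. a + integral {0..x} \<phi>) has_vector_derivative \<phi> x) (at x within {0..l})"
    using has_vector_derivative_add[OF has_vector_derivative_const 1, of a] by simp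
qed

lemma has_vector_derivative_components:
  fixes U :: "real \<Rightarrow> real \<times> real"
  assumes "(U has_vector_derivative V) F"
  shows "((\<lambda>x. fst (U x)) has_vector_derivative fst V) F" "((\<lambda>x. snd (U x)) has_vector_derivative snd V) F"
  using bounded_linear.has_vector_derivative[OF bounded_linear_fst assms]
    bounded_linear.has_vector_derivative[OF bounded_linear_snd assms] by simp_all

text \<open>The vector by which the value \<open>w l\<close> enters the boundary terms of the Green identity below:
  up to a sign in the second component, the derivative of \<open>y\<close> at \<open>l\<close>.\<close>

definition flux :: "(real \<Rightarrow> real) \<Rightarrow> (real \<Rightarrow> real) \<Rightarrow> real \<Rightarrow> real \<Rightarrow> (real \<Rightarrow> real \<times> real) \<Rightarrow> real \<times> real \<Rightarrow> real \<times> real"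
  where "flux q r \<mu> l y b = map_prod id uminus (b + integral {0..l} (\<lambda>x. coef q r \<mu> x (y x)))"

text \<open>Integrating \<open>w\<^sub>1 y\<^sub>1' - w\<^sub>1' y\<^sub>1 - w\<^sub>2 y\<^sub>2' + w\<^sub>2' y\<^sub>2\<close>: the coefficients cancel because the
  adjoint of \<open>N\<close> is its conjugate by the swap of components.\<close>

lemma Green_identity:
  fixes w y f :: "real \<Rightarrow> real \<times> real"
  assumes l: "0 < l" and qr: "continuous_on {0..l} q" "continuous_on {0..l} r" and f: "continuous_on {0..l} f"
    and w: "sol l (coef q r \<mu>) (\<lambda>x. x *\<^sub>R a + dint f x) w"
    and y: "bsol l (coef q r \<mu>) (\<lambda>_. 0) (\<lambda>_. 0) 0 y b"
  shows "inner (flux q r \<mu> l y b) (w l) = integral {0..l} (\<lambda>x. snd (f x) * snd (y x) - fst (f x) * fst (y x))"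
proof -
  have wc: "continuous_on {0..l} w" and yc: "continuous_on {0..l} y"
    using w y by (auto simp: bsol_def sol_def)
  have cw: "continuous_on {0..l} (\<lambda>x. coef q r \<mu> x (w x))" and cy: "continuous_on {0..l} (\<lambda>x. coef q r \<mu> x (y x))"
    by (intro continuous_on_coef qr wc yc)+
  define \<phi> where "\<phi> x = f x + coef q r \<mu> x (w x)" for x
  define \<theta> where "\<theta> x = coef q r \<mu> x (y x)" for x
  have \<phi>c: "continuous_on {0..l} \<phi>" unfolding \<phi>_def by (intro continuous_on_add f cw)
  have \<theta>c: "continuous_on {0..l} \<theta>" unfolding \<theta>_def by (rule cy)
  have wx: "\<forall>x\<in>{0..l}. w x = x *\<^sub>R a + dint \<phi> x"
    using w dint_add[OF integrable_continuous_interval[OF f] integrable_continuous_interval[OF cw]]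
    by (simp add: sol_def \<phi>_def[abs_def] add.assoc)
  have yx: "\<forall>x\<in>{0..l}. y x = x *\<^sub>R b + dint \<theta> x"
    using y by (simp add: bsol_def sol_def \<theta>_def[abs_def])
  define W where "W x = a + integral {0..x} \<phi>" for x
  define Y where "Y x = b + integral {0..x} \<theta>" for x
  note dw = dint_derivatives[OF \<phi>c wx, folded W_def] 
  note dy = dint_derivatives[OF \<theta>c yx, folded Y_def] 
  define G where "G x = fst (w x) * fst (Y x) - fst (W x) * fst (y x) - snd (w x) * snd (Y x) + snd (W x) * snd (y x)" for x
  have "(G has_vector_derivative snd (f x) * snd (y x) - fst (f x) * fst (y x)) (at x within {0..l})"
    if x: "x \<in> {0..l}" for x
  proof -
    note d = has_vector_derivative_components[OF dw(1)[OF x]] has_vector_derivative_components[OF dw(2)[OF x]]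
      has_vector_derivative_components[OF dy(1)[OF x]] has_vector_derivative_components[OF dy(2)[OF x]]
    note d' = d[folded has_real_derivative_iff_has_vector_derivative]
    have "(G has_real_derivative
       (fst (W x) * fst (Y x) + fst (\<theta> x) * fst (w x)) - (fst (\<phi> x) * fst (y x) + fst (Y x) * fst (W x))
       - (snd (W x) * snd (Y x) + snd (\<theta> x) * snd (w x)) + (snd (\<phi> x) * snd (y x) + snd (Y x) * snd (W x)))
       (at x within {0..l})"
      unfolding G_def by (intro DERIV_add DERIV_diff DERIV_mult d')
    moreover have "(fst (W x) * fst (Y x) + fst (\<theta> x) * fst (w x)) - (fst (\<phi> x) * fst (y x) + fst (Y x) * fst (W x))
       - (snd (W x) * snd (Y x) + snd (\<theta> x) * snd (w x)) + (snd (\<phi> x) * snd (y x) + snd (Y x) * snd (W x))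
      = snd (f x) * snd (y x) - fst (f x) * fst (y x)"
      by (simp add: \<theta>_def \<phi>_def coef_def algebra_simps)
    ultimately show ?thesis by (simp add: has_real_derivative_iff_has_vector_derivative)
  qed
  then have "((\<lambda>x. snd (f x) * snd (y x) - fst (f x) * fst (y x)) has_integral G l - G 0) {0..l}"
    using l by (intro fundamental_theorem_of_calculus) auto
  moreover have "w 0 = 0" "y 0 = 0" using bspec[OF wx, of 0] bspec[OF yx, of 0] l by (simp_all add: dint_def)
  moreover have "y l = 0" using y by (simp add: bsol_def)
  ultimately have "integral {0..l} (\<lambda>x. snd (f x) * snd (y x) - fst (f x) * fst (y x))
      = fst (w l) * fst (Y l) - snd (w l) * snd (Y l)"
    by (simp add: integral_unique G_def)
  then show ?thesis by (simp add: flux_def Y_def \<theta>_def[abs_def] inner_prod_def algebra_simps)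
qed

lemma dual_functionals:
  fixes a :: "nat \<Rightarrow> 'v::euclidean_space"
  assumes indep: "\<And>c. (\<Sum>i<n. c i *\<^sub>R a i) = 0 \<Longrightarrow> \<forall>i<n. c i = 0"
  obtains \<phi> :: "nat \<Rightarrow> 'v \<Rightarrow> real"
  where "\<And>i. linear (\<phi> i)" "\<And>i j. i < n \<Longrightarrow> j < n \<Longrightarrow> \<phi> i (a j) = (if i = j then 1 else 0)"
proof -
  have inj: "inj_on a {..<n}"
  proof (rule inj_onI, rule ccontr)
    fix i j assume ij: "i \<in> {..<n}" "j \<in> {..<n}" "a i = a j" "i \<noteq> j"
    define c where "c k = (if k = i then 1 else 0) - (if k = j then 1 else (0::real))" for k
    have "(\<Sum>k<n. c k *\<^sub>R a k) = (\<Sum>k<n. (if k = i then a k else 0) - (if k = j then a k else 0))"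
      by (intro sum.cong) (auto simp: c_def)
    also have "\<dots> = a i - a j" using ij by (simp add: sum_subtractf)
    finally have "c i = 0" using indep[of c] ij by simp
    then show False using ij by (simp add: c_def)
  qed
  have ind: "independent (a ` {..<n})"
  proof (rule independent_if_scalars_zero)
    fix f x assume 0: "(\<Sum>x\<in>a ` {..<n}. f x *\<^sub>R x) = 0" and x: "x \<in> a ` {..<n}"
    then have "(\<Sum>i<n. f (a i) *\<^sub>R a i) = 0" using inj by (simp add: sum.reindex comp_def)
    from indep[OF this] x show "f x = 0" by auto
  qed simp
  have "\<exists>\<psi> :: 'v \<Rightarrow> real. linear \<psi> \<and> (\<forall>x\<in>a ` {..<n}. \<psi> x = (if x = a i then 1 else 0))" for i
    by (rule linear_independent_extend[OF ind, where f = "\<lambda>x. if x = a i then 1 else 0"])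
  then obtain \<phi> :: "nat \<Rightarrow> 'v \<Rightarrow> real" where \<phi>: "\<And>i. linear (\<phi> i)"
    "\<And>i x. x \<in> a ` {..<n} \<Longrightarrow> \<phi> i x = (if x = a i then 1 else 0)" by metis
  show ?thesis
  proof (rule that[of \<phi>])
    fix i j assume "i < n" "j < n"
    then show "\<phi> i (a j) = (if i = j then 1 else 0)"
      using \<phi>(2)[of "a j" i] inj_onD[OF inj, of j i] by auto
  qed (rule \<phi>)
qed

section \<open>Bordering the kernel\<close>

text \<open>The bordered problem for \<open>U'' = A U + f\<close>. Unlike general data \<open>P\<close>, sources can absorb a change
  of the coefficient.\<close>

definition csol :: "real \<Rightarrow> (real \<Rightarrow> 'b \<Rightarrow> 'b) \<Rightarrow> ('b \<Rightarrow> 'b) \<Rightarrow> (real \<Rightarrow> 'b) \<Rightarrow> 'b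
    \<Rightarrow> (real \<Rightarrow> 'b::euclidean_space) \<Rightarrow> 'b \<Rightarrow> bool"
  where "csol l A Z f \<zeta> U a \<longleftrightarrow> continuous_on {0..l} f \<and> bsol l A Z (dint f) \<zeta> U a"

lemma csol_cont: "csol l A Z f \<zeta> U a \<Longrightarrow> continuous_on {0..l} U"
  by (simp add: csol_def bsol_def sol_def)

lemma csol_zero_iff: "csol l A Z (\<lambda>x. 0) \<zeta> U a \<longleftrightarrow> bsol l A Z (\<lambda>x. 0) \<zeta> U a"
proof -
  have "dint (\<lambda>x. 0 :: 'a) = (\<lambda>x. 0)" by (simp add: fun_eq_iff)
  then show ?thesis by (simp add: csol_def)
qed

lemma csol_cong:
  assumes c: "csol l A Z f \<zeta> U a" and eq: "\<And>x. x \<in> {0..l} \<Longrightarrow> f x = f' x" and \<zeta>: "\<zeta> = \<zeta>'"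
  shows "csol l A Z f' \<zeta>' U a"
proof -
  have "continuous_on {0..l} f'" using c eq continuous_on_cong[of "{0..l}" "{0..l}" f f'] by (simp add: csol_def)
  moreover have "dint f x = dint f' x" if "x \<in> {0..l}" for x using that eq by (intro dint_cong) auto
  ultimately show ?thesis using c \<zeta> sol_cong[of l "\<lambda>x. x *\<^sub>R a + dint f x" "\<lambda>x. x *\<^sub>R a + dint f' x" A U]
    by (simp add: csol_def bsol_def)
qed

context volterra
begin

lemma csol_add:
  assumes Z: "linear Z" and 1: "csol l A Z f \<zeta> U a" and 2: "csol l A Z g \<eta> V b"
  shows "csol l A Z (\<lambda>x. f x + g x) (\<zeta> + \<eta>) (\<lambda>x. U x + V x) (a + b)"
proof -
  have c: "continuous_on {0..l} f" "continuous_on {0..l} g" using 1 2 by (auto simp: csol_def)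
  have "bsol l A Z (\<lambda>x. dint f x + dint g x) (\<zeta> + \<eta>) (\<lambda>x. U x + V x) (a + b)"
    using 1 2 by (intro bsol_add Z) (auto simp: csol_def)
  moreover have "dint (\<lambda>x. f x + g x) x = dint f x + dint g x" if "x \<in> {0..l}" for x
    using c that by (intro dint_add integrable_continuous_interval)
  ultimately show ?thesis using c
      sol_cong[of l "\<lambda>x. x *\<^sub>R (a + b) + (dint f x + dint g x)" "\<lambda>x. x *\<^sub>R (a + b) + dint (\<lambda>x. f x + g x) x" A]
    by (simp add: csol_def bsol_def continuous_on_add)
qed

lemma csol_scale:
  assumes Z: "linear Z" and 1: "csol l A Z f \<zeta> U a"
  shows "csol l A Z (\<lambda>x. c *\<^sub>R f x) (c *\<^sub>R \<zeta>) (\<lambda>x. c *\<^sub>R U x) (c *\<^sub>R a)"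
proof -
  have f: "continuous_on {0..l} f" using 1 by (auto simp: csol_def)
  have "bsol l A Z (\<lambda>x. c *\<^sub>R dint f x) (c *\<^sub>R \<zeta>) (\<lambda>x. c *\<^sub>R U x) (c *\<^sub>R a)"
    using 1 by (intro bsol_scale Z) (auto simp: csol_def)
  moreover have "dint (\<lambda>x. c *\<^sub>R f x) x = c *\<^sub>R dint f x" if "x \<in> {0..l}" for x
    using f that by (intro dint_bounded_linear[OF bounded_linear_scaleR_right] integrable_continuous_interval)
  ultimately show ?thesis using f
      sol_cong[of l "\<lambda>x. x *\<^sub>R (c *\<^sub>R a) + c *\<^sub>R dint f x" "\<lambda>x. x *\<^sub>R (c *\<^sub>R a) + dint (\<lambda>x. c *\<^sub>R f x) x" A]
    by (simp add: csol_def bsol_def continuous_on_scaleR continuous_on_const)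
qed

lemma csol_diff:
  assumes Z: "linear Z" and 1: "csol l A Z f \<zeta> U a" and 2: "csol l A Z g \<eta> V b"
  shows "csol l A Z (\<lambda>x. f x - g x) (\<zeta> - \<eta>) (\<lambda>x. U x - V x) (a - b)"
  using csol_add[OF Z 1 csol_scale[OF Z 2, of "-1"]] by simp

lemma csol_sum:
  assumes Z: "linear Z" "finite I" "\<And>i. i \<in> I \<Longrightarrow> csol l A Z (f i) (\<zeta> i) (U i) (a i)"
  shows "csol l A Z (\<lambda>x. \<Sum>i\<in>I. f i x) (\<Sum>i\<in>I. \<zeta> i) (\<lambda>x. \<Sum>i\<in>I. U i x) (\<Sum>i\<in>I. a i)"
  using assms(2,3)
proof (induction rule: finite_induct)
  case empty
  then show ?case using bsol_zero[OF assms(1)] by (simp add: csol_zero_iff)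
next
  case (insert i I)
  then show ?case using csol_add[OF assms(1), of "f i" "\<zeta> i" "U i" "a i"] by simp
qed

text \<open>A change of the coefficient is a change of the source.\<close>

lemma csol_move:
  assumes A': "volterra A' l C'" and Z: "linear Z" and c: "csol l A' Z f \<zeta> U a"
  shows "csol l A Z (\<lambda>x. f x + (A' x (U x) - A x (U x))) \<zeta> U a"
proof -
  interpret v': volterra A' l C' by (rule A')
  note Uc = csol_cont[OF c]
  define D where "D x = A' x (U x) - A x (U x)" for x
  have f: "continuous_on {0..l} f" using c by (simp add: csol_def)
  have Dc: "continuous_on {0..l} D" unfolding D_def by (intro continuous_on_diff cont v'.cont Uc)
  have Di: "D integrable_on {0..l}" using Dc by (rule integrable_continuous_interval)
  have split: "dint (\<lambda>x. A' x (U x)) x = dint D x + dint (\<lambda>x. A x (U x)) x" if "x \<in> {0..l}" for x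
    using dint_add[OF Di integrable_A[OF Uc] that] by (simp add: D_def)
  have "dint (\<lambda>x. f x + D x) x = dint f x + dint D x" if "x \<in> {0..l}" for x
    using f Dc that by (intro dint_add integrable_continuous_interval)
  then have "bsol l A Z (dint (\<lambda>x. f x + D x)) \<zeta> U a"
    using c split by (simp add: csol_def bsol_def sol_def add.assoc)
  then show ?thesis using f Dc by (simp add: csol_def D_def continuous_on_add)
qed

end

lemma coef_diff:
  "coef q r \<mu> x u - coef q' r' \<mu>' x u = coef (\<lambda>x. q x - q' x) (\<lambda>x. r x - r' x) (\<mu> - \<mu>') x u"
  by (simp add: coef_def algebra_simps)

definition scaled :: "(real \<Rightarrow> real) \<Rightarrow> real \<Rightarrow> real \<Rightarrow> real"
  where "scaled g s x = s\<^sup>2 * g (s * x)"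

definition sys :: "(real \<Rightarrow> real) \<Rightarrow> (real \<Rightarrow> real) \<Rightarrow> real \<Rightarrow> real \<Rightarrow> real \<Rightarrow> real \<times> real \<Rightarrow> real \<times> real"
  where "sys g h t s = coef (scaled g s) (scaled h s) (s\<^sup>2 * t)"

text \<open>The inner product of \<open>u\<close> with \<open>S v\<close> for real functions.\<close>

definition pairing :: "real \<Rightarrow> (real \<Rightarrow> real \<times> real) \<Rightarrow> (real \<Rightarrow> real \<times> real) \<Rightarrow> real"
  where "pairing l u v = integral {0..l} (\<lambda>x. fst (u x) * snd (v x) + snd (u x) * fst (v x))"

text \<open>The functions \<open>y i\<close> are a real basis of the kernel at \<open>(t0, s0)\<close> and \<open>a i\<close> are their initial
  slopes. Of the dependence of the potentials on \<open>s\<close> only a Lipschitz bound and the derivative of their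
  integrals against continuous functions matter.\<close>

locale kernel_basis =
  fixes l s0 t0 \<delta> L :: real and g h dg dh :: "real \<Rightarrow> real"
    and n :: nat and y :: "nat \<Rightarrow> real \<Rightarrow> real \<times> real" and a :: "nat \<Rightarrow> real \<times> real"
  assumes l: "0 < l" and \<delta>: "0 < \<delta>" and L: "0 \<le> L"
    and contg: "\<And>s. \<bar>s - s0\<bar> \<le> \<delta> \<Longrightarrow> continuous_on {0..l} (scaled g s)"
    and conth: "\<And>s. \<bar>s - s0\<bar> \<le> \<delta> \<Longrightarrow> continuous_on {0..l} (scaled h s)"
    and lipg: "\<And>s x. \<bar>s - s0\<bar> \<le> \<delta> \<Longrightarrow> x \<in> {0..l} \<Longrightarrow> \<bar>scaled g s x - scaled g s0 x\<bar> \<le> L * \<bar>s - s0\<bar>"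
    and liph: "\<And>s x. \<bar>s - s0\<bar> \<le> \<delta> \<Longrightarrow> x \<in> {0..l} \<Longrightarrow> \<bar>scaled h s x - scaled h s0 x\<bar> \<le> L * \<bar>s - s0\<bar>"
    and derg: "\<And>v. continuous_on {0..l} v \<Longrightarrow> ((\<lambda>s. integral {0..l} (\<lambda>x. scaled g s x * v x))
        has_real_derivative integral {0..l} (\<lambda>x. dg x * v x)) (at s0)"
    and derh: "\<And>v. continuous_on {0..l} v \<Longrightarrow> ((\<lambda>s. integral {0..l} (\<lambda>x. scaled h s x * v x))
        has_real_derivative integral {0..l} (\<lambda>x. dh x * v x)) (at s0)"
    and ker: "\<And>i. i < n \<Longrightarrow> bsol l (sys g h t0 s0) (\<lambda>_. 0) (\<lambda>x. 0) 0 (y i) (a i)"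
    and indep: "\<And>c. (\<Sum>i<n. c i *\<^sub>R a i) = 0 \<Longrightarrow> \<forall>i<n. c i = 0"
    and span: "\<And>U b. bsol l (sys g h t0 s0) (\<lambda>_. 0) (\<lambda>x. 0) 0 U b \<Longrightarrow> \<exists>c. b = (\<Sum>i<n. c i *\<^sub>R a i)"
begin

abbreviation A where "A \<equiv> sys g h"

lemma volterra_A: "\<bar>s - s0\<bar> \<le> \<delta> \<Longrightarrow> \<exists>C. volterra (A t s) l C"
  unfolding sys_def using volterra_coef[OF l contg conth] by metis

lemma yc: "i < n \<Longrightarrow> continuous_on {0..l} (y i)"
  using ker by (simp add: bsol_def sol_def)

definition \<beta> :: "nat \<Rightarrow> real \<times> real"
  where "\<beta> j = flux (scaled g s0) (scaled h s0) (s0\<^sup>2 * t0) l (y j) (a j)"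

lemma inner_\<beta>:
  assumes f: "continuous_on {0..l} f" and w: "sol l (A t0 s0) (\<lambda>x. x *\<^sub>R b + dint f x) w" and j: "j < n"
  shows "inner (\<beta> j) (w l) = integral {0..l} (\<lambda>x. snd (f x) * snd (y j x) - fst (f x) * fst (y j x))"
  using Green_identity[OF l contg conth f w[unfolded sys_def] ker[OF j, unfolded sys_def]] \<delta>
  by (simp add: \<beta>_def)

text \<open>If a combination \<open>Y\<close> of the kernel functions had vanishing flux at \<open>l\<close>, testing it against
  the solution whose source is \<open>Y\<close> itself, up to signs, would give \<open>\<parallel>Y\<parallel>\<^sup>2 = 0\<close>.\<close>

lemma \<beta>_independent:
  assumes 0: "(\<Sum>i<n. c i *\<^sub>R \<beta> i) = 0"
  shows "\<forall>i<n. c i = 0"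
proof -
  obtain C where "volterra (A t0 s0) l C" using volterra_A[of s0 t0] \<delta> by auto
  then interpret v: volterra "A t0 s0" l C .
  define Y where "Y x = (\<Sum>i<n. c i *\<^sub>R y i x)" for x
  define b where "b = (\<Sum>i<n. c i *\<^sub>R a i)"
  have Z: "linear (\<lambda>_ :: real \<times> real. 0 :: real \<times> real)" by (rule linear_zero)
  have Y: "bsol l (A t0 s0) (\<lambda>_. 0) (\<lambda>x. 0) 0 Y b"
    unfolding Y_def[abs_def] b_def
    using v.bsol_sum[OF Z finite_lessThan, of n "\<lambda>i x. c i *\<^sub>R 0" "\<lambda>i. c i *\<^sub>R 0" "\<lambda>i x. c i *\<^sub>R y i x" "\<lambda>i. c i *\<^sub>R a i"]
      v.bsol_scale[OF Z ker] by simp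
  have Yc: "continuous_on {0..l} Y" using Y by (simp add: bsol_def sol_def)
  define f where "f x = (- fst (Y x), snd (Y x))" for x
  have fc: "continuous_on {0..l} f" unfolding f_def by (intro continuous_intros Yc)
  obtain w where w: "sol l (A t0 s0) (dint f) w"
    using v.sol_exists[OF continuous_on_dint[OF integrable_continuous_interval[OF fc]]] by blast
  have "sol l (A t0 s0) (\<lambda>x. x *\<^sub>R 0 + dint f x) w" using w by simp
  note G = inner_\<beta>[OF fc this]
  have "0 = (\<Sum>i<n. c i * inner (\<beta> i) (w l))"
    using arg_cong[OF 0, of "\<lambda>v. inner v (w l)"] by (simp add: inner_sum_left)
  also have "\<dots> = (\<Sum>i<n. c i * integral {0..l} (\<lambda>x. snd (f x) * snd (y i x) - fst (f x) * fst (y i x)))"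
    using G by simp
  also have "\<dots> = (\<Sum>i<n. integral {0..l} (\<lambda>x. c i * (snd (f x) * snd (y i x) - fst (f x) * fst (y i x))))"
    by simp
  also have "\<dots> = integral {0..l} (\<lambda>x. \<Sum>i<n. c i * (snd (f x) * snd (y i x) - fst (f x) * fst (y i x)))"
    by (intro integral_sum[symmetric] integrable_continuous_interval continuous_intros fc yc) auto
  also have "\<dots> = integral {0..l} (\<lambda>x. (norm (Y x))\<^sup>2)"
  proof (intro integral_cong)
    fix x
    have "fst (Y x) = (\<Sum>i<n. c i * fst (y i x))" "snd (Y x) = (\<Sum>i<n. c i * snd (y i x))"
      by (simp_all add: Y_def fst_sum snd_sum)
    then show "(\<Sum>i<n. c i * (snd (f x) * snd (y i x) - fst (f x) * fst (y i x))) = (norm (Y x))\<^sup>2"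
      by (simp add: f_def power2_norm_eq_inner inner_prod_def sum_distrib_left distrib_left sum.distrib mult_ac)
  qed
  finally have "integral {0..l} (\<lambda>x. (norm (Y x))\<^sup>2) = 0" by simp
  moreover have "continuous_on {0..l} (\<lambda>x. (norm (Y x))\<^sup>2)" by (intro continuous_intros Yc)
  ultimately have "\<forall>x\<in>{0..l}. (norm (Y x))\<^sup>2 = 0"
    using integral_eq_0_iff[of 0 l "\<lambda>x. (norm (Y x))\<^sup>2"] l by simp
  then have Y0: "Y x = 0" if "x \<in> {0..l}" for x using that by simp
  have "dint (\<lambda>x. A t0 s0 x (Y x)) l = dint (\<lambda>x. 0) l"
    using Y0 by (intro dint_cong) (simp add: sys_def coef_def zero_prod_def)
  moreover have "\<forall>x\<in>{0..l}. Y x = (x *\<^sub>R b + 0) + dint (\<lambda>x. A t0 s0 x (Y x)) x"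
    using Y unfolding bsol_def sol_def by blast
  then have "Y l = (l *\<^sub>R b + 0) + dint (\<lambda>x. A t0 s0 x (Y x)) l" by (rule bspec) (use l in simp)
  ultimately have "b = 0" using Y0[of l] l by simp
  then show ?thesis using indep by (simp add: b_def)
qed

text \<open>The border \<open>Z\<close> carries the initial slopes of the kernel onto their fluxes. Since these span the
  complement of the values at \<open>l\<close> that initial value solutions can attain, the bordered problem has
  no kernel left.\<close>

lemma border_exists:
  obtains Z where "linear Z" "\<forall>i<n. Z (a i) = \<beta> i" "\<forall>v. \<exists>c. Z v = (\<Sum>i<n. c i *\<^sub>R \<beta> i)"
    "\<forall>U b. bsol l (A t0 s0) Z (\<lambda>x. 0) 0 U b \<longrightarrow> b = 0"
proof -
  obtain \<phi> :: "nat \<Rightarrow> real \<times> real \<Rightarrow> real" where \<phi>: "\<And>i. linear (\<phi> i)"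
    "\<And>i j. i < n \<Longrightarrow> j < n \<Longrightarrow> \<phi> i (a j) = (if i = j then 1 else 0)"
    using dual_functionals[OF indep] by blast
  define Z where "Z v = (\<Sum>i<n. \<phi> i v *\<^sub>R \<beta> i)" for v
  have Zl: "linear Z"
    by (intro linearI) (simp_all add: Z_def linear_add[OF \<phi>(1)] linear_scale[OF \<phi>(1)] sum.distrib
        scaleR_left_distrib scaleR_sum_right)
  have Za: "Z (a i) = \<beta> i" if "i < n" for i
  proof -
    have "Z (a i) = (\<Sum>k<n. if k = i then \<beta> k else 0)"
      unfolding Z_def using \<phi>(2) that by (intro sum.cong) auto
    then show ?thesis using that by simp
  qed
  have triv: "b = 0" if b: "bsol l (A t0 s0) Z (\<lambda>x. 0) 0 U b" for U b
  proof -
    have U: "sol l (A t0 s0) (\<lambda>x. x *\<^sub>R b + dint (\<lambda>x. 0) x) U" using b by (simp add: bsol_def)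
    have orth: "inner (\<beta> j) (U l) = 0" if "j < n" for j
      using inner_\<beta>[OF continuous_on_const U that] by simp
    have UZ: "U l = - Z b" using b by (simp add: bsol_def eq_neg_iff_add_eq_0)
    have "inner (U l) (U l) = inner (- Z b) (U l)" by (rule arg_cong[OF UZ, of "\<lambda>v. inner v (U l)"])
    also have "\<dots> = - (\<Sum>i<n. \<phi> i b * inner (\<beta> i) (U l))"
      by (simp add: Z_def inner_sum_left)
    finally have "inner (U l) (U l) = - (\<Sum>i<n. \<phi> i b * inner (\<beta> i) (U l))" .
    then have U0: "U l = 0" using orth by simp
    then have "Z b = 0" using UZ by simp
    then have \<phi>0: "\<forall>i<n. \<phi> i b = 0" unfolding Z_def by (rule \<beta>_independent)
    have "bsol l (A t0 s0) (\<lambda>_. 0) (\<lambda>x. 0) 0 U b" using b U0 by (simp add: bsol_def)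
    then obtain c where c: "b = (\<Sum>i<n. c i *\<^sub>R a i)" using span by blast
    have "\<phi> k b = c k" if "k < n" for k
    proof -
      have "\<phi> k b = (\<Sum>i<n. if i = k then c i else 0)"
        unfolding c linear_sum[OF \<phi>(1)] linear_scale[OF \<phi>(1)] using \<phi>(2) that
        by (intro sum.cong) auto
      then show ?thesis using that by simp
    qed
    then have "c k = 0" if "k < n" for k using \<phi>0 that by simp
    then show "b = 0" unfolding c by (intro sum.neutral) simp
  qed
  show ?thesis
  proof (rule that[OF Zl])
    show "\<forall>i<n. Z (a i) = \<beta> i" using Za by simp
    show "\<forall>v. \<exists>c. Z v = (\<Sum>i<n. c i *\<^sub>R \<beta> i)" by (intro allI exI) (rule Z_def)
    show "\<forall>U b. bsol l (A t0 s0) Z (\<lambda>x. 0) 0 U b \<longrightarrow> b = 0" using triv by simp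
  qed
qed

definition \<Lambda> :: real where "\<Lambda> = 2 * (L + ((\<bar>s0\<bar> + \<delta>)\<^sup>2 + 2 * \<bar>t0\<bar> * (\<bar>s0\<bar> + \<delta>)))"

lemma \<Lambda>_nonneg: "0 \<le> \<Lambda>"
  using L \<delta> by (simp add: \<Lambda>_def)

lemma spectral_shift_lipschitz:
  assumes s: "\<bar>s - s0\<bar> \<le> \<delta>"
  shows "\<bar>s\<^sup>2 * t - s0\<^sup>2 * t0\<bar> \<le> ((\<bar>s0\<bar> + \<delta>)\<^sup>2 + 2 * \<bar>t0\<bar> * (\<bar>s0\<bar> + \<delta>)) * (\<bar>t - t0\<bar> + \<bar>s - s0\<bar>)"
proof -
  define S where "S = \<bar>s0\<bar> + \<delta>"
  have S: "\<bar>s\<bar> \<le> S" "\<bar>s0\<bar> \<le> S" "0 \<le> S" using s \<delta> by (auto simp: S_def)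
  have s2: "s\<^sup>2 \<le> S\<^sup>2" using power_mono[OF S(1), of 2] by simp
  have "s\<^sup>2 * t - s0\<^sup>2 * t0 = s\<^sup>2 * (t - t0) + t0 * ((s + s0) * (s - s0))"
    by (simp add: power2_eq_square algebra_simps)
  then have "\<bar>s\<^sup>2 * t - s0\<^sup>2 * t0\<bar> \<le> s\<^sup>2 * \<bar>t - t0\<bar> + \<bar>t0\<bar> * (\<bar>s + s0\<bar> * \<bar>s - s0\<bar>)"
    using abs_triangle_ineq[of "s\<^sup>2 * (t - t0)" "t0 * ((s + s0) * (s - s0))"] by (simp add: abs_mult)
  also have "\<dots> \<le> S\<^sup>2 * \<bar>t - t0\<bar> + \<bar>t0\<bar> * ((2 * S) * \<bar>s - s0\<bar>)"
    using S s2 by (intro add_mono mult_left_mono mult_right_mono) auto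
  also have "\<dots> \<le> S\<^sup>2 * (\<bar>t - t0\<bar> + \<bar>s - s0\<bar>) + (2 * \<bar>t0\<bar> * S) * (\<bar>t - t0\<bar> + \<bar>s - s0\<bar>)"
    using S by (simp add: algebra_simps)
  finally show ?thesis by (simp add: S_def algebra_simps)
qed

lemma A_lipschitz:
  assumes s: "\<bar>s - s0\<bar> \<le> \<delta>" and x: "x \<in> {0..l}"
  shows "norm (A t s x u - A t0 s0 x u) \<le> \<Lambda> * (\<bar>t - t0\<bar> + \<bar>s - s0\<bar>) * norm u"
proof -
  let ?d = "\<bar>t - t0\<bar> + \<bar>s - s0\<bar>"
  have "L * \<bar>s - s0\<bar> \<le> L * ?d" using L by (intro mult_left_mono) auto
  then have "norm (A t s x u - A t0 s0 x u)
      \<le> 2 * (L * ?d + ((\<bar>s0\<bar> + \<delta>)\<^sup>2 + 2 * \<bar>t0\<bar> * (\<bar>s0\<bar> + \<delta>)) * ?d) * norm u"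
    unfolding sys_def coef_diff using lipg[OF s x] liph[OF s x]
    by (intro norm_coef_le spectral_shift_lipschitz s) linarith+
  then show ?thesis by (simp add: \<Lambda>_def algebra_simps)
qed

text \<open>Near \<open>(t0, s0)\<close> the bordered problem stays well posed, with constants that do not depend on the
  parameters.\<close>

lemma bordered_exists:
  obtains Z \<epsilon> K where "linear Z" "\<forall>i<n. Z (a i) = \<beta> i" "\<forall>v. \<exists>c. Z v = (\<Sum>i<n. c i *\<^sub>R \<beta> i)"
    "0 < \<epsilon>" "\<epsilon> \<le> \<delta>"
    "\<forall>t s. \<bar>t - t0\<bar> \<le> \<epsilon> \<longrightarrow> \<bar>s - s0\<bar> \<le> \<epsilon> \<longrightarrow> well_posed l (A t s) Z K"
proof -
  obtain Z where Z: "linear Z" "\<forall>i<n. Z (a i) = \<beta> i" "\<forall>v. \<exists>c. Z v = (\<Sum>i<n. c i *\<^sub>R \<beta> i)"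
    and triv: "\<forall>U b. bsol l (A t0 s0) Z (\<lambda>x. 0) 0 U b \<longrightarrow> b = 0"
    by (rule border_exists)
  obtain C where "volterra (A t0 s0) l C" using volterra_A[of s0 t0] \<delta> by auto
  then interpret v: volterra "A t0 s0" l C .
  obtain K \<eta> where \<eta>: "0 < \<eta>"
    and st: "\<forall>A' C'. volterra A' l C' \<longrightarrow> (\<forall>x\<in>{0..l}. \<forall>u. norm (A' x u - A t0 s0 x u) \<le> \<eta> * norm u) \<longrightarrow> well_posed l A' Z K"
    by (rule v.bsol_stable[OF Z(1) triv])
  define \<epsilon> where "\<epsilon> = min \<delta> (\<eta> / (2 * (\<Lambda> + 1)))"
  have \<epsilon>: "0 < \<epsilon>" "\<epsilon> \<le> \<delta>" using \<delta> \<eta> \<Lambda>_nonneg by (auto simp: \<epsilon>_def)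
  have close: "norm (A t s x u - A t0 s0 x u) \<le> \<eta> * norm u"
    if "\<bar>t - t0\<bar> \<le> \<epsilon>" "\<bar>s - s0\<bar> \<le> \<epsilon>" "x \<in> {0..l}" for t s x u
  proof -
    have "\<Lambda> * (\<bar>t - t0\<bar> + \<bar>s - s0\<bar>) \<le> (\<Lambda> + 1) * (2 * (\<eta> / (2 * (\<Lambda> + 1))))"
      using that \<Lambda>_nonneg by (intro mult_mono) (auto simp: \<epsilon>_def)
    also have "\<dots> = \<eta>"
    proof -
      have "\<Lambda> + 1 \<noteq> 0" using \<Lambda>_nonneg by linarith
      then show ?thesis by (simp add: divide_simps)
    qed
    finally show ?thesis
      using A_lipschitz[of s x t u] that \<epsilon> by (meson mult_right_mono norm_ge_zero order_trans)
  qed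
  have "well_posed l (A t s) Z K" if near: "\<bar>t - t0\<bar> \<le> \<epsilon>" "\<bar>s - s0\<bar> \<le> \<epsilon>" for t s
  proof -
    obtain C' where "volterra (A t s) l C'" using volterra_A[of s t] near \<epsilon> by auto
    then show ?thesis using st close[OF near] by blast
  qed
  then show ?thesis by (intro that[OF Z \<epsilon>, of K]) simp
qed

end

section \<open>The reduced matrix\<close>

text \<open>All derivatives below are read off from expansions with a quadratic remainder.\<close>

lemma has_real_derivative_quadratic:
  fixes f :: "real \<Rightarrow> real"
  assumes e: "0 < e" and le: "\<And>t'. \<bar>t' - t\<bar> \<le> e \<Longrightarrow> \<bar>f t' - f t - (t' - t) * d\<bar> \<le> C * (t' - t)\<^sup>2"
  shows "(f has_real_derivative d) (at t)"
proof -
  have "\<forall>\<^sub>F t' in at t. norm ((f t' - f t) / (t' - t) - d) \<le> C * \<bar>t' - t\<bar>"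
    unfolding eventually_at
  proof (intro exI[of _ e] conjI ballI impI e)
    fix t' assume t': "t' \<noteq> t \<and> dist t' t < e"
    then have "t' - t \<noteq> 0" "\<bar>t' - t\<bar> \<le> e" by (auto simp: dist_real_def)
    then have "(f t' - f t) / (t' - t) - d = (f t' - f t - (t' - t) * d) / (t' - t)"
      by (simp add: field_simps)
    then have "norm ((f t' - f t) / (t' - t) - d) = \<bar>f t' - f t - (t' - t) * d\<bar> / \<bar>t' - t\<bar>"
      by simp
    also have "\<dots> \<le> C * (t' - t)\<^sup>2 / \<bar>t' - t\<bar>"
      using le[OF \<open>\<bar>t' - t\<bar> \<le> e\<close>] by (intro divide_right_mono) auto
    also have "\<dots> = C * \<bar>t' - t\<bar>"
    proof -
      define d where "d = \<bar>t' - t\<bar>"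
      have "d \<noteq> 0" "(t' - t)\<^sup>2 = d * d" using \<open>t' - t \<noteq> 0\<close> by (simp_all add: d_def power2_eq_square)
      then show ?thesis by (simp flip: d_def)
    qed
    finally show "norm ((f t' - f t) / (t' - t) - d) \<le> C * \<bar>t' - t\<bar>" .
  qed
  moreover have "((\<lambda>t'. C * \<bar>t' - t\<bar>) \<longlongrightarrow> C * \<bar>t - t\<bar>) (at t)"
    by (intro tendsto_intros)
  then have "((\<lambda>t'. C * \<bar>t' - t\<bar>) \<longlongrightarrow> 0) (at t)" by simp
  ultimately have "((\<lambda>t'. (f t' - f t) / (t' - t) - d) \<longlongrightarrow> 0) (at t)"
    by (rule Lim_null_comparison)
  then show ?thesis by (simp add: has_field_derivative_iff LIM_zero_iff)
qed

lemma continuous_on_pairing_integrand: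
  assumes "continuous_on {0..l} u" "continuous_on {0..l} v"
  shows "continuous_on {0..l} (\<lambda>x. fst (u x) * snd (v x) + snd (u x) * fst (v x) :: real)"
  by (intro continuous_intros assms)

lemma pairing_diff:
  assumes "continuous_on {0..l} u" "continuous_on {0..l} w" "continuous_on {0..l} v"
  shows "pairing l (\<lambda>x. u x - w x) v = pairing l u v - pairing l w v"
proof -
  have "pairing l (\<lambda>x. u x - w x) v = integral {0..l} (\<lambda>x. (fst (u x) * snd (v x) + snd (u x) * fst (v x))
      - (fst (w x) * snd (v x) + snd (w x) * fst (v x)))"
    unfolding pairing_def by (intro integral_cong) (simp add: algebra_simps)
  also have "\<dots> = pairing l u v - pairing l w v" unfolding pairing_def
    by (intro integral_diff integrable_continuous_interval continuous_on_pairing_integrand assms)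
  finally show ?thesis .
qed

lemma pairing_scale: "pairing l (\<lambda>x. c *\<^sub>R u x) v = c * pairing l u v"
proof -
  have "pairing l (\<lambda>x. c *\<^sub>R u x) v = integral {0..l} (\<lambda>x. c * (fst (u x) * snd (v x) + snd (u x) * fst (v x)))"
    unfolding pairing_def by (intro integral_cong) (simp add: algebra_simps)
  then show ?thesis by (simp add: pairing_def)
qed

lemma pairing_cong: "(\<And>x. x \<in> {0..l} \<Longrightarrow> u x = w x) \<Longrightarrow> pairing l u v = pairing l w v"
  unfolding pairing_def by (intro integral_cong) auto

lemma abs_weighted_le:
  fixes u v :: "real \<times> real"
  assumes "\<bar>p\<bar> \<le> c" "\<bar>r\<bar> \<le> c" "norm u \<le> \<kappa>" "norm v \<le> B"
    and f: "\<bar>u1\<bar> \<le> norm u" "\<bar>u2\<bar> \<le> norm u" "\<bar>v1\<bar> \<le> norm v" "\<bar>v2\<bar> \<le> norm v"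
  shows "\<bar>p * (u1 * v1) + r * (u2 * v2)\<bar> \<le> 2 * c * \<kappa> * B"
proof -
  have *: "\<bar>a\<bar> * (\<bar>b\<bar> * \<bar>d\<bar>) \<le> c * (\<kappa> * B)"
    if "\<bar>a\<bar> \<le> c" "\<bar>b\<bar> \<le> norm u" "\<bar>d\<bar> \<le> norm v" for a b d
  proof -
    have "\<bar>b\<bar> \<le> \<kappa>" "\<bar>d\<bar> \<le> B" "0 \<le> \<kappa>" using that assms norm_ge_zero[of u] by linarith+
    then show ?thesis using that by (intro mult_mono) auto
  qed
  have "\<bar>p * (u1 * v1) + r * (u2 * v2)\<bar> \<le> \<bar>p\<bar> * (\<bar>u1\<bar> * \<bar>v1\<bar>) + \<bar>r\<bar> * (\<bar>u2\<bar> * \<bar>v2\<bar>)"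
    using abs_triangle_ineq[of "p * (u1 * v1)" "r * (u2 * v2)"] by (simp add: abs_mult)
  also have "\<dots> \<le> 2 * c * \<kappa> * B"
    using *[OF assms(1) f(1) f(3)] *[OF assms(2) f(2) f(4)] by simp
  finally show ?thesis .
qed

lemma abs_components: "\<bar>fst u\<bar> \<le> norm u" "\<bar>snd u\<bar> \<le> norm u" for u :: "real \<times> real"
  using norm_fst_le[of "fst u" "snd u"] norm_snd_le[of "snd u" "fst u"] by simp_all

lemma pairing_bound:
  assumes v: "continuous_on {0..l} v" and l: "0 < l"
  obtains c where "0 \<le> c"
    "\<forall>u \<kappa>. continuous_on {0..l} u \<longrightarrow> (\<forall>x\<in>{0..l}. norm (u x) \<le> \<kappa>) \<longrightarrow> \<bar>pairing l u v\<bar> \<le> c * \<kappa>"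
proof -
  have "bounded (v ` {0..l})" using v by (intro compact_imp_bounded compact_continuous_image) auto
  then obtain B where B: "\<And>x. x \<in> {0..l} \<Longrightarrow> norm (v x) \<le> B" unfolding bounded_iff by (metis imageI)
  have B0: "0 \<le> B" using order_trans[OF norm_ge_zero B[of 0]] l by auto
  have "\<bar>pairing l u v\<bar> \<le> (2 * B * l) * \<kappa>"
    if u: "continuous_on {0..l} u" and \<kappa>: "\<And>x. x \<in> {0..l} \<Longrightarrow> norm (u x) \<le> \<kappa>" for u \<kappa>
  proof -
    have "norm (pairing l u v) \<le> integral {0..l} (\<lambda>x. 2 * 1 * \<kappa> * B)"
      unfolding pairing_def
    proof (intro integral_norm_bound_integral)
      fix x assume x: "x \<in> {0..l}"
      show "norm (fst (u x) * snd (v x) + snd (u x) * fst (v x)) \<le> 2 * 1 * \<kappa> * B"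
        using abs_weighted_le[of 1 1 1 "u x" \<kappa> "v x" B "fst (u x)" "snd (u x)" "snd (v x)" "fst (v x)"]
          \<kappa>[OF x] B[OF x] abs_components[of "u x"] abs_components[of "v x"] by simp
    qed (auto intro!: integrable_continuous_interval continuous_on_pairing_integrand u v)
    then show ?thesis using l by (simp add: mult_ac)
  qed
  then have "\<forall>u \<kappa>. continuous_on {0..l} u \<longrightarrow> (\<forall>x\<in>{0..l}. norm (u x) \<le> \<kappa>) \<longrightarrow> \<bar>pairing l u v\<bar> \<le> (2 * B * l) * \<kappa>"
    by simp
  then show ?thesis using B0 l by (intro that[of "2 * B * l"]) simp_all
qed

text \<open>At fixed \<open>s\<close> the coefficient is affine in \<open>t\<close>, with this constant map as its direction.\<close>

definition rot :: "real \<times> real \<Rightarrow> real \<times> real" where "rot u = (- snd u, fst u)"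

lemma rot_simps: "rot (u - v) = rot u - rot v" "rot (c *\<^sub>R u) = c *\<^sub>R rot u" "norm (rot u) = norm u"
  by (simp_all add: rot_def norm_prod_def add.commute)

lemma continuous_on_rot: "continuous_on S u \<Longrightarrow> continuous_on S (\<lambda>x. rot (u x))"
  unfolding rot_def by (intro continuous_intros)

lemma sys_diff_t: "sys g h t s x u - sys g h t' s x u = ((t - t') * s\<^sup>2) *\<^sub>R rot u"
  by (simp add: sys_def coef_diff) (simp add: coef_def rot_def algebra_simps)

text \<open>\<open>\<Phi> i t s\<close> continues the kernel function \<open>y i\<close> to nearby parameters: it keeps solving the equation
  and \<open>\<Phi> i t s l + Z (\<alpha> i t s) = \<beta> i\<close>, but it may violate the boundary condition at \<open>l\<close>.\<close>

locale bordered = kernel_basis +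
  fixes Z :: "real \<times> real \<Rightarrow> real \<times> real" and \<epsilon> K :: real
    and \<Phi> :: "nat \<Rightarrow> real \<Rightarrow> real \<Rightarrow> real \<Rightarrow> real \<times> real" and \<alpha> :: "nat \<Rightarrow> real \<Rightarrow> real \<Rightarrow> real \<times> real"
  assumes Zl: "linear Z" and Za: "\<And>i. i < n \<Longrightarrow> Z (a i) = \<beta> i" and Zspan: "\<And>v. \<exists>c. Z v = (\<Sum>i<n. c i *\<^sub>R \<beta> i)"
    and \<epsilon>: "0 < \<epsilon>" "\<epsilon> \<le> \<delta>"
    and wp: "\<And>t s. \<bar>t - t0\<bar> \<le> \<epsilon> \<Longrightarrow> \<bar>s - s0\<bar> \<le> \<epsilon> \<Longrightarrow> well_posed l (A t s) Z K"
    and \<Phi>_bsol: "\<And>i t s. i < n \<Longrightarrow> \<bar>t - t0\<bar> \<le> \<epsilon> \<Longrightarrow> \<bar>s - s0\<bar> \<le> \<epsilon> \<Longrightarrow>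
      bsol l (A t s) Z (\<lambda>x. 0) (\<beta> i) (\<Phi> i t s) (\<alpha> i t s)"
begin

abbreviation near where "near t s \<equiv> \<bar>t - t0\<bar> \<le> \<epsilon> \<and> \<bar>s - s0\<bar> \<le> \<epsilon>"

lemma volt: "near t s \<Longrightarrow> \<exists>C. volterra (A t s) l C"
  using volterra_A \<epsilon> by auto

lemma near0: "near t0 s0" using \<epsilon> by simp

lemma K_pos: "0 < K" using wp[of t0 s0] \<epsilon> by (simp add: well_posed_def)

lemma csol_bound:
  assumes "near t s" and c: "csol l (A t s) Z f \<zeta> U b" and \<kappa>: "\<And>x. x \<in> {0..l} \<Longrightarrow> norm (f x) \<le> \<kappa>"
  shows "norm b \<le> K * (\<kappa> * l\<^sup>2 + norm \<zeta>)" "x \<in> {0..l} \<Longrightarrow> norm (U x) \<le> K * (\<kappa> * l\<^sup>2 + norm \<zeta>)"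
proof -
  have f: "continuous_on {0..l} f" using c by (simp add: csol_def)
  have \<kappa>0: "0 \<le> \<kappa>" using order_trans[OF norm_ge_zero \<kappa>[of 0]] l by auto
  have "norm (dint f x) \<le> \<kappa> * l\<^sup>2" if "x \<in> {0..l}" for x
    using \<kappa> \<kappa>0 f that by (intro norm_dint_le_sup integrable_continuous_interval) auto
  note bd = well_posed_bound[OF wp c[unfolded csol_def, THEN conjunct2]
      continuous_on_dint[OF integrable_continuous_interval[OF f]] this]
  show "norm b \<le> K * (\<kappa> * l\<^sup>2 + norm \<zeta>)" using bd(1) assms(1) by simp
  show "norm (U x) \<le> K * (\<kappa> * l\<^sup>2 + norm \<zeta>)" if "x \<in> {0..l}" using bd(2) assms(1) that by simp
qed

lemma csol_unique:
  assumes near: "near t s" and 1: "csol l (A t s) Z f \<zeta> U b" and 2: "csol l (A t s) Z f \<zeta> V c"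
  shows "b = c" "x \<in> {0..l} \<Longrightarrow> U x = V x"
proof -
  obtain C where "volterra (A t s) l C" using volt[OF near] by blast
  then interpret v: volterra "A t s" l C .
  have d: "csol l (A t s) Z (\<lambda>x. f x - f x) (\<zeta> - \<zeta>) (\<lambda>x. U x - V x) (b - c)"
    by (rule v.csol_diff[OF Zl 1 2])
  show "b = c" using csol_bound(1)[OF near d, of 0] by simp
  show "U x = V x" if "x \<in> {0..l}" using csol_bound(2)[OF near d, of 0] that by simp
qed

lemma \<Phi>_csol: "i < n \<Longrightarrow> near t s \<Longrightarrow> csol l (A t s) Z (\<lambda>x. 0) (\<beta> i) (\<Phi> i t s) (\<alpha> i t s)"
  using \<Phi>_bsol by (simp add: csol_zero_iff)

lemma \<Phi>_cont: "i < n \<Longrightarrow> near t s \<Longrightarrow> continuous_on {0..l} (\<Phi> i t s)"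
  using csol_cont[OF \<Phi>_csol] .

lemma \<Phi>_bound: "i < n \<Longrightarrow> near t s \<Longrightarrow> x \<in> {0..l} \<Longrightarrow> norm (\<Phi> i t s x) \<le> K * norm (\<beta> i)"
  using csol_bound(2)[OF _ \<Phi>_csol, of t s i 0 x] by simp

lemma y_csol: "i < n \<Longrightarrow> csol l (A t0 s0) Z (\<lambda>x. 0) (\<beta> i) (y i) (a i)"
  using ker[of i] Za[of i] by (simp add: csol_zero_iff bsol_def)

lemma \<Phi>_base: "i < n \<Longrightarrow> x \<in> {0..l} \<Longrightarrow> \<Phi> i t0 s0 x = y i x"
  using csol_unique(2)[OF near0 \<Phi>_csol[OF _ near0] y_csol] .

lemma csol_to_base:
  assumes near: "near t s" and c: "csol l (A t s) Z f \<zeta> U b"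
  shows "csol l (A t0 s0) Z (\<lambda>x. f x + (A t s x (U x) - A t0 s0 x (U x))) \<zeta> U b"
proof -
  obtain C where "volterra (A t0 s0) l C" using volt[OF near0] by blast
  then interpret v: volterra "A t0 s0" l C .
  show ?thesis using v.csol_move[OF _ Zl c] volt[OF near] by blast
qed

text \<open>Up to the sign, the components of the boundary values \<open>\<Phi> i t s l\<close> along the fluxes.\<close>

definition M :: "nat \<Rightarrow> nat \<Rightarrow> real \<Rightarrow> real \<Rightarrow> real"
  where "M i j t s = - inner (\<beta> j) (\<Phi> i t s l)"

lemma inner_\<beta>_csol:
  assumes "csol l (A t0 s0) Z f \<zeta> U b" "j < n"
  shows "inner (\<beta> j) (U l) = integral {0..l} (\<lambda>x. snd (f x) * snd (y j x) - fst (f x) * fst (y j x))"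
  using assms by (intro inner_\<beta>[of f b]) (auto simp: csol_def bsol_def)

text \<open>\<open>\<Phi> i t s\<close> solves the equation at \<open>(t0, s0)\<close> with the change of the coefficient as source; the
  Green identity then expresses \<open>M\<close> by this change, which is small of first order.\<close>

lemma M_formula:
  assumes i: "i < n" and j: "j < n" and near: "near t s"
  shows "M i j t s = integral {0..l} (\<lambda>x. (scaled g s x - scaled g s0 x) * (fst (\<Phi> i t s x) * fst (y j x))
      + (scaled h s0 x - scaled h s x) * (snd (\<Phi> i t s x) * snd (y j x)) ) * (-1)
      - (s\<^sup>2 * t - s0\<^sup>2 * t0) * pairing l (\<Phi> i t s) (y j)"
proof -
  let ?U = "\<Phi> i t s"
  let ?\<mu> = "s\<^sup>2 * t - s0\<^sup>2 * t0"
  let ?F = "\<lambda>x. (scaled g s x - scaled g s0 x) * (fst (?U x) * fst (y j x))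
      + (scaled h s0 x - scaled h s x) * (snd (?U x) * snd (y j x))"
  let ?P = "\<lambda>x. fst (?U x) * snd (y j x) + snd (?U x) * fst (y j x)"
  have s: "\<bar>s - s0\<bar> \<le> \<delta>" "\<bar>s0 - s0\<bar> \<le> \<delta>" using near \<epsilon> by auto
  have U: "continuous_on {0..l} ?U" by (rule \<Phi>_cont[OF i near])
  have Fc: "continuous_on {0..l} ?F" and Pc: "continuous_on {0..l} ?P"
    by (intro continuous_intros contg conth s U yc j)+
  define f where "f x = 0 + (A t s x (?U x) - A t0 s0 x (?U x))" for x
  have "inner (\<beta> j) (?U l) = integral {0..l} (\<lambda>x. snd (f x) * snd (y j x) - fst (f x) * fst (y j x))"
    unfolding f_def by (rule inner_\<beta>_csol[OF csol_to_base[OF near \<Phi>_csol[OF i near]] j])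
  also have "\<dots> = integral {0..l} (\<lambda>x. ?F x + ?\<mu> * ?P x)"
  proof (intro integral_cong)
    fix x
    have "f x = coef (\<lambda>x. scaled g s x - scaled g s0 x) (\<lambda>x. scaled h s x - scaled h s0 x) ?\<mu> x (?U x)"
      unfolding f_def sys_def coef_diff by simp
    then show "snd (f x) * snd (y j x) - fst (f x) * fst (y j x) = ?F x + ?\<mu> * ?P x"
      by (simp add: coef_def algebra_simps)
  qed
  also have "\<dots> = integral {0..l} ?F + integral {0..l} (\<lambda>x. ?\<mu> * ?P x)"
    by (intro integral_add integrable_continuous_interval Fc continuous_on_mult continuous_on_const Pc)
  also have "integral {0..l} (\<lambda>x. ?\<mu> * ?P x) = ?\<mu> * pairing l ?U (y j)" by (simp add: pairing_def)
  finally show ?thesis by (simp add: M_def)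
qed

lemma M_base: "i < n \<Longrightarrow> j < n \<Longrightarrow> M i j t0 s0 = 0"
  using M_formula[OF _ _ near0] by simp

text \<open>A solution of the boundary value problem is a bordered solution, hence a combination of the
  \<open>\<Phi> i\<close>, and \<open>M\<close> measures the value of such a combination at \<open>l\<close>, which always lies in the span
  of the fluxes.\<close>

lemma singular_iff:
  assumes near: "near t s"
  shows "(\<exists>c. (\<exists>i<n. c i \<noteq> 0) \<and> (\<forall>j<n. (\<Sum>i<n. c i * M i j t s) = 0))
    \<longleftrightarrow> (\<exists>U b. bsol l (A t s) (\<lambda>_. 0) (\<lambda>x. 0) 0 U b \<and> b \<noteq> 0)"
proof -
  obtain C where "volterra (A t s) l C" using volt[OF near] by blast
  then interpret v: volterra "A t s" l C .
  define V where "V c x = (\<Sum>i<n. c i *\<^sub>R \<Phi> i t s x)" for c x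
  define b where "b c = (\<Sum>i<n. c i *\<^sub>R \<alpha> i t s)" for c
  have V: "csol l (A t s) Z (\<lambda>x. 0) (\<Sum>i<n. c i *\<^sub>R \<beta> i) (V c) (b c)" for c
    using v.csol_sum[OF Zl finite_lessThan v.csol_scale[OF Zl \<Phi>_csol[OF _ near]], of n "\<lambda>i. i" c]
    by (simp add: V_def[abs_def] b_def)
  have MV: "(\<Sum>i<n. c i * M i j t s) = - inner (\<beta> j) (V c l)" for c j
    by (simp add: M_def V_def inner_sum_right sum_negf)
  show ?thesis
  proof
    assume "\<exists>c. (\<exists>i<n. c i \<noteq> 0) \<and> (\<forall>j<n. (\<Sum>i<n. c i * M i j t s) = 0)"
    then obtain c where c: "\<exists>i<n. c i \<noteq> 0" and 0: "\<forall>j<n. inner (\<beta> j) (V c l) = 0" by (auto simp: MV)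
    obtain d where d: "Z (b c) = (\<Sum>i<n. d i *\<^sub>R \<beta> i)" using Zspan by blast
    have "V c l = (\<Sum>i<n. c i *\<^sub>R \<beta> i) - Z (b c)"
      using V[of c] by (simp add: csol_def bsol_def algebra_simps)
    also have "\<dots> = (\<Sum>i<n. (c i - d i) *\<^sub>R \<beta> i)"
      by (simp add: d scaleR_left_diff_distrib sum_subtractf)
    finally have Vl: "V c l = (\<Sum>i<n. (c i - d i) *\<^sub>R \<beta> i)" .
    have "inner (V c l) (V c l) = (\<Sum>i<n. (c i - d i) * inner (\<beta> i) (V c l))"
      by (subst Vl) (simp add: inner_sum_left)
    then have "V c l = 0" using 0 by simp
    then have sol: "bsol l (A t s) (\<lambda>_. 0) (\<lambda>x. 0) 0 (V c) (b c)"
      using V[of c] by (simp add: csol_zero_iff bsol_def)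
    moreover have "b c \<noteq> 0"
    proof
      assume "b c = 0"
      then have "Z (b c) = 0" using linear_0[OF Zl] by simp
      then have "(\<Sum>i<n. c i *\<^sub>R \<beta> i) = 0"
        using V[of c] \<open>V c l = 0\<close> by (simp add: csol_def bsol_def)
      then show False using \<beta>_independent c by blast
    qed
    ultimately show "\<exists>U b. bsol l (A t s) (\<lambda>_. 0) (\<lambda>x. 0) 0 U b \<and> b \<noteq> 0" by blast
  next
    assume "\<exists>U b. bsol l (A t s) (\<lambda>_. 0) (\<lambda>x. 0) 0 U b \<and> b \<noteq> 0"
    then obtain U e where U: "bsol l (A t s) (\<lambda>_. 0) (\<lambda>x. 0) 0 U e" "e \<noteq> 0" by blast
    obtain c where c: "Z e = (\<Sum>i<n. c i *\<^sub>R \<beta> i)" using Zspan by blast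
    have "csol l (A t s) Z (\<lambda>x. 0) (\<Sum>i<n. c i *\<^sub>R \<beta> i) U e"
      using U(1) c by (simp add: csol_zero_iff bsol_def)
    note eq = csol_unique[OF near this V]
    have "U l = 0" using U by (simp add: bsol_def)
    then have "V c l = 0" using eq(2)[of l] l by simp
    moreover have "\<exists>i<n. c i \<noteq> 0"
    proof (rule ccontr)
      assume "\<not> (\<exists>i<n. c i \<noteq> 0)"
      then have "b c = 0" by (simp add: b_def)
      then show False using eq(1) U(2) by simp
    qed
    ultimately show "\<exists>c. (\<exists>i<n. c i \<noteq> 0) \<and> (\<forall>j<n. (\<Sum>i<n. c i * M i j t s) = 0)"
      by (auto simp: MV)
  qed
qed

lemma \<Phi>_lipschitz:
  assumes i: "i < n"
  obtains C where "0 \<le> C"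
    "\<forall>t s. \<forall>x\<in>{0..l}. near t s \<longrightarrow> norm (\<Phi> i t s x - y i x) \<le> C * (\<bar>t - t0\<bar> + \<bar>s - s0\<bar>)"
proof -
  obtain C where "volterra (A t0 s0) l C" using volt[OF near0] by blast
  then interpret v: volterra "A t0 s0" l C .
  define B where "B = K * norm (\<beta> i)"
  have B0: "0 \<le> B" using K_pos by (simp add: B_def)
  show ?thesis
  proof (rule that[of "K * (\<Lambda> * B * l\<^sup>2)"])
    show "0 \<le> K * (\<Lambda> * B * l\<^sup>2)" using K_pos \<Lambda>_nonneg B0 by simp
    show "\<forall>t s. \<forall>x\<in>{0..l}. near t s \<longrightarrow> norm (\<Phi> i t s x - y i x) \<le> K * (\<Lambda> * B * l\<^sup>2) * (\<bar>t - t0\<bar> + \<bar>s - s0\<bar>)"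
    proof (intro allI ballI impI)
    fix t s x assume near: "near t s" and x: "x \<in> {0..l}"
    let ?d = "\<bar>t - t0\<bar> + \<bar>s - s0\<bar>"
    let ?f = "\<lambda>x. 0 + (A t s x (\<Phi> i t s x) - A t0 s0 x (\<Phi> i t s x)) - 0"
    have c: "csol l (A t0 s0) Z ?f (\<beta> i - \<beta> i) (\<lambda>x. \<Phi> i t s x - y i x) (\<alpha> i t s - a i)"
      by (rule v.csol_diff[OF Zl csol_to_base[OF near \<Phi>_csol[OF i near]] y_csol[OF i]])
    have "norm (?f x) \<le> \<Lambda> * ?d * B" if "x \<in> {0..l}" for x
    proof -
      have "norm (?f x) \<le> \<Lambda> * ?d * norm (\<Phi> i t s x)"
        using A_lipschitz[of s x t "\<Phi> i t s x"] near \<epsilon> that by simp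
      also have "\<dots> \<le> \<Lambda> * ?d * B"
        using \<Phi>_bound[OF i near that] \<Lambda>_nonneg by (intro mult_left_mono) (auto simp: B_def)
      finally show ?thesis .
    qed
    from csol_bound(2)[OF near0 c this x]
    show "norm (\<Phi> i t s x - y i x) \<le> K * (\<Lambda> * B * l\<^sup>2) * ?d" by (simp add: mult_ac)
    qed
  qed
qed

end

section \<open>Derivatives of the reduced matrix\<close>

context bordered
begin

lemma csol_change_t:
  assumes near: "near t s0" "near t' s0" and c: "csol l (A t' s0) Z f \<zeta> U b"
  shows "csol l (A t s0) Z (\<lambda>x. f x + ((t' - t) * s0\<^sup>2) *\<^sub>R rot (U x)) \<zeta> U b"
proof -
  obtain C where "volterra (A t s0) l C" using volt[OF near(1)] by blast
  then interpret v: volterra "A t s0" l C .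
  obtain C' where C': "volterra (A t' s0) l C'" using volt[OF near(2)] by blast
  show ?thesis using v.csol_move[OF C' Zl c] by (simp add: sys_diff_t)
qed

lemma \<Phi>_t_lipschitz:
  assumes i: "i < n"
  obtains C where "0 \<le> C" "\<forall>t t'. \<forall>x\<in>{0..l}. near t s0 \<longrightarrow> near t' s0 \<longrightarrow>
    norm (\<Phi> i t' s0 x - \<Phi> i t s0 x) \<le> C * \<bar>t' - t\<bar>"
proof -
  define B where "B = K * norm (\<beta> i)"
  have B0: "0 \<le> B" using K_pos by (simp add: B_def)
  show ?thesis
  proof (rule that[of "K * (s0\<^sup>2 * B * l\<^sup>2)"])
    show "0 \<le> K * (s0\<^sup>2 * B * l\<^sup>2)" using K_pos B0 by simp
    show "\<forall>t t'. \<forall>x\<in>{0..l}. near t s0 \<longrightarrow> near t' s0 \<longrightarrow>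
      norm (\<Phi> i t' s0 x - \<Phi> i t s0 x) \<le> K * (s0\<^sup>2 * B * l\<^sup>2) * \<bar>t' - t\<bar>"
    proof (intro allI ballI impI)
    fix t t' x assume near: "near t s0" "near t' s0" and x: "x \<in> {0..l}"
    obtain C where "volterra (A t s0) l C" using volt[OF near(1)] by blast
    then interpret v: volterra "A t s0" l C .
    let ?f = "\<lambda>x. 0 + ((t' - t) * s0\<^sup>2) *\<^sub>R rot (\<Phi> i t' s0 x) - 0"
    have c: "csol l (A t s0) Z ?f (\<beta> i - \<beta> i) (\<lambda>x. \<Phi> i t' s0 x - \<Phi> i t s0 x) (\<alpha> i t' s0 - \<alpha> i t s0)"
      by (rule v.csol_diff[OF Zl csol_change_t[OF near \<Phi>_csol[OF i near(2)]] \<Phi>_csol[OF i near(1)]])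
    have "norm (?f x) \<le> \<bar>t' - t\<bar> * s0\<^sup>2 * B" if "x \<in> {0..l}" for x
      using \<Phi>_bound[OF i near(2) that] by (auto simp: rot_simps abs_mult B_def intro!: mult_left_mono)
    from csol_bound(2)[OF near(1) c this x]
    show "norm (\<Phi> i t' s0 x - \<Phi> i t s0 x) \<le> K * (s0\<^sup>2 * B * l\<^sup>2) * \<bar>t' - t\<bar>" by (simp add: mult_ac)
    qed
  qed
qed

text \<open>\<open>\<Psi> i t\<close> is the derivative of \<open>t \<mapsto> \<Phi> i t s0\<close>: it solves the bordered problem obtained by
  differentiating the one for \<open>\<Phi>\<close>.\<close>

definition \<Psi> :: "nat \<Rightarrow> real \<Rightarrow> real \<Rightarrow> real \<times> real"
  where "\<Psi> i t = (SOME V. \<exists>b. csol l (A t s0) Z (\<lambda>x. s0\<^sup>2 *\<^sub>R rot (\<Phi> i t s0 x)) 0 V b)"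

lemma \<Psi>_csol:
  assumes i: "i < n" and near: "near t s0"
  shows "\<exists>b. csol l (A t s0) Z (\<lambda>x. s0\<^sup>2 *\<^sub>R rot (\<Phi> i t s0 x)) 0 (\<Psi> i t) b"
proof -
  have c: "continuous_on {0..l} (\<lambda>x. s0\<^sup>2 *\<^sub>R rot (\<Phi> i t s0 x))"
    by (intro continuous_on_scaleR continuous_on_const continuous_on_rot \<Phi>_cont i near)
  have "\<exists>V b. csol l (A t s0) Z (\<lambda>x. s0\<^sup>2 *\<^sub>R rot (\<Phi> i t s0 x)) 0 V b"
    using well_posed_solvable[OF wp continuous_on_dint[OF integrable_continuous_interval[OF c]], of t s0 0] near c
    by (simp add: csol_def)
  then show ?thesis unfolding \<Psi>_def by (rule someI_ex)
qed

lemma \<Psi>_cont: "i < n \<Longrightarrow> near t s0 \<Longrightarrow> continuous_on {0..l} (\<Psi> i t)"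
  using \<Psi>_csol csol_cont by blast

lemma \<Phi>_t_expansion:
  assumes i: "i < n"
  obtains C where "0 \<le> C" "\<forall>t t'. \<forall>x\<in>{0..l}. near t s0 \<longrightarrow> near t' s0 \<longrightarrow>
    norm (\<Phi> i t' s0 x - \<Phi> i t s0 x - (t' - t) *\<^sub>R \<Psi> i t x) \<le> C * (t' - t)\<^sup>2"
proof -
  obtain C where C0: "0 \<le> C" and CA: "\<forall>t t'. \<forall>x\<in>{0..l}. near t s0 \<longrightarrow> near t' s0 \<longrightarrow>
    norm (\<Phi> i t' s0 x - \<Phi> i t s0 x) \<le> C * \<bar>t' - t\<bar>" by (rule \<Phi>_t_lipschitz[OF i])
  note C = C0 CA[rule_format]
  show ?thesis
  proof (rule that[of "K * (s0\<^sup>2 * C * l\<^sup>2)"])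
    show "0 \<le> K * (s0\<^sup>2 * C * l\<^sup>2)" using K_pos C(1) by simp
    show "\<forall>t t'. \<forall>x\<in>{0..l}. near t s0 \<longrightarrow> near t' s0 \<longrightarrow>
      norm (\<Phi> i t' s0 x - \<Phi> i t s0 x - (t' - t) *\<^sub>R \<Psi> i t x) \<le> K * (s0\<^sup>2 * C * l\<^sup>2) * (t' - t)\<^sup>2"
    proof (intro allI ballI impI)
    fix t t' x assume near: "near t s0" "near t' s0" and x: "x \<in> {0..l}"
    obtain C' where "volterra (A t s0) l C'" using volt[OF near(1)] by blast
    then interpret v: volterra "A t s0" l C' .
    obtain b where b: "csol l (A t s0) Z (\<lambda>x. s0\<^sup>2 *\<^sub>R rot (\<Phi> i t s0 x)) 0 (\<Psi> i t) b"
      using \<Psi>_csol[OF i near(1)] by blast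
    let ?f = "\<lambda>x. 0 + ((t' - t) * s0\<^sup>2) *\<^sub>R rot (\<Phi> i t' s0 x) - 0 - (t' - t) *\<^sub>R s0\<^sup>2 *\<^sub>R rot (\<Phi> i t s0 x)"
    have c: "csol l (A t s0) Z ?f (\<beta> i - \<beta> i - (t' - t) *\<^sub>R 0)
        (\<lambda>x. \<Phi> i t' s0 x - \<Phi> i t s0 x - (t' - t) *\<^sub>R \<Psi> i t x) (\<alpha> i t' s0 - \<alpha> i t s0 - (t' - t) *\<^sub>R b)"
      by (rule v.csol_diff[OF Zl v.csol_diff[OF Zl csol_change_t[OF near \<Phi>_csol[OF i near(2)]] \<Phi>_csol[OF i near(1)]]
          v.csol_scale[OF Zl b]])
    have "norm (?f x) \<le> \<bar>t' - t\<bar> * s0\<^sup>2 * (C * \<bar>t' - t\<bar>)" if "x \<in> {0..l}" for x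
    proof -
      have "?f x = ((t' - t) * s0\<^sup>2) *\<^sub>R rot (\<Phi> i t' s0 x - \<Phi> i t s0 x)"
        by (simp add: rot_simps scaleR_diff_right)
      then show ?thesis using C(2)[OF that near] by (auto simp: rot_simps(3) abs_mult intro!: mult_left_mono)
    qed
    from csol_bound(2)[OF near(1) c this x]
    have "norm (\<Phi> i t' s0 x - \<Phi> i t s0 x - (t' - t) *\<^sub>R \<Psi> i t x) \<le> K * (\<bar>t' - t\<bar> * s0\<^sup>2 * (C * \<bar>t' - t\<bar>) * l\<^sup>2 + 0)"
      by (simp only: diff_self scaleR_zero_right diff_0_right norm_zero)
    also have "\<dots> = K * (s0\<^sup>2 * C * l\<^sup>2) * (\<bar>t' - t\<bar> * \<bar>t' - t\<bar>)" by (simp only: add_0_right mult_ac)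
    also have "\<bar>t' - t\<bar> * \<bar>t' - t\<bar> = (t' - t)\<^sup>2" by (simp add: power2_eq_square)
    finally show "norm (\<Phi> i t' s0 x - \<Phi> i t s0 x - (t' - t) *\<^sub>R \<Psi> i t x) \<le> K * (s0\<^sup>2 * C * l\<^sup>2) * (t' - t)\<^sup>2" .
    qed
  qed
qed

lemma \<Psi>_lipschitz:
  assumes i: "i < n"
  obtains C where "0 \<le> C" "\<forall>t. \<forall>x\<in>{0..l}. near t s0 \<longrightarrow> norm (\<Psi> i t x - \<Psi> i t0 x) \<le> C * \<bar>t - t0\<bar>"
proof -
  obtain C where C0: "0 \<le> C" and CA: "\<forall>t t'. \<forall>x\<in>{0..l}. near t s0 \<longrightarrow> near t' s0 \<longrightarrow>
    norm (\<Phi> i t' s0 x - \<Phi> i t s0 x) \<le> C * \<bar>t' - t\<bar>" by (rule \<Phi>_t_lipschitz[OF i])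
  note C = C0 CA[rule_format]
  define B where "B = K * norm (\<beta> i)"
  define B' where "B' = K * (s0\<^sup>2 * B * l\<^sup>2)"
  have B0: "0 \<le> B" "0 \<le> B'" using K_pos by (simp_all add: B_def B'_def)
  obtain C' where "volterra (A t0 s0) l C'" using volt[OF near0] by blast
  then interpret v: volterra "A t0 s0" l C' .
  obtain b0 where b0: "csol l (A t0 s0) Z (\<lambda>x. s0\<^sup>2 *\<^sub>R rot (\<Phi> i t0 s0 x)) 0 (\<Psi> i t0) b0"
    using \<Psi>_csol[OF i near0] by blast
  show ?thesis
  proof (rule that[of "K * ((s0\<^sup>2 * C + s0\<^sup>2 * B') * l\<^sup>2)"])
    show "0 \<le> K * ((s0\<^sup>2 * C + s0\<^sup>2 * B') * l\<^sup>2)" using K_pos C(1) B0 by simp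
    show "\<forall>t. \<forall>x\<in>{0..l}. near t s0 \<longrightarrow>
      norm (\<Psi> i t x - \<Psi> i t0 x) \<le> K * ((s0\<^sup>2 * C + s0\<^sup>2 * B') * l\<^sup>2) * \<bar>t - t0\<bar>"
    proof (intro allI ballI impI)
    fix t x assume near: "near t s0" and x: "x \<in> {0..l}"
    obtain b where b: "csol l (A t s0) Z (\<lambda>x. s0\<^sup>2 *\<^sub>R rot (\<Phi> i t s0 x)) 0 (\<Psi> i t) b"
      using \<Psi>_csol[OF i near] by blast
    have "norm (s0\<^sup>2 *\<^sub>R rot (\<Phi> i t s0 x)) \<le> s0\<^sup>2 * B" if "x \<in> {0..l}" for x
      using \<Phi>_bound[OF i near that] by (auto simp: rot_simps B_def intro!: mult_left_mono)
    from csol_bound(2)[OF near b this] have \<Psi>B: "norm (\<Psi> i t x) \<le> B'" if "x \<in> {0..l}" for x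
      using that by (simp add: B'_def)
    let ?f = "\<lambda>x. s0\<^sup>2 *\<^sub>R rot (\<Phi> i t s0 x) + ((t - t0) * s0\<^sup>2) *\<^sub>R rot (\<Psi> i t x) - s0\<^sup>2 *\<^sub>R rot (\<Phi> i t0 s0 x)"
    have c: "csol l (A t0 s0) Z ?f (0 - 0) (\<lambda>x. \<Psi> i t x - \<Psi> i t0 x) (b - b0)"
      by (rule v.csol_diff[OF Zl csol_change_t[OF near0 near b] b0])
    have "norm (?f x) \<le> s0\<^sup>2 * (C * \<bar>t - t0\<bar>) + \<bar>t - t0\<bar> * s0\<^sup>2 * B'" if "x \<in> {0..l}" for x
    proof -
      have "?f x = s0\<^sup>2 *\<^sub>R rot (\<Phi> i t s0 x - \<Phi> i t0 s0 x) + ((t - t0) * s0\<^sup>2) *\<^sub>R rot (\<Psi> i t x)"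
        by (simp add: rot_simps scaleR_diff_right)
      then have "norm (?f x) \<le> s0\<^sup>2 * norm (\<Phi> i t s0 x - \<Phi> i t0 s0 x) + \<bar>t - t0\<bar> * s0\<^sup>2 * norm (\<Psi> i t x)"
        using norm_triangle_ineq[of "s0\<^sup>2 *\<^sub>R rot (\<Phi> i t s0 x - \<Phi> i t0 s0 x)" "((t - t0) * s0\<^sup>2) *\<^sub>R rot (\<Psi> i t x)"]
        by (simp only: norm_scaleR rot_simps(3) abs_mult) simp
      also have "\<dots> \<le> s0\<^sup>2 * (C * \<bar>t - t0\<bar>) + \<bar>t - t0\<bar> * s0\<^sup>2 * B'"
        using C(2)[OF that near0 near] \<Psi>B[OF that] by (intro add_mono mult_left_mono) auto
      finally show ?thesis .
    qed
    from csol_bound(2)[OF near0 c this x]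
    show "norm (\<Psi> i t x - \<Psi> i t0 x) \<le> K * ((s0\<^sup>2 * C + s0\<^sup>2 * B') * l\<^sup>2) * \<bar>t - t0\<bar>" by (simp add: algebra_simps)
    qed
  qed
qed

lemma M_t:
  assumes "i < n" "j < n" "near t s0"
  shows "M i j t s0 = - ((t - t0) * s0\<^sup>2) * pairing l (\<Phi> i t s0) (y j)"
  using M_formula[OF assms] by (simp add: algebra_simps)

lemma pairing_\<Phi>_derivative:
  assumes i: "i < n" and j: "j < n" and t: "\<bar>t - t0\<bar> < \<epsilon>"
  shows "((\<lambda>t. pairing l (\<Phi> i t s0) (y j)) has_real_derivative pairing l (\<Psi> i t) (y j)) (at t)"
proof -
  obtain c where c0: "0 \<le> c" and cA: "\<forall>u \<kappa>. continuous_on {0..l} u \<longrightarrow> (\<forall>x\<in>{0..l}. norm (u x) \<le> \<kappa>) \<longrightarrow>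
    \<bar>pairing l u (y j)\<bar> \<le> c * \<kappa>" by (rule pairing_bound[OF yc[OF j] l])
  note c = c0 cA[rule_format]
  obtain C where C0: "0 \<le> C" and CA: "\<forall>t t'. \<forall>x\<in>{0..l}. near t s0 \<longrightarrow> near t' s0 \<longrightarrow>
    norm (\<Phi> i t' s0 x - \<Phi> i t s0 x - (t' - t) *\<^sub>R \<Psi> i t x) \<le> C * (t' - t)\<^sup>2" by (rule \<Phi>_t_expansion[OF i])
  note C = C0 CA[rule_format]
  show ?thesis
  proof (rule has_real_derivative_quadratic[of "\<epsilon> - \<bar>t - t0\<bar>"])
    show "0 < \<epsilon> - \<bar>t - t0\<bar>" using t by simp
    fix t' assume t': "\<bar>t' - t\<bar> \<le> \<epsilon> - \<bar>t - t0\<bar>"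
    have near: "near t s0" "near t' s0" using t t' \<epsilon> by auto
    note cont = \<Phi>_cont[OF i near(1)] \<Phi>_cont[OF i near(2)] \<Psi>_cont[OF i near(1)] yc[OF j]
    have cd: "continuous_on {0..l} (\<lambda>x. \<Phi> i t' s0 x - \<Phi> i t s0 x)" "continuous_on {0..l} (\<lambda>x. (t' - t) *\<^sub>R \<Psi> i t x)"
      by (intro continuous_intros cont)+
    have "pairing l (\<Phi> i t' s0) (y j) - pairing l (\<Phi> i t s0) (y j) - (t' - t) * pairing l (\<Psi> i t) (y j)
        = pairing l (\<lambda>x. \<Phi> i t' s0 x - \<Phi> i t s0 x - (t' - t) *\<^sub>R \<Psi> i t x) (y j)"
      using pairing_diff[OF cd cont(4)] pairing_diff[OF cont(2,1,4)] by (simp add: pairing_scale)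
    also have "\<bar>\<dots>\<bar> \<le> c * (C * (t' - t)\<^sup>2)"
      by (intro c(2) C(2) near continuous_on_diff cd)
    finally show "\<bar>pairing l (\<Phi> i t' s0) (y j) - pairing l (\<Phi> i t s0) (y j) - (t' - t) * pairing l (\<Psi> i t) (y j)\<bar>
        \<le> c * C * (t' - t)\<^sup>2" by (simp add: mult.assoc)
  qed
qed

definition dM :: "nat \<Rightarrow> nat \<Rightarrow> real \<Rightarrow> real"
  where "dM i j t = - (s0\<^sup>2 * (pairing l (\<Phi> i t s0) (y j) + (t - t0) * pairing l (\<Psi> i t) (y j)))"

text \<open>For \<open>s = s0\<close> the formula for \<open>M\<close> has the factor \<open>t - t0\<close>, and the other factor is continuously
  differentiable.\<close>

lemma M_derivative_t:
  assumes i: "i < n" and j: "j < n" and t: "\<bar>t - t0\<bar> < \<epsilon>"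
  shows "((\<lambda>t. M i j t s0) has_real_derivative dM i j t) (at t)"
proof -
  have "((\<lambda>t. - ((t - t0) * s0\<^sup>2) * pairing l (\<Phi> i t s0) (y j)) has_real_derivative dM i j t) (at t)"
  proof -
    have "((\<lambda>t. - ((t - t0) * s0\<^sup>2)) has_real_derivative - s0\<^sup>2) (at t)"
      by (auto intro!: derivative_eq_intros)
    from DERIV_mult[OF this pairing_\<Phi>_derivative[OF assms]]
    show ?thesis by (simp add: dM_def algebra_simps)
  qed
  moreover have "open {t. \<bar>t - t0\<bar> < \<epsilon>}"
    by (intro open_Collect_less continuous_intros)
  ultimately show ?thesis
    by (rule has_field_derivative_transform_within_open[of _ _ _ "{t. \<bar>t - t0\<bar> < \<epsilon>}"]) (use t \<epsilon> M_t[OF i j] in auto)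
qed

lemma dM_base: "i < n \<Longrightarrow> dM i j t0 = - (s0\<^sup>2 * pairing l (y i) (y j))"
  using pairing_cong[of l "\<Phi> i t0 s0" "y i" "y j"] \<Phi>_base by (simp add: dM_def)

text \<open>Both terms of \<open>dM\<close> contribute the same amount, whence the factor \<open>2\<close>. The second one needs only
  continuity of \<open>\<Psi>\<close> at \<open>t0\<close>.\<close>

lemma dM_derivative:
  assumes i: "i < n" and j: "j < n"
  shows "(dM i j has_real_derivative - 2 * s0\<^sup>2 * pairing l (\<Psi> i t0) (y j)) (at t0)"
proof -
  obtain c where c0: "0 \<le> c" and cA: "\<forall>u \<kappa>. continuous_on {0..l} u \<longrightarrow> (\<forall>x\<in>{0..l}. norm (u x) \<le> \<kappa>) \<longrightarrow>
    \<bar>pairing l u (y j)\<bar> \<le> c * \<kappa>" by (rule pairing_bound[OF yc[OF j] l])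
  note c = c0 cA[rule_format]
  obtain C where C0: "0 \<le> C" and CA: "\<forall>t. \<forall>x\<in>{0..l}. near t s0 \<longrightarrow> norm (\<Psi> i t x - \<Psi> i t0 x) \<le> C * \<bar>t - t0\<bar>"
    by (rule \<Psi>_lipschitz[OF i])
  note C = C0 CA[rule_format]
  have "((\<lambda>t. (t - t0) * pairing l (\<Psi> i t) (y j)) has_real_derivative pairing l (\<Psi> i t0) (y j)) (at t0)"
  proof (rule has_real_derivative_quadratic[OF \<epsilon>(1)])
    fix t assume "\<bar>t - t0\<bar> \<le> \<epsilon>"
    then have near: "near t s0" using \<epsilon> by simp
    have "\<bar>pairing l (\<lambda>x. \<Psi> i t x - \<Psi> i t0 x) (y j)\<bar> \<le> c * (C * \<bar>t - t0\<bar>)"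
      by (intro c(2) C(2) near continuous_on_diff \<Psi>_cont i near0)
    then have *: "\<bar>pairing l (\<Psi> i t) (y j) - pairing l (\<Psi> i t0) (y j)\<bar> \<le> c * (C * \<bar>t - t0\<bar>)"
      by (simp only: pairing_diff[OF \<Psi>_cont[OF i near] \<Psi>_cont[OF i near0] yc[OF j]])
    have "(t - t0) * pairing l (\<Psi> i t) (y j) - (t0 - t0) * pairing l (\<Psi> i t0) (y j) - (t - t0) * pairing l (\<Psi> i t0) (y j)
        = (t - t0) * (pairing l (\<Psi> i t) (y j) - pairing l (\<Psi> i t0) (y j))" by (simp add: algebra_simps)
    also have "\<bar>\<dots>\<bar> \<le> \<bar>t - t0\<bar> * (c * (C * \<bar>t - t0\<bar>))"
      unfolding abs_mult by (intro mult_left_mono *) simp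
    also have "\<dots> = c * C * (\<bar>t - t0\<bar> * \<bar>t - t0\<bar>)" by (simp only: mult_ac)
    also have "\<bar>t - t0\<bar> * \<bar>t - t0\<bar> = (t - t0)\<^sup>2" by (simp add: power2_eq_square)
    finally show "\<bar>(t - t0) * pairing l (\<Psi> i t) (y j) - (t0 - t0) * pairing l (\<Psi> i t0) (y j) - (t - t0) * pairing l (\<Psi> i t0) (y j)\<bar>
      \<le> c * C * (t - t0)\<^sup>2" .
  qed
  then have "((\<lambda>t. - (s0\<^sup>2 * (pairing l (\<Phi> i t s0) (y j) + (t - t0) * pairing l (\<Psi> i t) (y j)))) has_real_derivative
      - (s0\<^sup>2 * (pairing l (\<Psi> i t0) (y j) + pairing l (\<Psi> i t0) (y j)))) (at t0)"
    using pairing_\<Phi>_derivative[OF i j, of t0] \<epsilon> by (intro DERIV_minus DERIV_cmult DERIV_add) auto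
  then show ?thesis by (simp add: dM_def[abs_def] algebra_simps)
qed

text \<open>The value \<open>\<Psi> i t0 l\<close> lies in the span of the fluxes by the bordered condition, and its products
  with them are the pairings of the kernel functions by the Green identity. If those vanish, \<open>\<Psi> i t0\<close>
  satisfies the Dirichlet condition and is, up to a factor, the generalised eigenfunction.\<close>

lemma \<Psi>_boundary:
  assumes i: "i < n" and 0: "\<And>j. j < n \<Longrightarrow> pairing l (y i) (y j) = 0"
  obtains b where "csol l (A t0 s0) (\<lambda>_. 0) (\<lambda>x. s0\<^sup>2 *\<^sub>R rot (y i x)) 0 (\<Psi> i t0) b"
proof -
  obtain b where "csol l (A t0 s0) Z (\<lambda>x. s0\<^sup>2 *\<^sub>R rot (\<Phi> i t0 s0 x)) 0 (\<Psi> i t0) b"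
    using \<Psi>_csol[OF i near0] by blast
  then have b: "csol l (A t0 s0) Z (\<lambda>x. s0\<^sup>2 *\<^sub>R rot (y i x)) 0 (\<Psi> i t0) b"
    by (rule csol_cong) (simp_all add: \<Phi>_base[OF i])
  have orth: "inner (\<beta> j) (\<Psi> i t0 l) = 0" if j: "j < n" for j
  proof -
    have "inner (\<beta> j) (\<Psi> i t0 l) = integral {0..l} (\<lambda>x. s0\<^sup>2 * (fst (y i x) * snd (y j x) + snd (y i x) * fst (y j x)))"
      unfolding inner_\<beta>_csol[OF b j] by (intro integral_cong) (simp add: rot_def algebra_simps)
    also have "\<dots> = s0\<^sup>2 * pairing l (y i) (y j)" by (simp add: pairing_def)
    finally show ?thesis using 0[OF j] by simp
  qed
  obtain c where c: "Z b = (\<Sum>k<n. c k *\<^sub>R \<beta> k)" using Zspan by blast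
  have e: "\<Psi> i t0 l = - Z b" using b by (simp add: csol_def bsol_def eq_neg_iff_add_eq_0)
  have "inner (\<Psi> i t0 l) (\<Psi> i t0 l) = inner (- Z b) (\<Psi> i t0 l)"
    by (rule arg_cong[OF e, of "\<lambda>v. inner v (\<Psi> i t0 l)"])
  also have "\<dots> = - (\<Sum>k<n. c k * inner (\<beta> k) (\<Psi> i t0 l))"
    by (simp add: c inner_sum_left)
  finally have "inner (\<Psi> i t0 l) (\<Psi> i t0 l) = - (\<Sum>k<n. c k * inner (\<beta> k) (\<Psi> i t0 l))" .
  then have "\<Psi> i t0 l = 0" using orth by simp
  then show ?thesis using b by (intro that[of b]) (simp add: csol_def bsol_def)
qed

text \<open>The change of the coefficient is of first order in \<open>s - s0\<close>, so replacing \<open>\<Phi> i t0 s\<close> by \<open>y i\<close> in the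
  formula for \<open>M\<close> costs a quadratic error. No derivative of \<open>\<Phi>\<close> in \<open>s\<close> is involved.\<close>

lemma M_derivative_s:
  assumes i: "i < n" and j: "j < n"
  shows "((\<lambda>s. M i j t0 s) has_real_derivative
    integral {0..l} (\<lambda>x. dh x * (snd (y i x) * snd (y j x))) - integral {0..l} (\<lambda>x. dg x * (fst (y i x) * fst (y j x)))
    - 2 * s0 * t0 * pairing l (y i) (y j)) (at s0)"
proof -
  let ?G = "\<lambda>s. integral {0..l} (\<lambda>x. scaled g s x * (fst (y i x) * fst (y j x)))"
  let ?H = "\<lambda>s. integral {0..l} (\<lambda>x. scaled h s x * (snd (y i x) * snd (y j x)))"
  let ?p = "pairing l (y i) (y j)"
  \<comment> \<open>\<open>F\<close> is the formula for \<open>M\<close> with \<open>y i\<close> in place of \<open>\<Phi> i t0 s\<close>.\<close>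
  define F where "F s = ?H s - ?H s0 - (?G s - ?G s0) - (s\<^sup>2 * t0 - s0\<^sup>2 * t0) * ?p" for s
  note yi = yc[OF i] and yj = yc[OF j]
  have vc: "continuous_on {0..l} (\<lambda>x. fst (y i x) * fst (y j x))" "continuous_on {0..l} (\<lambda>x. snd (y i x) * snd (y j x))"
    by (intro continuous_intros yi yj)+
  have F': "(F has_real_derivative integral {0..l} (\<lambda>x. dh x * (snd (y i x) * snd (y j x)))
      - integral {0..l} (\<lambda>x. dg x * (fst (y i x) * fst (y j x))) - 2 * s0 * t0 * ?p) (at s0)"
  proof -
    have "((\<lambda>s. (s\<^sup>2 * t0 - s0\<^sup>2 * t0) * ?p) has_real_derivative 2 * s0 * t0 * ?p) (at s0)"
      by (auto intro!: derivative_eq_intros)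
    from DERIV_diff[OF DERIV_diff[OF DERIV_diff[OF derh[OF vc(2)] DERIV_const]
          DERIV_diff[OF derg[OF vc(1)] DERIV_const]] this]
    show ?thesis unfolding F_def by simp
  qed
  obtain c where c0: "0 \<le> c" and cA: "\<forall>u \<kappa>. continuous_on {0..l} u \<longrightarrow> (\<forall>x\<in>{0..l}. norm (u x) \<le> \<kappa>) \<longrightarrow>
    \<bar>pairing l u (y j)\<bar> \<le> c * \<kappa>" by (rule pairing_bound[OF yj l])
  note c = c0 cA[rule_format]
  obtain C where C0: "0 \<le> C" and CA: "\<forall>t s. \<forall>x\<in>{0..l}. near t s \<longrightarrow> norm (\<Phi> i t s x - y i x) \<le> C * (\<bar>t - t0\<bar> + \<bar>s - s0\<bar>)"
    by (rule \<Phi>_lipschitz[OF i])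
  note C = C0 CA[rule_format]
  have "bounded (y j ` {0..l})" using yj by (intro compact_imp_bounded compact_continuous_image) auto
  then obtain B where B: "\<And>x. x \<in> {0..l} \<Longrightarrow> norm (y j x) \<le> B" unfolding bounded_iff by (metis imageI)
  define R where "R = (\<bar>s0\<bar> + \<delta>)\<^sup>2 + 2 * \<bar>t0\<bar> * (\<bar>s0\<bar> + \<delta>)"
  have R0: "0 \<le> R" using \<delta> by (simp add: R_def)
  have "((\<lambda>s. M i j t0 s - F s) has_real_derivative 0) (at s0)"
  proof (rule has_real_derivative_quadratic[OF \<epsilon>(1)])
    fix s assume "\<bar>s - s0\<bar> \<le> \<epsilon>"
    then have near: "near t0 s" and s: "\<bar>s - s0\<bar> \<le> \<delta>" "\<bar>s0 - s0\<bar> \<le> \<delta>" using \<epsilon> by auto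
    let ?d = "\<bar>s - s0\<bar>"
    let ?\<mu> = "s\<^sup>2 * t0 - s0\<^sup>2 * t0"
    define E where "E x = \<Phi> i t0 s x - y i x" for x
    have Ec: "continuous_on {0..l} E" unfolding E_def by (intro continuous_intros \<Phi>_cont i near yi)
    have EB: "norm (E x) \<le> C * ?d" if "x \<in> {0..l}" for x using C(2)[OF that near] by (simp add: E_def)
    define I where "I U x = (scaled g s x - scaled g s0 x) * (fst (U x) * fst (y j x))
      + (scaled h s0 x - scaled h s x) * (snd (U x) * snd (y j x))" for U :: "real \<Rightarrow> real \<times> real" and x
    have Ic: "continuous_on {0..l} (I U)" if "continuous_on {0..l} U" for U
      unfolding I_def by (intro continuous_intros contg conth s that yj)
    note Ii = integrable_continuous_interval[OF Ic]
    have Is: "integral {0..l} (I (\<Phi> i t0 s)) = integral {0..l} (I (y i)) + integral {0..l} (I E)"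
    proof -
      have "integral {0..l} (I (\<Phi> i t0 s)) = integral {0..l} (\<lambda>x. I (y i) x + I E x)"
        by (intro integral_cong) (simp add: I_def E_def algebra_simps)
      then show ?thesis by (simp add: integral_add Ii yi Ec)
    qed
    have Iy: "integral {0..l} (I (y i)) = (?G s - ?G s0) - (?H s - ?H s0)"
    proof -
      have gi: "(\<lambda>x. scaled g s' x * (fst (y i x) * fst (y j x))) integrable_on {0..l}"
           "(\<lambda>x. scaled h s' x * (snd (y i x) * snd (y j x))) integrable_on {0..l}" if "\<bar>s' - s0\<bar> \<le> \<delta>" for s'
        by (intro integrable_continuous_interval continuous_on_mult contg conth that vc)+
      have "integral {0..l} (I (y i)) = integral {0..l} (\<lambda>x.
          (scaled g s x * (fst (y i x) * fst (y j x)) - scaled g s0 x * (fst (y i x) * fst (y j x)))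
        - (scaled h s x * (snd (y i x) * snd (y j x)) - scaled h s0 x * (snd (y i x) * snd (y j x))))"
        by (intro integral_cong) (simp add: I_def algebra_simps)
      also have "\<dots> = (?G s - ?G s0) - (?H s - ?H s0)"
        by (simp add: integral_diff gi[OF s(1)] gi[OF s(2)] integrable_diff)
      finally show ?thesis .
    qed
    have "M i j t0 s = - integral {0..l} (I (\<Phi> i t0 s)) - ?\<mu> * pairing l (\<Phi> i t0 s) (y j)"
      using M_formula[OF i j near] by (simp add: I_def[abs_def])
    moreover have "pairing l (\<Phi> i t0 s) (y j) = ?p + pairing l E (y j)"
      using pairing_diff[OF \<Phi>_cont[OF i near] yi yj] by (simp add: E_def[abs_def])
    ultimately have MF: "M i j t0 s - F s = - integral {0..l} (I E) - ?\<mu> * pairing l E (y j)"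
      by (simp add: F_def Is Iy algebra_simps)
    have "norm (integral {0..l} (I E)) \<le> integral {0..l} (\<lambda>x. 2 * (L * ?d) * (C * ?d) * B)"
    proof (intro integral_norm_bound_integral Ii Ec)
      fix x assume x: "x \<in> {0..l}"
      have "\<bar>scaled h s0 x - scaled h s x\<bar> \<le> L * ?d" using liph[OF s(1) x] by (simp add: abs_minus_commute)
      then show "norm (I E x) \<le> 2 * (L * ?d) * (C * ?d) * B"
        unfolding I_def real_norm_def
        by (intro abs_weighted_le[of _ _ _ "E x" _ "y j x"] lipg s x EB B abs_components)
    qed auto
    then have 1: "\<bar>integral {0..l} (I E)\<bar> \<le> 2 * (L * ?d) * (C * ?d) * B * l" using l by (simp add: mult_ac)
    have 2: "\<bar>?\<mu>\<bar> * \<bar>pairing l E (y j)\<bar> \<le> (R * ?d) * (c * (C * ?d))"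
      using spectral_shift_lipschitz[OF s(1), of t0] c(2)[OF Ec EB] R0 by (intro mult_mono) (auto simp: R_def)
    have "\<bar>M i j t0 s - F s\<bar> \<le> 2 * (L * ?d) * (C * ?d) * B * l + (R * ?d) * (c * (C * ?d))"
      unfolding MF using 1 2 abs_triangle_ineq4[of "- integral {0..l} (I E)" "?\<mu> * pairing l E (y j)"]
      by (simp add: abs_mult)
    also have "\<dots> = (2 * L * C * B * l + R * c * C) * (?d * ?d)" by (simp add: algebra_simps)
    also have "?d * ?d = (s - s0)\<^sup>2" by (simp add: power2_eq_square)
    finally show "\<bar>M i j t0 s - F s - (M i j t0 s0 - F s0) - (s - s0) * 0\<bar> \<le> (2 * L * C * B * l + R * c * C) * (s - s0)\<^sup>2"
      using M_base[OF i j] by (simp add: F_def)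
  qed
  from DERIV_add[OF this F'] show ?thesis by simp
qed

end

section \<open>The scaled potentials and the real kernel\<close>

text \<open>The point \<open>s * x\<close> stays in the interval where \<open>g\<close> is given, because \<open>s0 * l < l'\<close> in either case.
  The one-sided derivative of \<open>g\<close> at \<open>0\<close> may differ from \<open>deriv g 0\<close>, but it only occurs with the factor
  \<open>x = 0\<close>.\<close>

lemma C2_scaled_family:
  assumes l: "0 < l" and l': "l \<le> l'" "s0 = 1 \<Longrightarrow> l < l'" and C2: "C2_on 0 l' g" and s0: "0 < s0" "s0 \<le> 1"
  obtains \<delta> L where "0 < \<delta>" "0 \<le> L"
    "\<forall>s. \<bar>s - s0\<bar> \<le> \<delta> \<longrightarrow> continuous_on {0..l} (scaled g s)"
    "\<forall>s. \<forall>x\<in>{0..l}. \<bar>s - s0\<bar> \<le> \<delta> \<longrightarrow> \<bar>scaled g s x - scaled g s0 x\<bar> \<le> L * \<bar>s - s0\<bar>"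
    "continuous_on {0..l} (\<lambda>x. 2 * s0 * g (s0 * x) + s0\<^sup>2 * x * deriv g (s0 * x))"
    "\<forall>v. continuous_on {0..l} v \<longrightarrow> ((\<lambda>s. integral {0..l} (\<lambda>x. scaled g s x * v x)) has_real_derivative
        integral {0..l} (\<lambda>x. (2 * s0 * g (s0 * x) + s0\<^sup>2 * x * deriv g (s0 * x)) * v x)) (at s0)"
proof -
  obtain g' g'' where g': "\<And>x. x \<in> {0..l'} \<Longrightarrow> (g has_real_derivative g' x) (at x within {0..l'})"
    and g'': "\<And>x. x \<in> {0..l'} \<Longrightarrow> (g' has_real_derivative g'' x) (at x within {0..l'})"
    using C2 unfolding C2_on_def by blast
  have gc: "continuous_on {0..l'} g" "continuous_on {0..l'} g'"
    using DERIV_continuous_on[OF g'] DERIV_continuous_on[OF g''] by blast+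
  have sl: "s0 * l < l'"
  proof (cases "s0 = 1")
    case False
    then have "s0 * l < 1 * l" using s0 l by (intro mult_strict_right_mono) auto
    then show ?thesis using l' by simp
  qed (use l' in simp)
  define \<delta> where "\<delta> = min (s0 / 2) ((l' - s0 * l) / l)"
  have \<delta>: "0 < \<delta>" using s0 sl l by (simp add: \<delta>_def)
  define I where "I = {s0 - \<delta>..s0 + \<delta>}"
  have I: "s \<in> I \<longleftrightarrow> \<bar>s - s0\<bar> \<le> \<delta>" for s by (auto simp: I_def)
  have s0I: "s0 \<in> I" using \<delta> by (simp add: I)
  have into: "s * x \<in> {0..l'}" if "s \<in> I" "x \<in> {0..l}" for s x
  proof -
    have s: "0 \<le> s" "s \<le> s0 + (l' - s0 * l) / l" using that(1) s0 by (auto simp: I_def \<delta>_def)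
    have "s * x \<le> s * l" using that s by (intro mult_left_mono) auto
    also have "\<dots> \<le> (s0 + (l' - s0 * l) / l) * l" using s l by (intro mult_right_mono) auto
    also have "\<dots> = l'" using l by (simp add: field_simps)
    finally show ?thesis using s that by simp
  qed
  define Q where "Q s x = 2 * s * g (s * x) + s\<^sup>2 * (g' (s * x) * x)" for s x
  have dQ: "((\<lambda>s. scaled g s x) has_real_derivative Q s x) (at s within I)" if "s \<in> I" "x \<in> {0..l}" for s x
  proof -
    have "(g has_real_derivative g' (s * x)) (at (s * x) within (\<lambda>s. s * x) ` I)"
      by (rule DERIV_subset[OF g'[OF into[OF that]]]) (use into that in auto)
    moreover have "((\<lambda>s. s * x) has_real_derivative x) (at s within I)"
      by (auto intro!: derivative_eq_intros)
    ultimately have "((\<lambda>s. g (s * x)) has_real_derivative g' (s * x) * x) (at s within I)"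
      using DERIV_image_chain[of g "g' (s * x)" "\<lambda>s. s * x" s I x] by (simp add: comp_def)
    then show ?thesis unfolding scaled_def Q_def
      by (auto intro!: derivative_eq_intros simp: algebra_simps)
  qed
  have comp: "continuous_on (I \<times> {0..l}) (\<lambda>p. k (fst p * snd p))" if "continuous_on {0..l'} k" for k :: "real \<Rightarrow> real"
    using into by (intro continuous_on_compose2[OF that] continuous_intros) auto
  have Qc: "continuous_on (I \<times> {0..l}) (\<lambda>(s, x). Q s x)"
    unfolding Q_def case_prod_beta by (intro continuous_intros comp gc)
  have "compact (I \<times> {0..l})" unfolding I_def by (intro compact_Times compact_Icc)
  from compact_imp_bounded[OF compact_continuous_image[OF Qc this]]
  obtain L where L: "\<And>p. p \<in> I \<times> {0..l} \<Longrightarrow> norm (case p of (s, x) \<Rightarrow> Q s x) \<le> L"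
    unfolding bounded_iff by (metis imageI)
  have QL: "norm (Q s x) \<le> L" if "s \<in> I" "x \<in> {0..l}" for s x using L[of "(s, x)"] that by simp
  have L0: "0 \<le> L" using order_trans[OF norm_ge_zero QL[OF s0I, of 0]] l by simp
  have Qs: "continuous_on {0..l} (Q s)" "continuous_on {0..l} (scaled g s)" if "s \<in> I" for s
  proof -
    have "continuous_on {0..l} (\<lambda>x. case (s, x) of (s, x) \<Rightarrow> Q s x)"
      by (rule continuous_on_compose2[OF Qc])
        (use that in \<open>auto intro!: continuous_on_Pair continuous_on_const continuous_on_id\<close>)
    then show "continuous_on {0..l} (Q s)" by simp
    show "continuous_on {0..l} (scaled g s)" unfolding scaled_def
      using into[OF that] by (intro continuous_intros continuous_on_compose2[OF gc(1)]) auto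
  qed
  have Qderiv: "Q s0 x = 2 * s0 * g (s0 * x) + s0\<^sup>2 * x * deriv g (s0 * x)" if x: "x \<in> {0..l}" for x
  proof (cases "x = 0")
    case False
    have "s0 * x \<le> s0 * l" using x s0 by (intro mult_left_mono) auto
    then have "s0 * x < l'" using sl by linarith
    then have "s0 * x \<in> {0<..<l'}" using x False s0 by auto
    then have "(g has_real_derivative g' (s0 * x)) (at (s0 * x))"
      using g'[of "s0 * x"] by (auto simp: at_within_Icc_at)
    then show ?thesis by (simp add: Q_def DERIV_imp_deriv)
  qed (simp add: Q_def)
  show ?thesis
  proof (rule that[OF \<delta> L0])
    show "\<forall>s. \<bar>s - s0\<bar> \<le> \<delta> \<longrightarrow> continuous_on {0..l} (scaled g s)" using Qs(2) by (simp add: I)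
    show "\<forall>s. \<forall>x\<in>{0..l}. \<bar>s - s0\<bar> \<le> \<delta> \<longrightarrow> \<bar>scaled g s x - scaled g s0 x\<bar> \<le> L * \<bar>s - s0\<bar>"
    proof (intro allI ballI impI)
      fix s x assume x: "x \<in> {0..l}" and s: "\<bar>s - s0\<bar> \<le> \<delta>"
      have "norm (scaled g s x - scaled g s0 x) \<le> L * norm (s - s0)"
      proof (rule field_differentiable_bound[of I])
        show "convex I" by (simp add: I_def)
        show "\<And>s. s \<in> I \<Longrightarrow> ((\<lambda>s. scaled g s x) has_real_derivative Q s x) (at s within I)"
          by (rule dQ[OF _ x])
        show "\<And>s. s \<in> I \<Longrightarrow> norm (Q s x) \<le> L" by (rule QL[OF _ x])
      qed (use s s0I in \<open>simp_all add: I\<close>)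
      then show "\<bar>scaled g s x - scaled g s0 x\<bar> \<le> L * \<bar>s - s0\<bar>" by simp
    qed
    show "continuous_on {0..l} (\<lambda>x. 2 * s0 * g (s0 * x) + s0\<^sup>2 * x * deriv g (s0 * x))"
      by (rule continuous_on_eq[OF Qs(1)[OF s0I] Qderiv])
    show "\<forall>v. continuous_on {0..l} v \<longrightarrow> ((\<lambda>s. integral {0..l} (\<lambda>x. scaled g s x * v x)) has_real_derivative
        integral {0..l} (\<lambda>x. (2 * s0 * g (s0 * x) + s0\<^sup>2 * x * deriv g (s0 * x)) * v x)) (at s0)"
    proof (intro allI impI)
      fix v :: "real \<Rightarrow> real" assume v: "continuous_on {0..l} v"
      have "((\<lambda>s. integral (cbox 0 l) (\<lambda>x. scaled g s x * v x)) has_field_derivative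
        integral (cbox 0 l) (\<lambda>x. Q s0 x * v x)) (at s0 within I)"
      proof (rule leibniz_rule_field_derivative[OF _ _ _ s0I])
        show "((\<lambda>s. scaled g s x * v x) has_field_derivative Q s x * v x) (at s within I)"
          if "s \<in> I" "x \<in> cbox 0 l" for s x
          using dQ[of s x] that by (intro DERIV_cmult_right) auto
        show "(\<lambda>x. scaled g s x * v x) integrable_on cbox 0 l" if "s \<in> I" for s
          using Qs(2)[OF that] v by (auto intro!: integrable_continuous_interval continuous_intros)
        have "continuous_on (I \<times> cbox 0 l) (\<lambda>p. v (snd p))"
          by (rule continuous_on_compose2[OF v continuous_on_snd[OF continuous_on_id]]) auto
        then show "continuous_on (I \<times> cbox 0 l) (\<lambda>(s, x). Q s x * v x)"
          using Qc unfolding case_prod_beta by (auto intro!: continuous_intros)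
        show "convex I" by (simp add: I_def)
      qed
      moreover have "at s0 within I = at s0" using \<delta> by (simp add: I_def at_within_Icc_at)
      moreover have "integral {0..l} (\<lambda>x. Q s0 x * v x)
          = integral {0..l} (\<lambda>x. (2 * s0 * g (s0 * x) + s0\<^sup>2 * x * deriv g (s0 * x)) * v x)"
        by (intro integral_cong) (simp add: Qderiv)
      ultimately show "((\<lambda>s. integral {0..l} (\<lambda>x. scaled g s x * v x)) has_real_derivative
        integral {0..l} (\<lambda>x. (2 * s0 * g (s0 * x) + s0\<^sup>2 * x * deriv g (s0 * x)) * v x)) (at s0)"
        by simp
    qed
  qed
qed

lemma (in volterra) bsol_zero_slope:
  assumes b: "bsol l A Z (\<lambda>x. 0) \<zeta> U b" and U0: "\<And>x. x \<in> {0..l} \<Longrightarrow> U x = 0"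
  shows "b = 0"
proof -
  have "dint (\<lambda>x. A x (U x)) l = dint (\<lambda>x. 0) l"
    using U0 lin by (intro dint_cong) (auto intro: linear_0)
  moreover have "\<forall>x\<in>{0..l}. U x = (x *\<^sub>R b + 0) + dint (\<lambda>x. A x (U x)) x"
    using b unfolding bsol_def sol_def by blast
  then have "U l = (l *\<^sub>R b + 0) + dint (\<lambda>x. A x (U x)) l" by (rule bspec) (use l_pos in simp)
  ultimately show ?thesis using U0[of l] l_pos by simp
qed

lemma (in volterra) bsol_slope_zero:
  assumes b: "bsol l A Z (\<lambda>x. 0) \<zeta> U 0" and x: "x \<in> {0..l}"
  shows "U x = 0"
proof -
  have "sol l A (\<lambda>x. x *\<^sub>R 0 + 0) U" using b by (simp add: bsol_def)
  from sol_bound[OF this, of 0] x show ?thesis by simp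
qed

lemma linear_const_zero: "linear (\<lambda>_ :: 'a::real_vector. 0 :: 'b::real_vector)"
  by (rule linear_zero)

text \<open>The real parts of continuous representatives of the \<open>u i\<close> form a basis of the real solutions of the
  Dirichlet problem: linear relations over the reals and over the complex numbers are equivalent for
  real functions.\<close>

lemma kernel_real_basis:
  fixes l m s :: real and g h :: "real \<Rightarrow> real" and u :: "nat \<Rightarrow> vfun"
  assumes l: "0 < l" and gc: "continuous_on {0..l} (scaled g s)" and hc: "continuous_on {0..l} (scaled h s)"
    and basis: "is_basis l (kernel l (domN l) (shift (Nop l g h s) (of_real m))) n u"
    and u_real: "\<And>i. i < n \<Longrightarrow> real_valued l (u i)"
  obtains y a where
    "\<forall>i<n. bsol l (coef (scaled g s) (scaled h s) m) (\<lambda>_. 0) (\<lambda>x. 0) 0 (y i) (a i :: real \<times> real)"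
    "\<forall>c. (\<Sum>i<n. c i *\<^sub>R a i) = 0 \<longrightarrow> (\<forall>i<n. c i = 0)"
    "\<forall>U b. bsol l (coef (scaled g s) (scaled h s) m) (\<lambda>_. 0) (\<lambda>x. 0) 0 U b \<longrightarrow>
      (\<exists>c. b = (\<Sum>i<n. c i *\<^sub>R a i) \<and> (\<forall>x\<in>{0..l}. U x = (\<Sum>i<n. c i *\<^sub>R y i x)))"
    "\<forall>i<n. AE x in lebI l. fst (u i) x = of_real (fst (y i x)) \<and> snd (u i) x = of_real (snd (y i x))"
proof -
  let ?A = "coef (scaled g s) (scaled h s) m"
  let ?z = "(\<lambda>x. 0, \<lambda>x. 0) :: vfun"
  have sc: "scaled g s = (\<lambda>x. s\<^sup>2 * g (s * x))" "scaled h s = (\<lambda>x. s\<^sup>2 * h (s * x))"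
    by (simp_all add: fun_eq_iff scaled_def)
  obtain C where "volterra (?A :: real \<Rightarrow> real \<times> real \<Rightarrow> _) l C" by (rule volterra_coef[OF l gc hc])
  then interpret v: volterra "?A :: real \<Rightarrow> real \<times> real \<Rightarrow> _" l C .
  note Z = linear_const_zero[where 'a = "real \<times> real" and 'b = "real \<times> real"]
  define Pr where "Pr i p \<longleftrightarrow> bsol l ?A (\<lambda>_. 0) (\<lambda>x. 0) 0 (fst p) (snd p :: real \<times> real) \<and>
      (AE x in lebI l. fst (u i) x = of_real (fst (fst p x)) \<and> snd (u i) x = of_real (snd (fst p x)))" for i p
  have Pr: "\<exists>p. Pr i p" if i: "i < n" for i
  proof -
    have ui: "u i \<in> domN l" "aeq l (shift (Nop l g h s) (of_real m) (u i)) ?z"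
      using basis i by (auto simp: is_basis_def kernel_def)
    obtain U b where U: "bsol l ?A (\<lambda>_. 0) (dint (source ?z)) 0 U b"
      and uU: "AE x in lebI l. fst (u i) x = fst (U x) \<and> snd (u i) x = snd (U x)"
      by (rule domN_bsol[OF l gc hc sc ui(1) zero_L2 ui(2)])
    have "bsol l ?A (\<lambda>_. 0) (\<lambda>x. 0) 0 (\<lambda>x. map_both Re (U x)) (map_both Re b)"
      using bsol_map_both[OF bounded_linear_Re gc hc U[unfolded dint_source_zero]] by (simp add: map_both_def zero_prod_def)
    moreover have "AE x in lebI l. fst (u i) x = of_real (fst (map_both Re (U x))) \<and> snd (u i) x = of_real (snd (map_both Re (U x)))"
      using uU u_real[OF i, unfolded real_valued_def]
    proof eventually_elim
      case (elim x)
      then show ?case by (simp add: map_both_def of_real_Re)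
    qed
    ultimately have "Pr i (\<lambda>x. map_both Re (U x), map_both Re b)" by (simp add: Pr_def)
    then show ?thesis by (rule exI)
  qed
  define p where "p i = (SOME p. Pr i p)" for i
  have p: "Pr i (p i)" if "i < n" for i unfolding p_def by (rule someI_ex[OF Pr[OF that]])
  define y where "y i = fst (p i)" for i
  define a where "a i = snd (p i)" for i
  have ker: "bsol l ?A (\<lambda>_. 0) (\<lambda>x. 0) 0 (y i) (a i)"
    and uy: "AE x in lebI l. fst (u i) x = of_real (fst (y i x)) \<and> snd (u i) x = of_real (snd (y i x))" if "i < n" for i
    using p[OF that] by (simp_all add: Pr_def y_def a_def)
  have "AE x in lebI l. \<forall>i\<in>{..<n}. fst (u i) x = of_real (fst (y i x)) \<and> snd (u i) x = of_real (snd (y i x))"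
    using uy by (subst AE_finite_all) auto
  then have uy': "AE x in lebI l. \<forall>i<n. fst (u i) x = of_real (fst (y i x)) \<and> snd (u i) x = of_real (snd (y i x))"
    by (simp add: Ball_def)
  define V where "V c x = (\<Sum>i<n. c i *\<^sub>R y i x)" for c x
  have V: "bsol l ?A (\<lambda>_. 0) (\<lambda>x. 0) 0 (V c) (\<Sum>i<n. c i *\<^sub>R a i)" for c
    using v.bsol_sum[OF Z finite_lessThan v.bsol_scale[OF Z ker], of n "\<lambda>i. i" c]
    by (simp add: V_def[abs_def])
  have Vc: "continuous_on {0..l} (V c)" for c using V[of c] by (simp add: bsol_def sol_def)
  have indep: "\<forall>i<n. c i = 0" if "(\<Sum>i<n. c i *\<^sub>R a i) = 0" for c
  proof -
    have V0: "V c x = 0" if "x \<in> {0..l}" for x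
      using v.bsol_slope_zero[of _ _ "V c" x] V[of c] that \<open>(\<Sum>i<n. c i *\<^sub>R a i) = 0\<close> by metis
    have "aeq l (lin_comb n (\<lambda>i. of_real (c i)) u) ?z"
      unfolding aeq_def using uy' AE_space
    proof eventually_elim
      case (elim x)
      have "V c x = 0" using elim by (intro V0) auto
      then have "fst (V c x) = 0" "snd (V c x) = 0" by simp_all
      then have "(\<Sum>i<n. c i * fst (y i x)) = 0" "(\<Sum>i<n. c i * snd (y i x)) = 0"
        by (simp_all add: V_def fst_sum snd_sum)
      moreover have "fst (lin_comb n (\<lambda>i. of_real (c i)) u) x = of_real (\<Sum>i<n. c i * fst (y i x))"
        "snd (lin_comb n (\<lambda>i. of_real (c i)) u) x = of_real (\<Sum>i<n. c i * snd (y i x))"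
        using elim by (simp_all add: lin_comb_def)
      ultimately show ?case by simp
    qed
    then have "\<forall>i<n. complex_of_real (c i) = 0" using basis unfolding is_basis_def by blast
    then show ?thesis by simp
  qed
  have span: "\<exists>c. b = (\<Sum>i<n. c i *\<^sub>R a i) \<and> (\<forall>x\<in>{0..l}. U x = (\<Sum>i<n. c i *\<^sub>R y i x))"
    if b: "bsol l ?A (\<lambda>_. 0) (\<lambda>x. 0) 0 U b" for U b
  proof -
    define W where "W x = map_both complex_of_real (U x)" for x
    have "bsol l ?A (\<lambda>_. 0) (dint (source ?z)) 0 W (map_both of_real b)"
      using bsol_map_both[OF bounded_linear_of_real gc hc b] by (simp add: W_def[abs_def] map_both_def zero_prod_def dint_source_zero)
    note w = bsol_domN[OF l gc hc sc zero_L2 this]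
    then have "(\<lambda>x. fst (W x), \<lambda>x. snd (W x)) \<in> kernel l (domN l) (shift (Nop l g h s) (of_real m))"
      by (simp add: kernel_def)
    then obtain c where c: "aeq l (\<lambda>x. fst (W x), \<lambda>x. snd (W x)) (lin_comb n c u)"
      using basis unfolding is_basis_def by blast
    let ?c = "\<lambda>i. Re (c i)"
    have ae: "AE x in lebI l. U x = V ?c x"
      using c[unfolded aeq_def] uy'
    proof eventually_elim
      case (elim x)
      have "complex_of_real (fst (U x)) = (\<Sum>k<n. c k * of_real (fst (y k x)))"
        "complex_of_real (snd (U x)) = (\<Sum>k<n. c k * of_real (snd (y k x)))"
        using elim by (simp_all add: W_def map_both_def lin_comb_def)
      then have "Re (complex_of_real (fst (U x))) = (\<Sum>k<n. ?c k * fst (y k x))"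
        "Re (complex_of_real (snd (U x))) = (\<Sum>k<n. ?c k * snd (y k x))"
        by (simp_all only: Re_sum) simp_all
      then show ?case by (simp add: prod_eq_iff V_def fst_sum snd_sum)
    qed
    have Uc: "continuous_on {0..l} U" using b by (simp add: bsol_def sol_def)
    have UV: "U x = V ?c x" if "x \<in> {0..l}" for x
      using continuous_AE_eq[OF ae Uc Vc l that] .
    have "bsol l ?A (\<lambda>_. 0) (\<lambda>x. 0) 0 (\<lambda>x. U x + (-1) *\<^sub>R V ?c x) (b + (-1) *\<^sub>R (\<Sum>i<n. ?c i *\<^sub>R a i))"
      using v.bsol_add[OF Z b v.bsol_scale[OF Z V, of "-1" ?c]] by simp
    from v.bsol_zero_slope[OF this] UV have "b = (\<Sum>i<n. ?c i *\<^sub>R a i)" by simp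
    then show ?thesis using UV by (auto simp: V_def intro!: exI[of _ ?c])
  qed
  show ?thesis
  proof (rule that[of y a])
    show "\<forall>i<n. bsol l ?A (\<lambda>_. 0) (\<lambda>x. 0) 0 (y i) (a i)" using ker by simp
    show "\<forall>c. (\<Sum>i<n. c i *\<^sub>R a i) = 0 \<longrightarrow> (\<forall>i<n. c i = 0)" using indep by blast
    show "\<forall>U b. bsol l ?A (\<lambda>_. 0) (\<lambda>x. 0) 0 U b \<longrightarrow>
      (\<exists>c. b = (\<Sum>i<n. c i *\<^sub>R a i) \<and> (\<forall>x\<in>{0..l}. U x = (\<Sum>i<n. c i *\<^sub>R y i x)))"
      using span by (intro allI impI)
    show "\<forall>i<n. AE x in lebI l. fst (u i) x = of_real (fst (y i x)) \<and> snd (u i) x = of_real (snd (y i x))"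
      using uy by simp
  qed
qed

lemma ip_representatives:
  assumes f: "AE x in lebI l. f x = F x" and w: "AE x in lebI l. w x = of_real (W x)"
    and F: "continuous_on {0..l} F" and W: "continuous_on {0..l} W" and m: "f \<in> L2 l" "w \<in> L2 l"
  shows "ip l f w = integral {0..l} (\<lambda>x. F x * of_real (W x))"
proof -
  have "(LINT x|lebI l. f x * cnj (w x)) = (LINT x|lebI l. F x * of_real (W x))"
  proof (rule integral_cong_AE)
    have [measurable]: "cnj \<in> borel_measurable borel"
      by (intro borel_measurable_continuous_onI continuous_intros)
    have [measurable]: "f \<in> borel_measurable (lebI l)" "w \<in> borel_measurable (lebI l)" using m by (auto simp: L2_def)
    show "(\<lambda>x. f x * cnj (w x)) \<in> borel_measurable (lebI l)" by measurable
    show "(\<lambda>x. F x * of_real (W x)) \<in> borel_measurable (lebI l)"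
      by (intro measurable_lebI continuous_intros F W)
    show "AE x in lebI l. f x * cnj (w x) = F x * of_real (W x)"
      using f w by eventually_elim simp
  qed
  then show ?thesis unfolding ip_def
    by (simp add: integral_lebI(1) integrable_lebI continuous_intros F W)
qed

section \<open>The reduction theorem\<close>

lemma pairing_sum:
  fixes n :: nat
  assumes "\<And>k. k < n \<Longrightarrow> continuous_on {0..l} (y k)" "continuous_on {0..l} v"
  shows "pairing l (\<lambda>x. \<Sum>k<n. c k *\<^sub>R y k x) v = (\<Sum>k<n. c k * pairing l (y k) v)"
proof -
  have "pairing l (\<lambda>x. \<Sum>k<n. c k *\<^sub>R y k x) v
      = integral {0..l} (\<lambda>x. \<Sum>k<n. c k * (fst (y k x) * snd (v x) + snd (y k x) * fst (v x)))"
    unfolding pairing_def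
    by (intro integral_cong) (simp add: fst_sum snd_sum sum_distrib_left sum_distrib_right sum.distrib algebra_simps)
  also have "\<dots> = (\<Sum>k<n. integral {0..l} (\<lambda>x. c k * (fst (y k x) * snd (v x) + snd (y k x) * fst (v x))))"
    using assms by (intro integral_sum integrable_continuous_interval continuous_intros) auto
  finally show ?thesis by (simp add: pairing_def)
qed

lemma complex_pairing:
  fixes X :: "real \<Rightarrow> complex \<times> complex" and v :: "real \<Rightarrow> real \<times> real"
  assumes X: "continuous_on {0..l} X" and v: "continuous_on {0..l} v"
  shows "integral {0..l} (\<lambda>x. fst (X x) * of_real (snd (v x))) + integral {0..l} (\<lambda>x. snd (X x) * of_real (fst (v x)))
    = Complex (pairing l (\<lambda>x. map_both Re (X x)) v) (pairing l (\<lambda>x. map_both Im (X x)) v)"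
proof -
  let ?f = "\<lambda>x. fst (X x) * of_real (snd (v x)) + snd (X x) * of_real (fst (v x))"
  have i: "(\<lambda>x. fst (X x) * complex_of_real (snd (v x))) integrable_on {0..l}"
     "(\<lambda>x. snd (X x) * complex_of_real (fst (v x))) integrable_on {0..l}"
    by (intro integrable_continuous_interval continuous_intros X v)+
  have f: "?f integrable_on {0..l}" by (rule integrable_add[OF i])
  have "Re (integral {0..l} ?f) = pairing l (\<lambda>x. map_both Re (X x)) v"
    using integral_linear[OF f bounded_linear_Re] by (simp add: comp_def pairing_def map_both_def)
  moreover have "Im (integral {0..l} ?f) = pairing l (\<lambda>x. map_both Im (X x)) v"
    using integral_linear[OF f bounded_linear_Im] by (simp add: comp_def pairing_def map_both_def)
  ultimately show ?thesis by (simp add: integral_add[OF i, symmetric] complex_eq_iff)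
qed

lemma bsol_cong:
  assumes "\<And>x. x \<in> {0..l} \<Longrightarrow> P x = Q x"
  shows "bsol l A Z P \<zeta> U a \<longleftrightarrow> bsol l A Z Q \<zeta> U a"
  using sol_cong[of l "\<lambda>x. x *\<^sub>R a + P x" "\<lambda>x. x *\<^sub>R a + Q x" A U] assms by (simp add: bsol_def)

lemma det_eq_0_iff_left:
  fixes M :: "nat \<Rightarrow> nat \<Rightarrow> real"
  shows "Determinant.det (mat n n (\<lambda>(i, j). M i j)) = 0 \<longleftrightarrow>
    (\<exists>c. (\<exists>i<n. c i \<noteq> 0) \<and> (\<forall>j<n. (\<Sum>i<n. c i * M i j) = 0))" (is "Determinant.det ?M = 0 \<longleftrightarrow> ?ex")
proof -
  have T: "transpose_mat ?M \<in> carrier_mat n n" by simp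
  have "Determinant.det ?M = Determinant.det (transpose_mat ?M)" by (rule Determinant.det_transpose[symmetric, of _ n]) simp
  also have "\<dots> = 0 \<longleftrightarrow> (\<exists>v\<in>carrier_vec n. v \<noteq> 0\<^sub>v n \<and> transpose_mat ?M *\<^sub>v v = 0\<^sub>v n)"
    using det_0_iff_vec_prod_zero[OF T] by blast
  also have "\<dots> \<longleftrightarrow> ?ex"
  proof
    assume "\<exists>v\<in>carrier_vec n. v \<noteq> 0\<^sub>v n \<and> transpose_mat ?M *\<^sub>v v = 0\<^sub>v n"
    then obtain v where v: "v \<in> carrier_vec n" "v \<noteq> 0\<^sub>v n" and 0: "transpose_mat ?M *\<^sub>v v = 0\<^sub>v n" by blast
    have "\<exists>i<n. v $ i \<noteq> 0" using v by (auto simp: vec_eq_iff)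
    moreover have "(\<Sum>i<n. v $ i * M i j) = 0" if "j < n" for j
    proof -
      have "(transpose_mat ?M *\<^sub>v v) $ j = 0" using 0 that by simp
      then show ?thesis using that v by (simp add: scalar_prod_def lessThan_atLeast0 mult.commute)
    qed
    ultimately show ?ex by (intro exI[of _ "\<lambda>i. v $ i"]) auto
  next
    assume ?ex
    then obtain c where c: "\<exists>i<n. c i \<noteq> 0" and 0: "\<And>j. j < n \<Longrightarrow> (\<Sum>i<n. c i * M i j) = 0" by blast
    have "transpose_mat ?M *\<^sub>v vec n c = 0\<^sub>v n"
      by (rule eq_vecI) (simp_all add: scalar_prod_def 0[unfolded lessThan_atLeast0] mult.commute)
    moreover have "vec n c \<noteq> 0\<^sub>v n" using c by (auto simp: vec_eq_iff)
    ultimately show "\<exists>v\<in>carrier_vec n. v \<noteq> 0\<^sub>v n \<and> transpose_mat ?M *\<^sub>v v = 0\<^sub>v n"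
      by (intro bexI[of _ "vec n c"]) auto
  qed
  finally show ?thesis .
qed

theorem proposition4p2:
  fixes l l' s0 lam0 :: real and g h :: "real \<Rightarrow> real"
    and n :: nat and u :: "nat \<Rightarrow> vfun"
  assumes l_pos: "0 < l"
    and l': "l \<le> l'" "s0 = 1 \<Longrightarrow> l < l'"
    and C2: "C2_on 0 l' g" "C2_on 0 l' h"
    and s0: "0 < s0" "s0 \<le> 1"
    and basis: "is_basis l (kernel l (domN l) (shift (Nop l g h s0) (of_real (s0\<^sup>2 * lam0)))) n u"
    and u_real: "\<And>i. i < n \<Longrightarrow> real_valued l (u i)"
  shows "\<exists>M :: real \<Rightarrow> real \<Rightarrow> real mat.
    (\<forall>t s. M t s \<in> carrier_mat n n) \<and>
    (\<forall>\<^sub>F (t, s) in nhds (lam0, s0).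
        of_real (s\<^sup>2 * t) \<in> Spec l (domN l) (Nop l g h s) \<longleftrightarrow> Determinant.det (M t s) = 0) \<and>
    M lam0 s0 = 0\<^sub>m n n \<and>
    (\<forall>i<n. \<forall>j<n.
        ((\<lambda>t. complex_of_real (M t s0 $$ (i, j))) has_vector_derivative
           - of_real (s0\<^sup>2) * ip2 l (u i) (Smat (u j))) (at lam0) \<and>
        ((\<lambda>s. complex_of_real (M lam0 s $$ (i, j))) has_vector_derivative
           ip2 l (shift (dsB g h s0) (of_real (2 * s0 * lam0)) (u i)) (Smat (u j))) (at s0)) \<and>
    ((\<forall>i<n. \<forall>j<n. ip2 l (u i) (Smat (u j)) = 0) \<longrightarrow>
      (\<forall>i<n.
        (\<exists>v\<in>domN l. aeq l (shift (Nop l g h s0) (of_real (s0\<^sup>2 * lam0)) v) (u i)) \<and>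
        (\<forall>v\<in>domN l. aeq l (shift (Nop l g h s0) (of_real (s0\<^sup>2 * lam0)) v) (u i) \<longrightarrow>
          (\<forall>j<n. \<exists>D :: real \<Rightarrow> real.
            (\<forall>\<^sub>F t in nhds lam0. ((\<lambda>t. M t s0 $$ (i, j)) has_real_derivative D t) (at t)) \<and>
            ((\<lambda>t. complex_of_real (D t)) has_vector_derivative
               - 2 * of_real (s0 ^ 4) * ip2 l v (Smat (u j))) (at lam0)))))"
proof -
  define dg where "dg x = 2 * s0 * g (s0 * x) + s0\<^sup>2 * x * deriv g (s0 * x)" for x
  define dh where "dh x = 2 * s0 * h (s0 * x) + s0\<^sup>2 * x * deriv h (s0 * x)" for x
  obtain \<delta>g Lg where G: "0 < \<delta>g" "0 \<le> Lg"
    "\<forall>s. \<bar>s - s0\<bar> \<le> \<delta>g \<longrightarrow> continuous_on {0..l} (scaled g s)"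
    "\<forall>s. \<forall>x\<in>{0..l}. \<bar>s - s0\<bar> \<le> \<delta>g \<longrightarrow> \<bar>scaled g s x - scaled g s0 x\<bar> \<le> Lg * \<bar>s - s0\<bar>"
    "continuous_on {0..l} dg"
    "\<forall>v. continuous_on {0..l} v \<longrightarrow> ((\<lambda>s. integral {0..l} (\<lambda>x. scaled g s x * v x)) has_real_derivative
        integral {0..l} (\<lambda>x. dg x * v x)) (at s0)"
    unfolding dg_def by (rule C2_scaled_family[OF l_pos l' C2(1) s0])
  obtain \<delta>h Lh where H: "0 < \<delta>h" "0 \<le> Lh"
    "\<forall>s. \<bar>s - s0\<bar> \<le> \<delta>h \<longrightarrow> continuous_on {0..l} (scaled h s)"
    "\<forall>s. \<forall>x\<in>{0..l}. \<bar>s - s0\<bar> \<le> \<delta>h \<longrightarrow> \<bar>scaled h s x - scaled h s0 x\<bar> \<le> Lh * \<bar>s - s0\<bar>"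
    "continuous_on {0..l} dh"
    "\<forall>v. continuous_on {0..l} v \<longrightarrow> ((\<lambda>s. integral {0..l} (\<lambda>x. scaled h s x * v x)) has_real_derivative
        integral {0..l} (\<lambda>x. dh x * v x)) (at s0)"
    unfolding dh_def by (rule C2_scaled_family[OF l_pos l' C2(2) s0])
  define \<mu> where "\<mu> = s0\<^sup>2 * lam0"
  have gc: "continuous_on {0..l} (scaled g s0)" and hc: "continuous_on {0..l} (scaled h s0)"
    using G(1,3) H(1,3) by auto
  have sc: "scaled g s = (\<lambda>x. s\<^sup>2 * g (s * x))" "scaled h s = (\<lambda>x. s\<^sup>2 * h (s * x))" for s
    by (simp_all add: fun_eq_iff scaled_def)
  let ?A = "coef (scaled g s0) (scaled h s0) \<mu>"
  obtain y a where ker: "\<forall>i<n. bsol l ?A (\<lambda>_. 0) (\<lambda>x. 0) 0 (y i) (a i :: real \<times> real)"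
    and indep: "\<forall>c. (\<Sum>i<n. c i *\<^sub>R a i) = 0 \<longrightarrow> (\<forall>i<n. c i = 0)"
    and span: "\<forall>U b. bsol l ?A (\<lambda>_. 0) (\<lambda>x. 0) 0 U b \<longrightarrow>
      (\<exists>c. b = (\<Sum>i<n. c i *\<^sub>R a i) \<and> (\<forall>x\<in>{0..l}. U x = (\<Sum>i<n. c i *\<^sub>R y i x)))"
    and uy: "\<forall>i<n. AE x in lebI l. fst (u i) x = of_real (fst (y i x)) \<and> snd (u i) x = of_real (snd (y i x))"
    unfolding \<mu>_def by (rule kernel_real_basis[OF l_pos gc hc basis u_real])
  have sysA: "sys g h lam0 s0 = ?A" by (simp add: sys_def \<mu>_def)
  have lip: "c * d \<le> max c c' * d" "c' * d \<le> max c c' * d" if "0 \<le> d" for c c' d :: real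
    using that by (auto intro: mult_right_mono)
  interpret kb: kernel_basis l s0 lam0 "min \<delta>g \<delta>h" "max Lg Lh" g h dg dh n y a
  proof (unfold_locales, goal_cases)
    case (6 s x)
    then show ?case using G(4) order_trans[OF _ lip(1)[of "\<bar>s - s0\<bar>" Lg Lh]] by simp
  next
    case (7 s x)
    then show ?case using H(4) order_trans[OF _ lip(2)[of "\<bar>s - s0\<bar>" Lh Lg]] by simp
  next
    case (11 c)
    then show ?case using indep by blast
  next
    case (12 U b)
    then show ?case using span unfolding sysA by blast
  next
    case 1
    show ?case by (rule l_pos)
  next
    case 2
    show ?case using G(1) H(1) by simp
  next
    case 3
    show ?case using G(2) by simp
  next
    case (4 s)
    then show ?case using G(3) by simp
  next
    case (5 s)
    then show ?case using H(3) by simp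
  next
    case (8 v)
    then show ?case using G(6) by blast
  next
    case (9 v)
    then show ?case using H(6) by blast
  next
    case (10 i)
    then show ?case using ker unfolding sysA by blast
  qed
  obtain Z \<epsilon> K where Z: "linear Z" "\<forall>i<n. Z (a i) = kb.\<beta> i" "\<forall>v. \<exists>c. Z v = (\<Sum>i<n. c i *\<^sub>R kb.\<beta> i)"
    and \<epsilon>: "0 < \<epsilon>" "\<epsilon> \<le> min \<delta>g \<delta>h"
    and wp: "\<forall>t s. \<bar>t - lam0\<bar> \<le> \<epsilon> \<longrightarrow> \<bar>s - s0\<bar> \<le> \<epsilon> \<longrightarrow> well_posed l (sys g h t s) Z K"
    by (rule kb.bordered_exists)
  define p where "p i t s = (SOME p. bsol l (sys g h t s) Z (\<lambda>x. 0) (kb.\<beta> i) (fst p) (snd p))" for i t s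
  have \<Phi>: "bsol l (sys g h t s) Z (\<lambda>x. 0) (kb.\<beta> i) (fst (p i t s)) (snd (p i t s))"
    if near: "\<bar>t - lam0\<bar> \<le> \<epsilon>" "\<bar>s - s0\<bar> \<le> \<epsilon>" for i t s
  proof -
    have "well_posed l (sys g h t s) Z K" using wp near by blast
    then obtain U b where "bsol l (sys g h t s) Z (\<lambda>x. 0) (kb.\<beta> i) U b"
      using well_posed_solvable[OF _ continuous_on_const] by blast
    then have "\<exists>p. bsol l (sys g h t s) Z (\<lambda>x. 0) (kb.\<beta> i) (fst p) (snd p)"
      by (intro exI[of _ "(U, b)"]) simp
    then show ?thesis unfolding p_def by (rule someI_ex)
  qed
  interpret b: bordered l s0 lam0 "min \<delta>g \<delta>h" "max Lg Lh" g h dg dh n y a Z \<epsilon> K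
    "\<lambda>i t s. fst (p i t s)" "\<lambda>i t s. snd (p i t s)"
  proof (intro bordered.intro bordered_axioms.intro, goal_cases)
    case 1
    show ?case by (rule kb.kernel_basis_axioms)
  next
    case 2
    show ?case by (rule Z(1))
  next
    case (3 i)
    then show ?case using Z(2) by blast
  next
    case (4 v)
    show ?case using Z(3) by blast
  next
    case 5
    show ?case by (rule \<epsilon>(1))
  next
    case 6
    show ?case by (rule \<epsilon>(2))
  next
    case (7 t s)
    then show ?case using wp by blast
  next
    case (8 i t s)
    then show ?case by (intro \<Phi>)
  qed
  define M where "M t s = mat n n (\<lambda>(i, j). b.M i j t s)" for t s
  have Mij: "M t s $$ (i, j) = b.M i j t s" if "i < n" "j < n" for i j t s using that by (simp add: M_def)
  have yc: "continuous_on {0..l} (y i)" if "i < n" for i using kb.yc that by blast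
  have uL: "fst (u i) \<in> L2 l" "snd (u i) \<in> L2 l" and udom: "u i \<in> domN l" if "i < n" for i
    using basis that by (auto simp: is_basis_def kernel_def domN_def H2_def H1_def)
  have ip: "ip2 l v (Smat (u j)) = Complex (pairing l (\<lambda>x. map_both Re (X x)) (y j)) (pairing l (\<lambda>x. map_both Im (X x)) (y j))"
    if v: "AE x in lebI l. fst v x = fst (X x) \<and> snd v x = snd (X x)" and X: "continuous_on {0..l} X"
      and vL: "fst v \<in> L2 l" "snd v \<in> L2 l" and j: "j < n" for v X j
  proof -
    have v': "AE x in lebI l. fst v x = fst (X x)" "AE x in lebI l. snd v x = snd (X x)"
      using v by (auto elim: eventually_mono)
    have u': "AE x in lebI l. fst (u j) x = of_real (fst (y j x))" "AE x in lebI l. snd (u j) x = of_real (snd (y j x))"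
      using uy j by (auto elim: eventually_mono)
    have "ip2 l v (Smat (u j)) = integral {0..l} (\<lambda>x. fst (X x) * of_real (snd (y j x)))
        + integral {0..l} (\<lambda>x. snd (X x) * of_real (fst (y j x)))"
      unfolding ip2_def Smat_def fst_conv snd_conv
      by (intro arg_cong2[of _ _ _ _ "(+)"] ip_representatives v' u' vL uL j continuous_on_fst continuous_on_snd X yc)
    then show ?thesis by (simp add: complex_pairing[OF X yc[OF j]])
  qed
  have ip_real: "ip2 l v (Smat (u j)) = of_real (pairing l X (y j))"
    if v: "AE x in lebI l. fst v x = of_real (fst (X x)) \<and> snd v x = of_real (snd (X x))" and X: "continuous_on {0..l} X"
      and vL: "fst v \<in> L2 l" "snd v \<in> L2 l" and j: "j < n" for v X j
  proof -
    have "continuous_on {0..l} (\<lambda>x. map_both complex_of_real (X x))" unfolding map_both_def by (intro continuous_intros X)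
    from ip[OF _ this vL j] v show ?thesis by (simp add: map_both_def pairing_def complex_eq_iff)
  qed
  have ipuu: "ip2 l (u i) (Smat (u j)) = of_real (pairing l (y i) (y j))" if "i < n" "j < n" for i j
    using uy that by (intro ip_real yc uL) auto
  have spectrum: "\<forall>\<^sub>F (t, s) in nhds (lam0, s0).
        of_real (s\<^sup>2 * t) \<in> Spec l (domN l) (Nop l g h s) \<longleftrightarrow> Determinant.det (M t s) = 0"
  proof -
    have "open ({lam0 - \<epsilon><..<lam0 + \<epsilon>} \<times> {s0 - \<epsilon><..<s0 + \<epsilon>})" by (intro open_Times) auto
    then have "\<forall>\<^sub>F p in nhds (lam0, s0). p \<in> {lam0 - \<epsilon><..<lam0 + \<epsilon>} \<times> {s0 - \<epsilon><..<s0 + \<epsilon>}"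
      using \<epsilon> by (intro eventually_nhds_in_open) auto
    then show ?thesis
    proof (rule eventually_mono, safe)
      fix t s assume ts: "t \<in> {lam0 - \<epsilon><..<lam0 + \<epsilon>}" "s \<in> {s0 - \<epsilon><..<s0 + \<epsilon>}"
      then have near: "\<bar>t - lam0\<bar> \<le> \<epsilon> \<and> \<bar>s - s0\<bar> \<le> \<epsilon>" by auto
      then have cont: "continuous_on {0..l} (scaled g s)" "continuous_on {0..l} (scaled h s)"
        using \<epsilon> G(3) H(3) by auto
      have "of_real (s\<^sup>2 * t) \<in> Spec l (domN l) (Nop l g h s) \<longleftrightarrow>
          (\<exists>U b. bsol l (sys g h t s) (\<lambda>_. 0) (\<lambda>x. 0) 0 U b \<and> b \<noteq> 0)"
        using Spec_iff_bsol[OF l_pos cont[unfolded sc], of "s\<^sup>2 * t"] unfolding sys_def sc .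
      also have "\<dots> \<longleftrightarrow> Determinant.det (M t s) = 0"
        unfolding M_def det_eq_0_iff_left b.singular_iff[OF near] ..
      finally have eq: "of_real (s\<^sup>2 * t) \<in> Spec l (domN l) (Nop l g h s) \<longleftrightarrow> Determinant.det (M t s) = 0" .
      show "Determinant.det (M t s) = 0" if "of_real (s\<^sup>2 * t) \<in> Spec l (domN l) (Nop l g h s)" using eq that by blast
      show "of_real (s\<^sup>2 * t) \<in> Spec l (domN l) (Nop l g h s)" if "Determinant.det (M t s) = 0" using eq that by blast
    qed
  qed
  have base: "M lam0 s0 = 0\<^sub>m n n"
    by (rule eq_matI) (auto simp: M_def b.M_base)
  have first_t: "((\<lambda>t. complex_of_real (M t s0 $$ (i, j))) has_vector_derivative
           - of_real (s0\<^sup>2) * ip2 l (u i) (Smat (u j))) (at lam0)" if ij: "i < n" "j < n" for i j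
  proof -
    have "((\<lambda>t. b.M i j t s0) has_real_derivative - (s0\<^sup>2 * pairing l (y i) (y j))) (at lam0)"
      using b.M_derivative_t[OF ij, of lam0] \<epsilon> b.dM_base[OF ij(1)] by simp
    from has_vector_derivative_of_real[OF this]
    show ?thesis using ij by (simp add: Mij ipuu)
  qed
  have first_s: "((\<lambda>s. complex_of_real (M lam0 s $$ (i, j))) has_vector_derivative
           ip2 l (shift (dsB g h s0) (of_real (2 * s0 * lam0)) (u i)) (Smat (u j))) (at s0)" if ij: "i < n" "j < n" for i j
  proof -
    let ?v = "shift (dsB g h s0) (of_real (2 * s0 * lam0)) (u i)"
    define X where "X x = (dh x * snd (y i x) - 2 * s0 * lam0 * fst (y i x), - (dg x * fst (y i x)) - 2 * s0 * lam0 * snd (y i x))" for x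
    have vx: "fst ?v = (\<lambda>x. of_real (dh x) * snd (u i) x - of_real (2 * s0 * lam0) * fst (u i) x)"
      "snd ?v = (\<lambda>x. (- of_real (dg x)) * fst (u i) x - of_real (2 * s0 * lam0) * snd (u i) x)"
      by (simp_all add: shift_def dsB_def dg_def dh_def fun_eq_iff)
    have "AE x in lebI l. fst ?v x = of_real (fst (X x)) \<and> snd ?v x = of_real (snd (X x))"
      using uy[rule_format, OF ij(1)] unfolding vx by eventually_elim (simp add: X_def)
    moreover have "continuous_on {0..l} X"
      unfolding X_def by (intro continuous_intros G H yc ij)
    moreover have "fst ?v \<in> L2 l" "snd ?v \<in> L2 l"
      unfolding vx by (intro L2_diff L2_mult uL ij continuous_intros G H)+
    ultimately have ipv: "ip2 l ?v (Smat (u j)) = of_real (pairing l X (y j))" using ij by (intro ip_real)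
    have i: "(\<lambda>x. dh x * (snd (y i x) * snd (y j x))) integrable_on {0..l}"
      "(\<lambda>x. dg x * (fst (y i x) * fst (y j x))) integrable_on {0..l}"
      "(\<lambda>x. 2 * s0 * lam0 * (fst (y i x) * snd (y j x) + snd (y i x) * fst (y j x))) integrable_on {0..l}"
      by (intro integrable_continuous_interval continuous_intros G H yc ij)+
    have "pairing l X (y j) = integral {0..l} (\<lambda>x. dh x * (snd (y i x) * snd (y j x)) - dg x * (fst (y i x) * fst (y j x))
        - 2 * s0 * lam0 * (fst (y i x) * snd (y j x) + snd (y i x) * fst (y j x)))"
      unfolding pairing_def by (intro integral_cong) (simp add: X_def algebra_simps)
    also have "\<dots> = integral {0..l} (\<lambda>x. dh x * (snd (y i x) * snd (y j x))) - integral {0..l} (\<lambda>x. dg x * (fst (y i x) * fst (y j x)))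
        - integral {0..l} (\<lambda>x. 2 * s0 * lam0 * (fst (y i x) * snd (y j x) + snd (y i x) * fst (y j x)))"
      by (simp add: integral_diff integrable_diff i del: integral_mult_right)
    also have "integral {0..l} (\<lambda>x. 2 * s0 * lam0 * (fst (y i x) * snd (y j x) + snd (y i x) * fst (y j x)))
        = 2 * s0 * lam0 * pairing l (y i) (y j)" by (simp only: pairing_def integral_mult_right)
    finally have "((\<lambda>s. b.M i j lam0 s) has_real_derivative pairing l X (y j)) (at s0)"
      using b.M_derivative_s[OF ij] by simp
    from has_vector_derivative_of_real[OF this]
    show ?thesis unfolding ipv Mij[OF ij] .
  qed
  have second: "(\<exists>v\<in>domN l. aeq l (shift (Nop l g h s0) (of_real (s0\<^sup>2 * lam0)) v) (u i)) \<and>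
        (\<forall>v\<in>domN l. aeq l (shift (Nop l g h s0) (of_real (s0\<^sup>2 * lam0)) v) (u i) \<longrightarrow>
          (\<forall>j<n. \<exists>D :: real \<Rightarrow> real.
            (\<forall>\<^sub>F t in nhds lam0. ((\<lambda>t. M t s0 $$ (i, j)) has_real_derivative D t) (at t)) \<and>
            ((\<lambda>t. complex_of_real (D t)) has_vector_derivative
               - 2 * of_real (s0 ^ 4) * ip2 l v (Smat (u j))) (at lam0)))"
    if orth: "\<forall>i<n. \<forall>j<n. ip2 l (u i) (Smat (u j)) = 0" and i: "i < n" for i
  proof -
    have pair0: "pairing l (y k) (y j) = 0" if "k < n" "j < n" for k j using orth ipuu that by simp
    obtain C where "volterra (?A :: real \<Rightarrow> real \<times> real \<Rightarrow> _) l C" by (rule volterra_coef[OF l_pos gc hc])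
    then interpret v: volterra "?A :: real \<Rightarrow> real \<times> real \<Rightarrow> _" l C .
    note Z0 = linear_const_zero[where 'a = "real \<times> real" and 'b = "real \<times> real"]
    have hom0: "pairing l U (y j) = 0" if U: "bsol l ?A (\<lambda>_. 0) (\<lambda>x. 0) 0 U b" and j: "j < n" for U b j
    proof -
      obtain c where c: "\<forall>x\<in>{0..l}. U x = (\<Sum>k<n. c k *\<^sub>R y k x)" using span U by blast
      have "pairing l U (y j) = pairing l (\<lambda>x. \<Sum>k<n. c k *\<^sub>R y k x) (y j)" using c by (intro pairing_cong) blast
      also have "\<dots> = (\<Sum>k<n. c k * pairing l (y k) (y j))" by (intro pairing_sum yc j)
      finally show ?thesis using pair0 j by simp
    qed
    define V where "V x = (1 / s0\<^sup>2) *\<^sub>R b.\<Psi> i lam0 x" for x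
    obtain b where "csol l ?A (\<lambda>_. 0) (\<lambda>x. s0\<^sup>2 *\<^sub>R rot (y i x)) 0 (b.\<Psi> i lam0) b"
      using b.\<Psi>_boundary[OF i] pair0 i unfolding sysA by blast
    from v.csol_scale[OF Z0 this, of "1 / s0\<^sup>2"]
    have "csol l ?A (\<lambda>_. 0) (\<lambda>x. rot (y i x)) 0 V ((1 / s0\<^sup>2) *\<^sub>R b)"
      unfolding V_def[abs_def] by (rule csol_cong) (use s0 in simp_all)
    then have V: "bsol l ?A (\<lambda>_. 0) (dint (\<lambda>x. rot (y i x))) 0 V ((1 / s0\<^sup>2) *\<^sub>R b)" by (simp add: csol_def)
    have Jc: "(\<lambda>x. rot (y i x)) integrable_on {0..l}"
      by (intro integrable_continuous_interval continuous_on_rot yc i)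
    have source: "dint (source (u i)) x = map_both complex_of_real (dint (\<lambda>x. rot (y i x)) x)" if x: "x \<in> {0..l}" for x
    proof -
      have "AE x in lebI l. source (u i) x = map_both of_real (rot (y i x))"
        using uy[rule_format, OF i] by eventually_elim (simp add: source_def map_both_def rot_def)
      then have "dint (source (u i)) x = dint (\<lambda>x. map_both complex_of_real (rot (y i x))) x"
        using x by (intro dint_cong_lebI) auto
      then show ?thesis using dint_bounded_linear[OF bounded_linear_map_both[OF bounded_linear_of_real] Jc x] by simp
    qed
    have uL2: "u i \<in> L2 l \<times> L2 l" using uL[OF i] by (simp add: mem_Times_iff)
    note qr = gc hc sc[of s0]
    have "bsol l ?A (\<lambda>_. 0) (\<lambda>x. map_both complex_of_real (dint (\<lambda>x. rot (y i x)) x)) 0 (\<lambda>x. map_both complex_of_real (V x))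
        (map_both complex_of_real ((1 / s0\<^sup>2) *\<^sub>R b))"
      by (rule bsol_map_both[OF bounded_linear_of_real gc hc V])
    then have "bsol l ?A (\<lambda>_. 0) (dint (source (u i))) 0 (\<lambda>x. map_both complex_of_real (V x))
        (map_both complex_of_real ((1 / s0\<^sup>2) *\<^sub>R b))"
      by (subst bsol_cong[OF source])
    note ex = bsol_domN[OF l_pos qr uL2 this]
    have "\<exists>D :: real \<Rightarrow> real.
            (\<forall>\<^sub>F t in nhds lam0. ((\<lambda>t. M t s0 $$ (i, j)) has_real_derivative D t) (at t)) \<and>
            ((\<lambda>t. complex_of_real (D t)) has_vector_derivative
               - 2 * of_real (s0 ^ 4) * ip2 l v (Smat (u j))) (at lam0)"
      if v: "v \<in> domN l" and eq: "aeq l (shift (Nop l g h s0) (of_real (s0\<^sup>2 * lam0)) v) (u i)" and j: "j < n" for v j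
    proof -
      obtain X d where X: "bsol l ?A (\<lambda>_. 0) (dint (source (u i))) 0 X d"
        and vX: "AE x in lebI l. fst v x = fst (X x) \<and> snd v x = snd (X x)"
        by (rule domN_bsol[OF l_pos qr v uL2 eq[folded \<mu>_def]])
      have Xc: "continuous_on {0..l} X" using X by (simp add: bsol_def sol_def)
      have "bsol l ?A (\<lambda>_. 0) (dint (\<lambda>x. rot (y i x))) 0 (\<lambda>x. map_both Re (X x)) (map_both Re d)"
        using bsol_map_both[OF bounded_linear_Re gc hc X]
        by (subst (asm) bsol_cong[where Q = "dint (\<lambda>x. rot (y i x))"]) (simp_all add: source map_both_def)
      from v.bsol_add[OF Z0 this v.bsol_scale[OF Z0 V, of "-1"]]
      have "bsol l ?A (\<lambda>_. 0) (\<lambda>x. 0) 0 (\<lambda>x. map_both Re (X x) + (-1) *\<^sub>R V x) (map_both Re d + (-1) *\<^sub>R (1 / s0\<^sup>2) *\<^sub>R b)"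
        by simp
      then have "pairing l (\<lambda>x. map_both Re (X x) - V x) (y j) = 0" using hom0[OF _ j] by fastforce
      moreover have "continuous_on {0..l} (\<lambda>x. map_both Re (X x))" "continuous_on {0..l} V"
        using V Xc by (auto simp: map_both_def bsol_def sol_def intro!: continuous_intros)
      ultimately have re: "pairing l (\<lambda>x. map_both Re (X x)) (y j) = pairing l V (y j)"
        by (simp add: pairing_diff yc[OF j])
      have "bsol l ?A (\<lambda>_. 0) (\<lambda>x. 0) 0 (\<lambda>x. map_both Im (X x)) (map_both Im d)"
        using bsol_map_both[OF bounded_linear_Im gc hc X]
        by (subst (asm) bsol_cong[where Q = "\<lambda>x. 0"]) (simp_all add: source map_both_def zero_prod_def)
      then have im: "pairing l (\<lambda>x. map_both Im (X x)) (y j) = 0" using hom0[OF _ j] by blast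
      have vL: "fst v \<in> L2 l" "snd v \<in> L2 l" using v by (auto simp: domN_def H2_def H1_def)
      have "ip2 l v (Smat (u j)) = of_real (pairing l V (y j))"
        using ip[OF vX Xc vL j] re im by (simp add: complex_eq_iff)
      also have "pairing l V (y j) = pairing l (b.\<Psi> i lam0) (y j) / s0\<^sup>2"
        unfolding V_def[abs_def] pairing_scale by simp
      finally have "- 2 * of_real (s0 ^ 4) * ip2 l v (Smat (u j))
          = complex_of_real (- 2 * s0 ^ 4 * (pairing l (b.\<Psi> i lam0) (y j) / s0\<^sup>2))" by simp
      also have "- 2 * s0 ^ 4 * (pairing l (b.\<Psi> i lam0) (y j) / s0\<^sup>2) = - 2 * s0\<^sup>2 * pairing l (b.\<Psi> i lam0) (y j)"
        using s0 by (simp add: field_simps power2_eq_square power4_eq_xxxx)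
      finally have val: "- 2 * of_real (s0 ^ 4) * ip2 l v (Smat (u j))
          = complex_of_real (- 2 * s0\<^sup>2 * pairing l (b.\<Psi> i lam0) (y j))" .
      have "\<forall>\<^sub>F t in nhds lam0. t \<in> {lam0 - \<epsilon><..<lam0 + \<epsilon>}"
        using \<epsilon> by (intro eventually_nhds_in_open) auto
      then have "\<forall>\<^sub>F t in nhds lam0. ((\<lambda>t. M t s0 $$ (i, j)) has_real_derivative b.dM i j t) (at t)"
        unfolding Mij[OF i j]
        by (rule eventually_mono) (rule b.M_derivative_t[OF i j], auto)
      moreover have "((\<lambda>t. complex_of_real (b.dM i j t)) has_vector_derivative
               - 2 * of_real (s0 ^ 4) * ip2 l v (Smat (u j))) (at lam0)"
        unfolding val
        using has_vector_derivative_of_real[OF b.dM_derivative[OF i j]] .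
      ultimately show ?thesis by blast
    qed
    then show ?thesis using ex unfolding \<mu>_def by blast
  qed
  have carrier: "\<forall>t s. M t s \<in> carrier_mat n n" by (simp add: M_def)
  show ?thesis
    by (rule exI[of _ M]) (use carrier spectrum base first_t first_s second in blast)
qed

end
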